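(* Let $W, W_1,W_2,\dots$ be i.i.d. random vectors in $\mathbb{R}^m$ (with the samples $W_1,\dots,W_n$ distinct), let $h:\mathbb{R}^m\times\mathbb{R}^l\to\mathbb{R}^r$, let $\rho>1$, and assume: A1) $c(u,w)=\|u-w\|_q^\rho$ with $q\ge1$, and $p$ is such that $1/p+1/q=1$; A2) $\theta_*\in\mathbb{R}^l$ satisfies $\mathbb{E}[h(W,\theta_* )]=\mathbf 0$ and $\mathbb{E}\|h(W,\theta_* )\|_2^2<\infty$; A3) $h(\cdot,\theta_* )$ is continuously differentiable with derivative $D_wh(\cdot,\theta_* )$; A4) for each $\zeta\in\mathbb{R}^r$, $\zeta\ne0$, $\ \Pr\big(\|\zeta^TD_wh(W,\theta_* )\|_p>0\big)>0$; A5) there is $\kappa\in(0,\infty)$ such that $\|D_wh(w,\theta_* )\|_p\le\kappa\|w\|_q^{\rho-1}$ for all $w$ with $\|w\|_q\ge1$, and $\mathbb{E}\|W\|_q^\rho<\infty$; A6) there is $\bar\kappa:\mathbb{R}^m\to[0,\infty)$ such that $\|D_wh(w+\Delta,\theta_* )-D_wh(w,\theta_* )\|_p\le\bar\kappa(w)\|\Delta\|_q$ for all $w$ and all $\|\Delta\|_q\le1$, and $\mathbb{E}[\bar\kappa(W)^{c}]<\infty$ for $c\le\max\{2,\frac{\rho}{\rho-1}\}$. Let $R_n(\theta;\rho)=\inf\{\mathcal{D}_c(\mathbb{P},\mathbb{P}_n):\mathbb{E}_{\mathbb{P}}[h(W,\theta)]=\mathbf 0\}$. Then, as $n\to\infty$,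 $$n^{\rho/2}R_n(\theta_*;\rho)\Rightarrow\bar R(\rho):=\max_{\zeta\in\mathbb{R}^r}\Big\{\rho\,\zeta^TH-(\rho-1)\,\mathbb{E}\big\|\zeta^TD_wh(W,\theta_* )\big\|_p^{\rho/(\rho-1)}\Big\},$$ where $H\sim\mathcal{N}(\mathbf 0,\mathbb{E}[h(W,\theta_* )h(W,\theta_* )^T])$ and the expectation inside the maximum is over $W$ with $\zeta$ and $H$ fixed.
   Context: $\Rightarrow$ denotes convergence in distribution. $\mathbb{P}_n=\frac1n\sum_{i=1}^n\delta_{W_i}$. For a cost $c$, $\mathcal{D}_c(\mathbb{P},\mathbb{Q})=\inf\{\mathbb{E}_\pi[c(U,W)]\}$ over joint distributions $\pi$ on $\mathbb{R}^m\times\mathbb{R}^m$ with marginals $\pi_U=\mathbb{P}$, $\pi_W=\mathbb{Q}$. The infimum in $R_n$ is over Borel probability measures $\mathbb{P}$ on $\mathbb{R}^m$ (with $W\sim\mathbb{P}$ under $\mathbb{E}_{\mathbb{P}}$). $D_wh$ is the $r\times m$ Jacobian in the first argument; the norm $\|D_wh\|_p$ of this matrix in A5, A6 is a matrix norm (the choice is immaterial up to multiplicative constants in $\kappa,\bar\kappa$). In A1, $q=\infty$ (with $p=1$) is allowed. *)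

theory Defs
  imports "HOL-Probability.Probability"
begin

definition lp_norm :: "ennreal \<Rightarrow> real ^ 'n \<Rightarrow> real" where
  "lp_norm p x =
     (if p = \<infinity> then infnorm x
      else (\<Sum>i\<in>UNIV. \<bar>x $ i\<bar> powr enn2real p) powr (1 / enn2real p))"

text \<open>The operator norm of a matrix induced by the vector norm \<^const>\<open>lp_norm\<close> on both sides.
  The quotient at \<open>x = 0\<close> is \<open>0\<close> and so does not affect the supremum.\<close>

definition matrix_lp_norm :: "ennreal \<Rightarrow> real ^ 'm ^ 'r \<Rightarrow> real" where
  "matrix_lp_norm p A = (SUP x. lp_norm p (A *v x) / lp_norm p x)"

definition couplings :: "'a::topological_space measure \<Rightarrow> 'a measure \<Rightarrow> ('a \<times> 'a) measure set" where
  "couplings P Q = {\<pi>. prob_space \<pi> \<and> sets \<pi> = sets (borel \<Otimes>\<^sub>M borel) \<and>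
                       distr \<pi> borel fst = P \<and> distr \<pi> borel snd = Q}"

definition transport_cost ::
    "('a::topological_space \<Rightarrow> 'a \<Rightarrow> real) \<Rightarrow> 'a measure \<Rightarrow> 'a measure \<Rightarrow> ennreal" where
  "transport_cost c P Q = (INF \<pi>\<in>couplings P Q. \<integral>\<^sup>+z. ennreal (c (fst z) (snd z)) \<partial>\<pi>)"

definition empirical_measure :: "nat \<Rightarrow> (nat \<Rightarrow> 'a::topological_space) \<Rightarrow> 'a measure" where
  "empirical_measure n w = distr (uniform_count_measure {1..n}) borel w"

lemma emeasure_empirical_measure:
  assumes "1 \<le> n" and A: "A \<in> sets borel"
  shows "emeasure (empirical_measure n w) A = ennreal ((1 / real n) * (\<Sum>i=1..n. indicator A (w i)))"
proof -
  have w: "w \<in> measurable (uniform_count_measure {1..n}) borel"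
    by (simp add: measurable_def space_uniform_count_measure sets_uniform_count_measure)
  have "emeasure (empirical_measure n w) A
      = emeasure (uniform_count_measure {1..n}) ({1..n} \<inter> w -` A)"
    using w A by (simp add: empirical_measure_def emeasure_distr space_uniform_count_measure
        Int_commute)
  also have "\<dots> = ennreal (card ({1..n} \<inter> w -` A) / card {1..n})"
    by (rule emeasure_uniform_count_measure) auto
  also have "real (card ({1..n} \<inter> w -` A)) = (\<Sum>i=1..n. indicator A (w i))"
    by (simp add: indicator_def sum.If_cases vimage_def Int_def)
  finally show ?thesis by simp
qed

text \<open>Integrability is part of the moment constraint, because the Bochner integral of a
  non-integrable function is \<open>0\<close>. The value is \<open>\<infinity>\<close> if no measure satisfies the constraint.\<close>

definition profile_function ::
    "('a::topological_space \<Rightarrow> 'a \<Rightarrow> real) \<Rightarrow> ('a \<Rightarrow> 't \<Rightarrow> 'b::euclidean_space) \<Rightarrow>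
     nat \<Rightarrow> (nat \<Rightarrow> 'a) \<Rightarrow> 't \<Rightarrow> ennreal" where
  "profile_function c h n w \<theta> =
     (INF P\<in>{P. prob_space P \<and> sets P = sets borel \<and>
                integrable P (\<lambda>x. h x \<theta>) \<and> (\<integral>x. h x \<theta> \<partial>P) = 0}.
        transport_cost c P (empirical_measure n w))"

text \<open>The one-dimensional normal law with mean \<open>\<mu>\<close> and variance \<open>v\<close>,
  a point mass for \<open>v = 0\<close>.\<close>

definition normal_law :: "real \<Rightarrow> real \<Rightarrow> real measure" where
  "normal_law \<mu> v =
     (if v = 0 then return borel \<mu>
      else density lborel (\<lambda>x. ennreal (normal_density \<mu> (sqrt v) x)))"

text \<open>Joint normality as normality of all linear functionals; the covariance matrix may be
  singular.\<close>

definition normal_vector ::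
    "'a measure \<Rightarrow> ('a \<Rightarrow> real ^ 'r) \<Rightarrow> real ^ 'r \<Rightarrow> real ^ 'r ^ 'r \<Rightarrow> bool" where
  "normal_vector M X \<mu> \<Sigma> \<longleftrightarrow>
     prob_space M \<and> X \<in> borel_measurable M \<and>
     (\<forall>t. distr M borel (\<lambda>\<omega>. t \<bullet> X \<omega>) = normal_law (t \<bullet> \<mu>) (t \<bullet> (\<Sigma> *v t)))"

text \<open>Measurability is included, because \<^const>\<open>distr\<close> is only meaningful
  for measurable functions.\<close>

definition converges_in_distribution ::
    "'a measure \<Rightarrow> (nat \<Rightarrow> 'a \<Rightarrow> real) \<Rightarrow> 'b measure \<Rightarrow> ('b \<Rightarrow> real) \<Rightarrow> bool" where
  "converges_in_distribution M X N Y \<longleftrightarrow>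
     (\<forall>n. X n \<in> borel_measurable M) \<and> Y \<in> borel_measurable N \<and>
     weak_conv_m (\<lambda>n. distr M borel (X n)) (distr N borel Y)"

text \<open>The function maximized in the limit law: \<open>J\<close> is the random Jacobian, \<open>x\<close> the value of the
  Gaussian vector, which stays fixed while the expectation over \<open>M\<close> is taken.\<close>

definition limit_objective ::
    "'a measure \<Rightarrow> ('a \<Rightarrow> real ^ 'm ^ 'r) \<Rightarrow> ennreal \<Rightarrow> real \<Rightarrow> real ^ 'r \<Rightarrow> real ^ 'r \<Rightarrow> real" where
  "limit_objective M J p \<rho> x \<zeta> =
     \<rho> * (\<zeta> \<bullet> x) - (\<rho> - 1) * (\<integral>\<omega>. lp_norm p (\<zeta> v* J \<omega>) powr (\<rho> / (\<rho> - 1)) \<partial>M)"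

end

theory Submission
  imports Defs
begin

text \<open>A measure \<open>P\<close> coupled with the empirical measure is an average of laws \<open>\<mu> i\<close>, one per
  sample point, and \<open>\<mu> i\<close> moves the mass at \<open>w i\<close>. At displacements of order \<open>1 / sqrt n\<close> the moment
  condition linearizes. Weak duality bounds the scaled profile from below by
  \<open>\<rho> * (z \<bullet> X) + mean_value z\<close> up to a vanishing error for each multiplier \<open>z\<close>, where \<open>X\<close> is the
  normalized sum of the moments. Conversely, by compactness finitely many measurable displacement
  fields are nearly optimal for all multipliers in a ball, and linear programming duality
  mixes them so that the moment condition holds exactly. Hence the scaled profile differs from
  \<open>F X\<close> by a term vanishing in probability, where \<open>F\<close> is the supremum of the bounds over \<open>z\<close>, a finite
  convex and so continuous function. The multivariate central limit theorem follows from the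
  one-dimensional one, because polynomials in sines of the coordinates approximate bounded continuous
  functions on compact sets while staying bounded everywhere.\<close>

section \<open>Norms\<close>

text \<open>The exponent \<open>\<rho> / 2\<close> comes from the scale: with
  \<open>t = 1 / sqrt n\<close>, a displacement \<open>t *\<^sub>R d\<close> costs
  \<open>t powr \<rho>\<close> times the cost of \<open>d\<close> and changes a moment by about
  \<open>t *\<^sub>R (D w *v d)\<close>, so \<open>n\<close> such changes can balance a sum of
  centred moments, which has order \<open>sqrt n\<close>. Minimizing over \<open>d\<close> at a
  fixed sample point is then the Legendre transform of a power of a norm, which by Hoelder and Young
  is \<open>- (\<rho> - 1)\<close> times a power of the dual norm of \<open>z v* D w\<close>. The
  obstacle is that displacements and multipliers both range over unbounded sets. Growth condition A5
  tames large displacements: the moment then grows at most like the cost, with an extra factor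
  \<open>t powr (\<rho> - 1)\<close> that vanishes. Condition A4 tames large multipliers: it makes
  \<open>mean_value\<close> negative off the origin, and homogeneity of degree
  \<open>\<rho> / (\<rho> - 1) > 1\<close> lets it beat the linear term. Only then do finite covers
  suffice, of multipliers by displacement fields for the upper bound and of values of
  \<open>X\<close> by multipliers for the lower one.\<close>

lemma lp_norm_top: "lp_norm \<top> x = infnorm x"
  by (simp add: lp_norm_def)

lemma lp_norm_ennreal:
  assumes "0 \<le> r"
  shows "lp_norm (ennreal r) x = (\<Sum>i\<in>UNIV. \<bar>x $ i\<bar> powr r) powr (1 / r)"
  using assms by (simp add: lp_norm_def)

lemma ennreal_exponent_cases:
  assumes "1 \<le> (p::ennreal)"
  obtains (top) "p = \<infinity>" | (real) r where "1 \<le> r" "p = ennreal r"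
proof (cases p)
  case (real r)
  then show ?thesis using assms that(2)[of r] by (simp add: ennreal_1[symmetric] del: ennreal_1)
next
  case top
  then show ?thesis using that(1) by (simp add: infinity_ennreal_def)
qed

lemma lp_norm_nonneg [simp]: "0 \<le> lp_norm p x"
  by (auto simp: lp_norm_def infnorm_pos_le)

lemma lp_norm_scaleR:
  assumes "1 \<le> p"
  shows "lp_norm p (c *\<^sub>R x) = \<bar>c\<bar> * lp_norm p x"
  using assms
proof (cases rule: ennreal_exponent_cases)
  case top
  then show ?thesis by (simp add: lp_norm_top infnorm_mul)
next
  case (real r)
  then show ?thesis
    by (simp add: lp_norm_ennreal abs_mult powr_mult sum_nonneg powr_powr
        flip: sum_distrib_left)
qed

lemma lp_norm_zero [simp]: "1 \<le> p \<Longrightarrow> lp_norm p 0 = 0"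
  using lp_norm_scaleR[of p 0 0] by simp

lemma abs_component_le_lp_norm:
  assumes "1 \<le> p"
  shows "\<bar>x $ i\<bar> \<le> lp_norm p x"
  using assms
proof (cases rule: ennreal_exponent_cases)
  case top
  then show ?thesis by (simp add: lp_norm_top component_le_infnorm_cart)
next
  case (real r)
  have "\<bar>x $ i\<bar> = (\<bar>x $ i\<bar> powr r) powr (1 / r)"
    using real by (simp add: powr_powr)
  also have "\<dots> \<le> (\<Sum>i\<in>UNIV. \<bar>x $ i\<bar> powr r) powr (1 / r)"
    using real by (intro powr_mono2 member_le_sum) auto
  finally show ?thesis using real by (simp add: lp_norm_ennreal)
qed

text \<open>Growth and integrability estimates only use that the norms are equivalent, so a crude
  constant that serves every \<open>p\<close> is enough.\<close>

lemma lp_norm_le_norm: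
  fixes x :: "real ^ 'n"
  assumes "1 \<le> p"
  shows "lp_norm p x \<le> real CARD('n) * norm x"
  using assms
proof (cases rule: ennreal_exponent_cases)
  case top
  have "1 * norm x \<le> real CARD('n) * norm x"
    by (intro mult_right_mono) (auto simp: Suc_le_eq)
  then show ?thesis using infnorm_le_norm[of x] top by (simp add: lp_norm_top)
next
  case (real r)
  have "(\<Sum>i\<in>UNIV. \<bar>x $ i\<bar> powr r) \<le> (\<Sum>i\<in>(UNIV::'n set). norm x powr r)"
    using real by (intro sum_mono powr_mono2 component_le_norm_cart) auto
  also have "\<dots> = real CARD('n) * norm x powr r" by simp
  finally have "(\<Sum>i\<in>UNIV. \<bar>x $ i\<bar> powr r) powr (1 / r) \<le> (real CARD('n) * norm x powr r) powr (1 / r)"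
    using real by (intro powr_mono2) (auto intro: sum_nonneg)
  also have "\<dots> = real CARD('n) powr (1 / r) * norm x"
    using real by (simp add: powr_mult powr_powr)
  also have "\<dots> \<le> real CARD('n) powr 1 * norm x"
    using real by (intro mult_right_mono powr_mono) (auto simp: Suc_le_eq)
  finally show ?thesis using real by (simp add: lp_norm_ennreal)
qed

lemma norm_le_lp_norm:
  fixes x :: "real ^ 'n"
  assumes "1 \<le> p"
  shows "norm x \<le> real CARD('n) * lp_norm p x"
proof -
  have "norm x \<le> (\<Sum>i\<in>UNIV. \<bar>x $ i\<bar>)" by (rule norm_le_l1_cart)
  also have "\<dots> \<le> (\<Sum>i\<in>(UNIV::'n set). lp_norm p x)"
    by (intro sum_mono abs_component_le_lp_norm assms)
  finally show ?thesis by simp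
qed

lemma lp_norm_eq_0_iff:
  assumes "1 \<le> p"
  shows "lp_norm p x = 0 \<longleftrightarrow> x = 0"
  using norm_le_lp_norm[OF assms, of x] assms by auto

lemma continuous_on_lp_norm [continuous_intros]:
  assumes "1 \<le> p" "continuous_on S f"
  shows "continuous_on S (\<lambda>x. lp_norm p (f x))"
  using assms(1)
proof (cases rule: ennreal_exponent_cases)
  case top
  then show ?thesis
    using continuous_on_compose2[OF continuous_on_infnorm[OF continuous_on_id] assms(2)]
    by (auto simp: lp_norm_top assms intro!: continuous_intros)
next
  case (real r)
  have "continuous_on S (\<lambda>x. (\<Sum>i\<in>UNIV. \<bar>f x $ i\<bar> powr r) powr (1 / r))"
    using real assms(2)
    by (intro continuous_on_powr' continuous_intros) (auto intro!: sum_nonneg)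
  then show ?thesis using real by (simp add: lp_norm_ennreal)
qed

lemma borel_measurable_lp_norm [measurable]:
  assumes "1 \<le> p"
  shows "lp_norm p \<in> borel_measurable borel"
  by (intro borel_measurable_continuous_onI continuous_on_lp_norm assms continuous_on_id)

section \<open>Hoelder duality for conjugate exponents\<close>

lemma conjugate_exponent_cases:
  assumes "1 \<le> q" "1 / p + 1 / q = (1::ennreal)"
  obtains (one_top) "p = 1" "q = \<infinity>" | (top_one) "p = \<infinity>" "q = 1"
    | (real) a b where "p = ennreal a" "q = ennreal b" "1 < a" "1 < b" "1 / a + 1 / b = 1"
proof (cases p)
  case (real a)
  show ?thesis
    using \<open>1 \<le> q\<close>
  proof (cases rule: ennreal_exponent_cases)
    case top
    have "1 / p = 1" using assms(2) top by (simp add: infinity_ennreal_def)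
    then have "a \<noteq> 0" using real by auto
    then have "ennreal (1 / a) = ennreal 1"
      using \<open>1 / p = 1\<close> real divide_ennreal[of 1 a] by simp
    then have "p = 1" using real \<open>a \<noteq> 0\<close> by (simp del: ennreal_1) 
    then show ?thesis using that(1) top by simp
  next
    case (real b)
    \<comment> \<open>Since \<open>1 / 0 = \<top>\<close> in \<open>ennreal\<close>, the conjugacy
      equation itself rules out \<open>p = 0\<close>; likewise \<open>1 / \<top> = 0\<close> lets it
      cover both endpoint pairs.\<close>
    have "a \<noteq> 0"
    proof
      assume "a = 0"
      then have "1 / p = \<top>" using \<open>p = ennreal a\<close> by simp
      then show False using assms(2) by simp
    qed
    then have a: "a > 0" using \<open>0 \<le> a\<close> by simp
    have "ennreal (1 / a + 1 / b) = ennreal 1"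
      using assms(2) real \<open>p = ennreal a\<close> a divide_ennreal[of 1 a] divide_ennreal[of 1 b] 
      by (simp add: ennreal_plus)
    then have eq: "1 / a + 1 / b = 1" using a real by (subst (asm) ennreal_inj) auto
    have "1 / a > 0" "1 / b > 0" using a real by auto
    then have "1 / a < 1" "1 / b < 1" using eq by linarith+
    then have "1 < a" "1 < b" using a real by (auto simp: field_simps)
    then show ?thesis using that(3) eq real \<open>p = ennreal a\<close> by blast
  qed
next
  case top
  then have "1 / q = 1" using assms(2) by simp
  moreover have "q \<noteq> \<top>"
    using \<open>1 / q = 1\<close> by auto
  then obtain b where b: "q = ennreal b" "1 \<le> b"
    using ennreal_exponent_cases[OF \<open>1 \<le> q\<close>] by (metis infinity_ennreal_def)
  ultimately have "ennreal (1 / b) = ennreal 1"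
    using divide_ennreal[of 1 b] by simp
  then have "q = 1" using b by (simp del: ennreal_1)
  then show ?thesis using that(2) top by (simp add: infinity_ennreal_def)
qed

lemma conjugate_exponent_ge_1:
  assumes "1 \<le> q" "1 / p + 1 / q = (1::ennreal)"
  shows "1 \<le> p"
  using assms
  by (cases rule: conjugate_exponent_cases) auto

lemma inner_le_lp_norm_1_infnorm:
  "\<bar>x \<bullet> y\<bar> \<le> lp_norm 1 x * infnorm y"
proof -
  have "\<bar>x \<bullet> y\<bar> \<le> (\<Sum>i\<in>UNIV. \<bar>x $ i * y $ i\<bar>)"
    by (simp add: inner_vec_def sum_abs)
  also have "\<dots> \<le> (\<Sum>i\<in>UNIV. \<bar>x $ i\<bar> * infnorm y)"
    by (intro sum_mono) (auto simp: abs_mult intro!: mult_left_mono component_le_infnorm_cart)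
  also have "\<dots> = lp_norm 1 x * infnorm y"
    using lp_norm_ennreal[of 1 x] by (simp add: sum_distrib_right sum_nonneg)
  finally show ?thesis .
qed

lemma Holder_lp_norm:
  assumes "1 \<le> q" "1 / p + 1 / q = (1::ennreal)"
  shows "\<bar>x \<bullet> y\<bar> \<le> lp_norm p x * lp_norm q y"
  using assms
proof (cases rule: conjugate_exponent_cases)
  case one_top
  then show ?thesis using inner_le_lp_norm_1_infnorm[of x y] by (simp add: lp_norm_top)
next
  case top_one
  then show ?thesis using inner_le_lp_norm_1_infnorm[of y x]
    by (simp add: lp_norm_top inner_commute mult.commute)
next
  case (real a b)
  have p: "1 \<le> p" using conjugate_exponent_ge_1[OF assms] .
  define A where "A = lp_norm p x"
  define B where "B = lp_norm q y"
  show ?thesis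
  proof (cases "A = 0 \<or> B = 0")
    case True
    then show ?thesis using p assms by (auto simp: A_def B_def lp_norm_eq_0_iff)
  next
    case False
    then have pos: "A > 0" "B > 0"
      unfolding A_def B_def by (simp_all add: less_le)
    have Ap: "A powr a = (\<Sum>i\<in>UNIV. \<bar>x $ i\<bar> powr a)"
      using real by (simp add: A_def lp_norm_ennreal powr_powr sum_nonneg)
    have Bq: "B powr b = (\<Sum>i\<in>UNIV. \<bar>y $ i\<bar> powr b)"
      using real by (simp add: B_def lp_norm_ennreal powr_powr sum_nonneg)
    \<comment> \<open>Dividing by the norms lets Young's inequality act coordinate by coordinate,
      and the resulting bounds sum to \<open>1 / a + 1 / b = 1\<close>.\<close>
    have "\<bar>x \<bullet> y\<bar> / (A * B) \<le> (\<Sum>i\<in>UNIV. \<bar>x $ i * y $ i\<bar>) / (A * B)"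
      using pos by (intro divide_right_mono) (auto simp: inner_vec_def sum_abs)
    also have "\<dots> = (\<Sum>i\<in>UNIV. (\<bar>x $ i\<bar> / A) * (\<bar>y $ i\<bar> / B))"
      by (simp add: sum_divide_distrib abs_mult)
    also have "\<dots> \<le> (\<Sum>i\<in>UNIV. (\<bar>x $ i\<bar> / A) powr a / a + (\<bar>y $ i\<bar> / B) powr b / b)"
      using real pos by (intro sum_mono Youngs_inequality) auto
    also have "\<dots> = (\<Sum>i\<in>UNIV. \<bar>x $ i\<bar> powr a) / A powr a / a + (\<Sum>i\<in>UNIV. \<bar>y $ i\<bar> powr b) / B powr b / b"
      using pos by (simp add: sum.distrib sum_divide_distrib powr_divide)
    also have "\<dots> = 1"
      using pos real by (simp flip: Ap Bq)
    finally show ?thesis using pos by (simp add: A_def B_def divide_simps)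
  qed
qed

text \<open>Extremal vectors of Hoelder's inequality: the sign pattern of \<open>x\<close> for
  \<open>p = 1\<close>, a signed axis vector at a coordinate of largest modulus for
  \<open>p = \<infinity>\<close>. The norm of \<open>e\<close> is only bounded by \<open>1\<close>
  because \<open>x = 0\<close> leads to \<open>e = 0\<close>.\<close>

lemma Holder_lp_norm_attained:
  assumes "1 \<le> q" "1 / p + 1 / q = (1::ennreal)"
  shows "\<exists>e. lp_norm q e \<le> 1 \<and> x \<bullet> e = lp_norm p x"
  using assms
proof (cases rule: conjugate_exponent_cases)
  case one_top
  define e where "e = (\<chi> i. sgn (x $ i))"
  have "infnorm e \<le> 1"
    unfolding infnorm_cart e_def by (intro cSup_least) (auto simp: abs_sgn_eq)
  moreover have "x \<bullet> e = lp_norm 1 x"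
  proof -
    have "x $ i * sgn (x $ i) = \<bar>x $ i\<bar>" for i by (rule abs_sgn[symmetric])
    then show ?thesis
      using lp_norm_ennreal[of 1 x] by (simp add: inner_vec_def e_def sum_nonneg)
  qed
  ultimately show ?thesis using one_top by (auto simp: lp_norm_top)
next
  case top_one
  have "infnorm x \<in> {\<bar>x $ i\<bar> |i. i \<in> UNIV}"
    unfolding infnorm_cart
  proof (subst cSup_eq_Max)
    show "finite {\<bar>x $ i\<bar> |i. i \<in> UNIV}" "{\<bar>x $ i\<bar> |i. i \<in> UNIV} \<noteq> {}"
      by (auto simp: full_SetCompr_eq)
    then show "Max {\<bar>x $ i\<bar> |i. i \<in> UNIV} \<in> {\<bar>x $ i\<bar> |i. i \<in> UNIV}"
      by (rule Max_in)
  qed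
  then obtain k where k: "infnorm x = \<bar>x $ k\<bar>" by auto
  define e where "e = sgn (x $ k) *\<^sub>R axis k (1::real)"
  have "lp_norm 1 (axis k (1::real)) = 1"
    using lp_norm_ennreal[of 1 "axis k (1::real)"]
    by (simp add: axis_def if_distrib[of abs] if_distrib[of "\<lambda>x. x powr 1"] cong: if_cong)
  then have "lp_norm 1 e \<le> 1"
    unfolding e_def by (simp add: lp_norm_scaleR abs_sgn_eq)
  moreover have "x \<bullet> e = lp_norm \<infinity> x"
    by (simp add: e_def inner_axis lp_norm_top k abs_sgn mult.commute)
  ultimately show ?thesis using top_one by auto
next
  case (real a b)
  define A where "A = lp_norm p x"
  show ?thesis
  proof (cases "A = 0")
    case True
    then show ?thesis using assms conjugate_exponent_ge_1[OF assms]
      by (intro exI[of _ 0]) (auto simp: A_def)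
  next
    case False
    then have pos: "A > 0"
      unfolding A_def by (simp add: less_le)
    have Ap: "(\<Sum>i\<in>UNIV. \<bar>x $ i\<bar> powr a) = A powr a"
      using real by (simp add: A_def lp_norm_ennreal powr_powr sum_nonneg)
    have ab: "(a - 1) * b = a"
      using real by (simp add: field_simps)
    \<comment> \<open>This is the gradient of the norm at \<open>x\<close>; the identity
      \<open>(a - 1) * b = a\<close> makes the \<open>b\<close>-th powers of its coordinates add up
      to one.\<close>
    define e where "e = (\<chi> i. sgn (x $ i) * \<bar>x $ i\<bar> powr (a - 1) / A powr (a - 1))"
    have "\<bar>e $ i\<bar> powr b = \<bar>x $ i\<bar> powr a / A powr a" for i
    proof -
      have "\<bar>e $ i\<bar> = \<bar>x $ i\<bar> powr (a - 1) / A powr (a - 1)"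
        by (simp add: e_def abs_mult abs_sgn_eq)
      then show ?thesis by (simp add: powr_divide powr_powr ab)
    qed
    then have "(\<Sum>i\<in>UNIV. \<bar>e $ i\<bar> powr b) = 1"
      using pos by (simp flip: sum_divide_distrib add: Ap)
    then have "lp_norm q e = 1" using real by (simp add: lp_norm_ennreal)
    moreover have "x \<bullet> e = A"
    proof -
      have "x $ i * e $ i = \<bar>x $ i\<bar> powr a / A powr (a - 1)" for i
      proof -
        have "x $ i * e $ i = \<bar>x $ i\<bar> * \<bar>x $ i\<bar> powr (a - 1) / A powr (a - 1)"
          by (simp add: e_def abs_sgn mult.commute)
        also have "\<bar>x $ i\<bar> * \<bar>x $ i\<bar> powr (a - 1) = \<bar>x $ i\<bar> powr a"
          using powr_mult_base[of "\<bar>x $ i\<bar>" "a - 1"] by simp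
        finally show ?thesis .
      qed
      then have "x \<bullet> e = A powr a / A powr (a - 1)"
        by (simp add: inner_vec_def Ap flip: sum_divide_distrib)
      also have "\<dots> = A" using pos by (simp flip: powr_diff)
      finally show ?thesis .
    qed
    ultimately show ?thesis unfolding A_def by (intro exI[of _ e]) simp
  qed
qed

text \<open>Young's inequality multiplied by \<open>\<rho>\<close>. The conjugate exponent is
  \<open>\<rho> / (\<rho> - 1)\<close>, and dividing \<open>\<rho>\<close> by it leaves the
  coefficient \<open>\<rho> - 1\<close> that appears in the limit law.\<close>

lemma powr_Youngs_inequality:
  fixes t a \<rho> :: real
  assumes "1 < \<rho>" "0 \<le> t" "0 \<le> a"
  shows "\<rho> * (a * t) \<le> t powr \<rho> + (\<rho> - 1) * a powr (\<rho> / (\<rho> - 1))"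
proof -
  have "t * a \<le> t powr \<rho> / \<rho> + a powr (\<rho> / (\<rho> - 1)) / (\<rho> / (\<rho> - 1))"
    using assms by (intro Youngs_inequality) (auto simp: field_simps)
  then show ?thesis using assms by (simp add: field_simps)
qed

text \<open>One half of a Legendre transform: Hoelder reduces the linear term to a product of norms,
  and Young absorbs the product. Equality in both gives the other half below.\<close>

lemma lp_norm_powr_linear_ge:
  assumes "1 \<le> q" "1 / p + 1 / q = (1::ennreal)" "1 < \<rho>"
  shows "- (\<rho> - 1) * lp_norm p g powr (\<rho> / (\<rho> - 1)) \<le> lp_norm q x powr \<rho> + \<rho> * (g \<bullet> x)"
proof -
  have "- (g \<bullet> x) \<le> lp_norm p g * lp_norm q x"
    using Holder_lp_norm[OF assms(1,2), of g x] by linarith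
  then have "\<rho> * (- (g \<bullet> x)) \<le> \<rho> * (lp_norm p g * lp_norm q x)"
    using assms by (intro mult_left_mono) auto
  also have "\<dots> \<le> lp_norm q x powr \<rho> + (\<rho> - 1) * lp_norm p g powr (\<rho> / (\<rho> - 1))"
    using assms by (intro powr_Youngs_inequality) auto
  finally show ?thesis by (simp add: algebra_simps)
qed

lemma lp_norm_powr_linear_attained:
  assumes "1 \<le> q" "1 / p + 1 / q = (1::ennreal)" "1 < \<rho>"
  shows "\<exists>x. lp_norm q x powr \<rho> + \<rho> * (g \<bullet> x) \<le> - (\<rho> - 1) * lp_norm p g powr (\<rho> / (\<rho> - 1))"
proof -
  obtain e where e: "lp_norm q e \<le> 1" "g \<bullet> e = lp_norm p g"
    using Holder_lp_norm_attained[OF assms(1,2)] by blast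
  define a where "a = lp_norm p g"
  \<comment> \<open>In the direction \<open>- e\<close> the problem is to minimize
    \<open>l powr \<rho> - \<rho> * a * l\<close>, whose stationary point satisfies
    \<open>l powr (\<rho> - 1) = a\<close>.\<close>
  define l where "l = a powr (1 / (\<rho> - 1))"
  have "0 \<le> a" "0 \<le> l" by (auto simp: a_def l_def)
  have "lp_norm q (- l *\<^sub>R e) powr \<rho> \<le> l powr \<rho>"
    using assms e(1) \<open>0 \<le> l\<close> by (intro powr_mono2) (auto simp: lp_norm_scaleR mult_left_le simp del: scaleR_minus_left)
  also have "l powr \<rho> = a powr (\<rho> / (\<rho> - 1))"
    by (simp add: l_def powr_powr)
  finally have 1: "lp_norm q (- l *\<^sub>R e) powr \<rho> \<le> a powr (\<rho> / (\<rho> - 1))" .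
  have "g \<bullet> (- l *\<^sub>R e) = - (a * a powr (1 / (\<rho> - 1)))"
    by (simp add: e(2) l_def a_def)
  also have "\<dots> = - (a powr (\<rho> / (\<rho> - 1)))"
    using powr_mult_base[OF \<open>0 \<le> a\<close>, of "1 / (\<rho> - 1)"] assms by (simp add: field_simps)
  finally show ?thesis
    using 1 by (intro exI[of _ "- l *\<^sub>R e"]) (simp add: a_def algebra_simps)
qed

text \<open>A real supremum bounds the members of its range only if that range is bounded above;
  \<open>onorm\<close> supplies such a bound, after which norm equivalence gives the Euclidean
  form.\<close>

lemma norm_matrix_vector_le_matrix_lp_norm:
  fixes A :: "real ^ 'm ^ 'r"
  assumes "1 \<le> p"
  shows "norm (A *v x) \<le> real CARD('r) * real CARD('m) * matrix_lp_norm p A * norm x"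
proof (cases "x = 0")
  case False
  have "lp_norm p (A *v y) / lp_norm p y \<le> real CARD('r) * onorm ((*v) A) * real CARD('m)" for y
  proof (cases "y = 0")
    case False
    then have "lp_norm p y > 0" using lp_norm_eq_0_iff[OF assms, of y] by (simp add: less_le)
    have "lp_norm p (A *v y) \<le> real CARD('r) * norm (A *v y)" by (rule lp_norm_le_norm[OF assms])
    also have "\<dots> \<le> real CARD('r) * (onorm ((*v) A) * norm y)"
      by (intro mult_left_mono onorm matrix_vector_mul_bounded_linear) auto
    also have "\<dots> \<le> real CARD('r) * (onorm ((*v) A) * (real CARD('m) * lp_norm p y))"
      by (intro mult_left_mono norm_le_lp_norm[OF assms] onorm_pos_le matrix_vector_mul_bounded_linear) auto
    finally show ?thesis using \<open>lp_norm p y > 0\<close> by (simp add: divide_simps mult_ac)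
  qed (use assms in \<open>simp add: onorm_pos_le matrix_vector_mul_bounded_linear\<close>)
  then have "bdd_above (range (\<lambda>y. lp_norm p (A *v y) / lp_norm p y))"
    by (intro bdd_aboveI2)
  then have "lp_norm p (A *v x) / lp_norm p x \<le> matrix_lp_norm p A"
    unfolding matrix_lp_norm_def by (intro cSUP_upper) auto
  moreover have px: "lp_norm p x > 0"
    using lp_norm_eq_0_iff[OF assms, of x] False by (simp add: less_le)
  ultimately have *: "lp_norm p (A *v x) \<le> matrix_lp_norm p A * lp_norm p x"
    by (simp add: divide_simps)
  have "0 \<le> matrix_lp_norm p A * lp_norm p x"
    using * lp_norm_nonneg[of p "A *v x"] by linarith
  then have nn: "0 \<le> matrix_lp_norm p A" using px by (simp add: zero_le_mult_iff)
  have "norm (A *v x) \<le> real CARD('r) * lp_norm p (A *v x)" by (rule norm_le_lp_norm[OF assms])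
  also have "\<dots> \<le> real CARD('r) * (matrix_lp_norm p A * lp_norm p x)"
    using * by (intro mult_left_mono) auto
  also have "\<dots> \<le> real CARD('r) * (matrix_lp_norm p A * (real CARD('m) * norm x))"
    using nn by (intro mult_left_mono lp_norm_le_norm[OF assms]) auto
  finally show ?thesis by (simp add: mult_ac)
qed auto

text \<open>Pairing \<open>z v* A\<close> with itself moves one factor across the product, where the
  bound for \<open>A\<close> applies: a matrix and its transpose have the same Euclidean operator
  norm.\<close>

lemma norm_vector_matrix_le:
  fixes A :: "real ^ 'm ^ 'r"
  assumes "\<And>x. norm (A *v x) \<le> B * norm x"
  shows "norm (z v* A) \<le> B * norm z"
proof -
  let ?y = "z v* A"
  have "norm ?y * norm ?y = z \<bullet> (A *v ?y)"
    by (simp add: dot_lmul_matrix power2_norm_eq_inner flip: power2_eq_square)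
  also have "\<dots> \<le> norm z * norm (A *v ?y)" by (rule norm_cauchy_schwarz)
  also have "\<dots> \<le> norm z * (B * norm ?y)" by (intro mult_left_mono assms) auto
  finally have "norm ?y * norm ?y \<le> (B * norm z) * norm ?y" by (simp add: mult_ac)
  \<comment> \<open>Testing the hypothesis on a unit vector shows that \<open>B\<close> is
    nonnegative, which settles the case \<open>?y = 0\<close>.\<close>
  moreover have "0 \<le> B * norm z"
    using order_trans[OF norm_ge_zero assms, of "axis undefined 1"] by (simp add: norm_axis_1)
  ultimately show ?thesis
    by (cases "?y = 0") auto
qed

section \<open>Couplings with an empirical measure\<close>

text \<open>The sample points do not enter: measures are indexed by sample number, so a family stays
  feasible when the points move. This is what makes sublevel sets of the profile open.\<close>

definition feasible_family ::
    "('a::topological_space \<Rightarrow> 'b::euclidean_space) \<Rightarrow> nat \<Rightarrow> (nat \<Rightarrow> 'a measure) \<Rightarrow> bool" where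
  "feasible_family h n \<mu> \<longleftrightarrow>
     (\<forall>i\<in>{1..n}. prob_space (\<mu> i) \<and> sets (\<mu> i) = sets borel \<and> integrable (\<mu> i) h) \<and>
     (\<Sum>i=1..n. \<integral>x. h x \<partial>\<mu> i) = 0"

lemma enn2real_sum_finite:
  assumes "\<And>i. i \<in> I \<Longrightarrow> f i < \<top>"
  shows "enn2real (\<Sum>i\<in>I. f i) = (\<Sum>i\<in>I. enn2real (f i))"
proof -
  have "(\<Sum>i\<in>I. f i) = (\<Sum>i\<in>I. ennreal (enn2real (f i)))"
    using assms by (intro sum.cong) auto
  then show ?thesis by (simp add: sum_ennreal sum_nonneg)
qed

text \<open>The averaging hypothesis concerns nonnegative integrals. Positive and negative parts
  carry it to signed ones, and integrability keeps every part finite under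
  \<open>enn2real\<close>.\<close>

lemma average_real_integral:
  fixes f :: "'a::topological_space \<Rightarrow> real"
  assumes sets: "sets P = sets borel" "\<And>i. i \<in> {1..n::nat} \<Longrightarrow> sets (\<mu> i) = sets borel"
    and avg: "\<And>f. f \<in> borel_measurable borel \<Longrightarrow>
      (\<integral>\<^sup>+x. f x \<partial>P) = ennreal (1 / real n) * (\<Sum>i=1..n. \<integral>\<^sup>+x. f x \<partial>\<mu> i)"
    and int: "\<And>i. i \<in> {1..n} \<Longrightarrow> integrable (\<mu> i) f"
    and f: "f \<in> borel_measurable borel" and P: "integrable P f"
  shows "(\<integral>x. f x \<partial>P) = (1 / real n) * (\<Sum>i=1..n. \<integral>x. f x \<partial>\<mu> i)"
proof -
  have *: "enn2real (\<integral>\<^sup>+x. ennreal (g x) \<partial>P) = (1 / real n) * (\<Sum>i=1..n. enn2real (\<integral>\<^sup>+x. ennreal (g x) \<partial>\<mu> i))"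
    if g: "g \<in> borel_measurable borel" "\<And>i. i \<in> {1..n} \<Longrightarrow> integrable (\<mu> i) g"
    for g :: "'a \<Rightarrow> real"
  proof -
    have "(\<integral>\<^sup>+x. ennreal (g x) \<partial>\<mu> i) < \<top>" if "i \<in> {1..n}" for i
    proof -
      have "(\<integral>\<^sup>+x. ennreal (g x) \<partial>\<mu> i) \<le> (\<integral>\<^sup>+x. ennreal (norm (g x)) \<partial>\<mu> i)"
        by (intro nn_integral_mono ennreal_leI) auto
      also have "\<dots> < \<infinity>" using g(2)[OF that] by (simp add: integrable_iff_bounded)
      finally show ?thesis by simp
    qed
    then have "enn2real (\<Sum>i=1..n. \<integral>\<^sup>+x. ennreal (g x) \<partial>\<mu> i) = (\<Sum>i=1..n. enn2real (\<integral>\<^sup>+x. ennreal (g x) \<partial>\<mu> i))"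
      by (intro enn2real_sum_finite) (auto simp del: atLeastAtMost_iff)
    then show ?thesis using g
      by (subst avg) (auto simp: enn2real_mult)
  qed
  show ?thesis
    unfolding real_lebesgue_integral_def[OF P] using f int
    by (subst (1 2) *) (auto simp: real_lebesgue_integral_def[OF int] sum_subtractf
        right_diff_distrib intro!: sum.cong)
qed

lemma average_integral:
  fixes h :: "'a::topological_space \<Rightarrow> 'b::euclidean_space"
  assumes sets: "sets P = sets borel" "\<And>i. i \<in> {1..n::nat} \<Longrightarrow> sets (\<mu> i) = sets borel"
    and avg: "\<And>f. f \<in> borel_measurable borel \<Longrightarrow>
      (\<integral>\<^sup>+x. f x \<partial>P) = ennreal (1 / real n) * (\<Sum>i=1..n. \<integral>\<^sup>+x. f x \<partial>\<mu> i)"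
    and int: "\<And>i. i \<in> {1..n} \<Longrightarrow> integrable (\<mu> i) h"
    and h: "h \<in> borel_measurable borel"
    and P: "integrable P h"
  shows "(\<integral>x. h x \<partial>P) = (1 / real n) *\<^sub>R (\<Sum>i=1..n. \<integral>x. h x \<partial>\<mu> i)"
proof (rule euclidean_eqI)
  fix b :: 'b assume "b \<in> Basis"
  have "(\<integral>x. h x \<partial>P) \<bullet> b = (\<integral>x. h x \<bullet> b \<partial>P)"
    using P by (intro integral_inner_left[symmetric]) auto
  also have "\<dots> = (1 / real n) * (\<Sum>i=1..n. \<integral>x. h x \<bullet> b \<partial>\<mu> i)"
    using int h P by (intro average_real_integral sets avg) auto
  also have "\<dots> = ((1 / real n) *\<^sub>R (\<Sum>i=1..n. \<integral>x. h x \<partial>\<mu> i)) \<bullet> b"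
    using int by (simp add: inner_sum_left)
  finally show "(\<integral>x. h x \<partial>P) \<bullet> b = ((1 / real n) *\<^sub>R (\<Sum>i=1..n. \<integral>x. h x \<partial>\<mu> i)) \<bullet> b" .
qed

lemma average_integrable_iff:
  fixes h :: "'a::topological_space \<Rightarrow> 'b::euclidean_space"
  assumes "1 \<le> n" 
    and sets: "sets P = sets borel" "\<And>i. i \<in> {1..n::nat} \<Longrightarrow> sets (\<mu> i) = sets borel"
    and avg: "\<And>f. f \<in> borel_measurable borel \<Longrightarrow>
      (\<integral>\<^sup>+x. f x \<partial>P) = ennreal (1 / real n) * (\<Sum>i=1..n. \<integral>\<^sup>+x. f x \<partial>\<mu> i)"
    and h: "h \<in> borel_measurable borel"
  shows "integrable P h \<longleftrightarrow> (\<forall>i\<in>{1..n}. integrable (\<mu> i) h)"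
proof -
  have [measurable_cong]: "sets P = sets borel" by fact
  have m: "h \<in> borel_measurable P" "\<And>i. i \<in> {1..n} \<Longrightarrow> h \<in> borel_measurable (\<mu> i)"
    using h sets by (simp_all cong: measurable_cong_sets)
  have "(\<integral>\<^sup>+x. ennreal (norm (h x)) \<partial>P) < \<infinity> \<longleftrightarrow> (\<Sum>i=1..n. \<integral>\<^sup>+x. ennreal (norm (h x)) \<partial>\<mu> i) < \<infinity>"
    using assms(1) h by (subst avg) (auto simp: ennreal_mult_less_top)
  also have "\<dots> \<longleftrightarrow> (\<forall>i\<in>{1..n}. (\<integral>\<^sup>+x. ennreal (norm (h x)) \<partial>\<mu> i) < \<infinity>)"
    by (simp only: infinity_ennreal_def ennreal_sum_less_top finite_atLeastAtMost)
  finally show ?thesis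
    using m by (auto simp: integrable_iff_bounded)
qed

text \<open>Drawing an index \<open>i\<close> uniformly, then \<open>u\<close> from
  \<open>\<mu> i\<close>, and pairing \<open>u\<close> with \<open>w i\<close> gives a coupling of
  the averaged law with the empirical measure.\<close>

lemma profile_function_le_family:
  fixes c :: "'a::topological_space \<Rightarrow> 'a \<Rightarrow> real" and H :: "'a \<Rightarrow> 't \<Rightarrow> 'b::euclidean_space"
  assumes n: "1 \<le> n" and c[measurable]: "case_prod c \<in> borel_measurable (borel \<Otimes>\<^sub>M borel)"
    and h[measurable]: "(\<lambda>x. H x \<theta>) \<in> borel_measurable borel"
    and feas: "feasible_family (\<lambda>x. H x \<theta>) n \<mu>"
  shows "profile_function c H n w \<theta> \<le> ennreal (1 / real n) * (\<Sum>i=1..n. \<integral>\<^sup>+u. ennreal (c u (w i)) \<partial>\<mu> i)"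
proof -
  let ?U = "uniform_count_measure {1..n}"
  let ?B = "borel \<Otimes>\<^sub>M borel :: ('a \<times> 'a) measure"
  let ?K = "\<lambda>i. distr (\<mu> i) ?B (\<lambda>u. (u, w i))"
  define \<pi> where "\<pi> = ?U \<bind> ?K"
  define P where "P = distr \<pi> borel fst"
  have mu: "prob_space (\<mu> i)" "sets (\<mu> i) = sets borel" "integrable (\<mu> i) (\<lambda>x. H x \<theta>)"
    if "i \<in> {1..n}" for i
    using feas that by (auto simp: feasible_family_def)
  have meas_mu: "(\<lambda>u. (u, w i)) \<in> measurable (\<mu> i) ?B" if "i \<in> {1..n}" for i
    using mu(2)[OF that] by (simp cong: measurable_cong_sets)
  \<comment> \<open>All subsets of the index space are measurable, so a kernel only has to take its
    values in \<open>subprob_algebra\<close>.\<close>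
  have K: "?K \<in> measurable ?U (subprob_algebra ?B)"
    using meas_mu mu(1)
    by (auto simp: measurable_def space_uniform_count_measure sets_uniform_count_measure
        space_subprob_algebra intro!: prob_space_imp_subprob_space prob_space.prob_space_distr)
  have ne: "space ?U \<noteq> {}" using n by (simp add: space_uniform_count_measure)
  have sets_pi: "sets \<pi> = sets ?B"
    unfolding \<pi>_def by (rule sets_bind) (use ne in auto)
  note [measurable_cong] = sets_pi
  have U: "prob_space ?U" using n by (intro prob_space_uniform_count_measure) auto
  have "prob_space \<pi>"
    unfolding \<pi>_def
    by (rule prob_space.prob_space_bind[OF U _ K])
       (use mu(1) meas_mu in \<open>auto simp: space_uniform_count_measure intro!: AE_I2 prob_space.prob_space_distr\<close>)
  then interpret \<pi>: prob_space \<pi> .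
  have int_pi: "(\<integral>\<^sup>+z. f z \<partial>\<pi>) = ennreal (1 / real n) * (\<Sum>i=1..n. \<integral>\<^sup>+u. f (u, w i) \<partial>\<mu> i)"
    if [measurable]: "f \<in> borel_measurable ?B" for f
  proof -
    have "(\<integral>\<^sup>+z. f z \<partial>\<pi>) = (\<integral>\<^sup>+i. \<integral>\<^sup>+z. f z \<partial>?K i \<partial>?U)"
      unfolding \<pi>_def by (rule nn_integral_bind[OF that K])
    also have "\<dots> = (\<Sum>i=1..n. ennreal (1 / real n) * \<integral>\<^sup>+z. f z \<partial>?K i)"
      unfolding uniform_count_measure_def by (simp add: nn_integral_point_measure_finite)
    also have "\<dots> = (\<Sum>i=1..n. ennreal (1 / real n) * \<integral>\<^sup>+u. f (u, w i) \<partial>\<mu> i)"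
      using meas_mu by (intro sum.cong refl arg_cong2[where f="(*)"] nn_integral_distr) auto
    finally show ?thesis by (simp add: sum_distrib_left)
  qed
  have int_P: "(\<integral>\<^sup>+x. f x \<partial>P) = ennreal (1 / real n) * (\<Sum>i=1..n. \<integral>\<^sup>+u. f u \<partial>\<mu> i)"
    if [measurable]: "f \<in> borel_measurable borel" for f
    unfolding P_def by (subst nn_integral_distr) (simp_all add: int_pi)
  have P: "prob_space P" "sets P = sets borel"
    unfolding P_def by (auto intro!: \<pi>.prob_space_distr)
  have intP: "integrable P (\<lambda>x. H x \<theta>)"
    by (rule average_integrable_iff[where \<mu>=\<mu> and n=n, THEN iffD2]) (use n mu int_P P(2) in auto)
  have "(\<integral>x. H x \<theta> \<partial>P) = (1 / real n) *\<^sub>R (\<Sum>i=1..n. \<integral>x. H x \<theta> \<partial>\<mu> i)"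
    using mu intP by (intro average_integral P int_P) auto
  also have "\<dots> = 0" using feas by (simp add: feasible_family_def)
  finally have int0: "(\<integral>x. H x \<theta> \<partial>P) = 0" .
  have "distr \<pi> borel snd = empirical_measure n w"
  proof (rule measure_eqI)
    show "sets (distr \<pi> borel snd) = sets (empirical_measure n w)"
      by (simp add: empirical_measure_def)
    fix A assume "A \<in> sets (distr \<pi> borel snd)"
    then have A[measurable]: "A \<in> sets borel" by simp
    have "emeasure (distr \<pi> borel snd) A = (\<integral>\<^sup>+z. indicator A z \<partial>distr \<pi> borel snd)" by simp
    also have "\<dots> = (\<integral>\<^sup>+z. indicator A (snd z) \<partial>\<pi>)" by (intro nn_integral_distr) auto
    also have "\<dots> = ennreal (1 / real n) * (\<Sum>i=1..n. \<integral>\<^sup>+u. indicator A (w i) \<partial>\<mu> i)"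
      by (subst int_pi) auto
    also have "\<dots> = ennreal (1 / real n) * (\<Sum>i=1..n. ennreal (indicator A (w i)))"
      using mu(1) by (intro arg_cong2[where f="(*)"] sum.cong refl)
        (auto simp: prob_space.emeasure_space_1 split: split_indicator)
    also have "\<dots> = emeasure (empirical_measure n w) A"
      using n A by (simp add: emeasure_empirical_measure sum_ennreal sum_nonneg flip: ennreal_mult)
    finally show "emeasure (distr \<pi> borel snd) A = emeasure (empirical_measure n w) A" .
  qed
  then have pi: "\<pi> \<in> couplings P (empirical_measure n w)"
    by (auto simp: couplings_def P_def sets_pi \<pi>.prob_space_axioms)
  have "profile_function c H n w \<theta> \<le> transport_cost c P (empirical_measure n w)"
    unfolding profile_function_def using P intP int0 by (intro INF_lower) auto
  also have "\<dots> \<le> (\<integral>\<^sup>+z. ennreal (c (fst z) (snd z)) \<partial>\<pi>)"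
    unfolding transport_cost_def by (intro INF_lower pi)
  also have "\<dots> = ennreal (1 / real n) * (\<Sum>i=1..n. \<integral>\<^sup>+u. ennreal (c u (w i)) \<partial>\<mu> i)"
    by (subst int_pi) auto
  finally show ?thesis .
qed

text \<open>\<open>\<mu> i\<close> is the conditional law of the first coordinate given that the second one is \<open>w i\<close>;
  indices with equal sample points share this law.\<close>

lemma coupling_empirical_disintegration:
  fixes w :: "nat \<Rightarrow> 'a::t1_space"
  assumes n: "1 \<le> n" and \<pi>: "\<pi> \<in> couplings P (empirical_measure n w)"
  obtains \<mu> where "\<And>i. i \<in> {1..n} \<Longrightarrow> prob_space (\<mu> i) \<and> sets (\<mu> i) = sets borel"
    "\<And>f. f \<in> borel_measurable (borel \<Otimes>\<^sub>M borel) \<Longrightarrow>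
      (\<integral>\<^sup>+z. f z \<partial>\<pi>) = ennreal (1 / real n) * (\<Sum>i=1..n. \<integral>\<^sup>+u. f (u, w i) \<partial>\<mu> i)"
proof -
  let ?B = "borel \<Otimes>\<^sub>M borel :: ('a \<times> 'a) measure"
  have [measurable_cong]: "sets \<pi> = sets ?B" and \<pi>_prob: "prob_space \<pi>"
    and snd: "distr \<pi> borel snd = empirical_measure n w"
    using \<pi> by (auto simp: couplings_def)
  define k where "k v = card {j\<in>{1..n}. w j = v}" for v
  have k: "0 < k (w i)" if "i \<in> {1..n}" for i
    unfolding k_def using that by (intro card_gt_0_iff[THEN iffD2]) auto
  \<comment> \<open>The second marginal gives the point \<open>w i\<close> the mass
    \<open>k (w i) / n\<close>; its reciprocal normalizes the restriction of \<open>\<pi>\<close> to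
    that point.\<close>
  let ?d = "\<lambda>i (z :: 'a \<times> 'a). ennreal (real n / real (k (w i))) * indicator {w i} (snd z)"
  define \<mu> where "\<mu> i = distr (density \<pi> (?d i)) borel fst" for i
  have int_mu: "(\<integral>\<^sup>+u. f u \<partial>\<mu> i) = (\<integral>\<^sup>+z. ?d i z * f (fst z) \<partial>\<pi>)"
    if [measurable]: "f \<in> borel_measurable borel" for f i
    unfolding \<mu>_def by (simp add: nn_integral_distr nn_integral_density)
  have atom: "(\<integral>\<^sup>+z. indicator A (snd z) \<partial>\<pi>) = ennreal ((1 / real n) * (\<Sum>i=1..n. indicator A (w i)))"
    if [measurable]: "A \<in> sets borel" for A
  proof -
    have "(\<integral>\<^sup>+z. indicator A (snd z) \<partial>\<pi>) = (\<integral>\<^sup>+z. indicator A z \<partial>distr \<pi> borel snd)"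
      by (intro nn_integral_distr[symmetric]) auto
    also have "\<dots> = emeasure (empirical_measure n w) A"
      unfolding snd by (simp add: empirical_measure_def)
    finally show ?thesis using n that by (simp add: emeasure_empirical_measure)
  qed
  have card_k: "(\<Sum>j=1..n. indicator {v} (w j)) = real (k v)" for v
    by (simp add: k_def indicator_def sum.If_cases Int_def)
  have prob: "prob_space (\<mu> i)" if i: "i \<in> {1..n}" for i
  proof
    have "emeasure (\<mu> i) (space (\<mu> i)) = (\<integral>\<^sup>+u. 1 \<partial>\<mu> i)" by simp
    also have "\<dots> = (\<integral>\<^sup>+z. ?d i z \<partial>\<pi>)" by (subst int_mu) auto
    also have "\<dots> = ennreal (real n / real (k (w i))) * (\<integral>\<^sup>+z. indicator {w i} (snd z) \<partial>\<pi>)"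
      by (rule nn_integral_cmult) measurable
    also have "\<dots> = ennreal (real n / real (k (w i))) * ennreal ((1 / real n) * k (w i))"
      by (subst atom) (simp_all only: card_k borel_singleton sets.empty_sets)
    also have "\<dots> = 1" using k[OF i] n by (subst ennreal_mult[symmetric]) auto
    finally show "emeasure (\<mu> i) (space (\<mu> i)) = 1" .
  qed
  \<comment> \<open>The second coordinate lies in the finite sample almost surely; finite sets are
    closed in a T1 space and therefore Borel.\<close>
  have ae: "AE z in \<pi>. snd z \<in> w ` {1..n}"
  proof -
    have [measurable]: "w ` {1..n} \<in> sets borel"
      by (intro borel_closed finite_imp_closed) auto
    have "(\<integral>\<^sup>+z. indicator (- w ` {1..n}) (snd z) \<partial>\<pi>) = 0"
      using \<open>w ` {1..n} \<in> sets borel\<close> by (subst atom) (auto intro!: sum.neutral simp: indicator_def simp del: atLeastAtMost_iff)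
    moreover have "(\<lambda>z. indicator (- w ` {1..n}) (snd z) :: ennreal) \<in> borel_measurable \<pi>"
      by measurable
    ultimately have "AE z in \<pi>. indicator (- w ` {1..n}) (snd z) = (0::ennreal)"
      by (simp only: nn_integral_0_iff_AE)
    then show ?thesis by eventually_elim (auto simp: indicator_def split: if_splits)
  qed
  have "(\<integral>\<^sup>+z. f z \<partial>\<pi>) = ennreal (1 / real n) * (\<Sum>i=1..n. \<integral>\<^sup>+u. f (u, w i) \<partial>\<mu> i)"
    if [measurable]: "f \<in> borel_measurable ?B" for f
  proof -
    have "ennreal (1 / real n) * (\<Sum>i=1..n. \<integral>\<^sup>+u. f (u, w i) \<partial>\<mu> i)
      = ennreal (1 / real n) * (\<Sum>i=1..n. \<integral>\<^sup>+z. ?d i z * f (fst z, w i) \<partial>\<pi>)"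
      by (intro arg_cong2[where f="(*)"] sum.cong refl int_mu) measurable
    also have "\<dots> = (\<integral>\<^sup>+z. ennreal (1 / real n) * (\<Sum>i=1..n. ?d i z * f (fst z, w i)) \<partial>\<pi>)"
      by (simp add: nn_integral_sum nn_integral_cmult)
    also have "\<dots> = (\<integral>\<^sup>+z. f z \<partial>\<pi>)"
    proof (rule nn_integral_cong_AE, use ae in eventually_elim)
      fix z :: "'a \<times> 'a" assume z: "snd z \<in> w ` {1..n}"
      \<comment> \<open>Exactly \<open>k (snd z)\<close> indices contribute for a given
        \<open>z\<close>, each with the same value, and their number cancels the weight
        \<open>n / k (snd z)\<close>.\<close>
      have "ennreal (1 / real n) * (\<Sum>i=1..n. ?d i z * f (fst z, w i))
        = ennreal (1 / real n) * (\<Sum>i=1..n. (ennreal (real n / real (k (snd z))) * f z) * ennreal (indicator {snd z} (w i)))"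
      proof (rule arg_cong2[where f="(*)", OF refl], rule sum.cong[OF refl])
        fix i
        show "?d i z * f (fst z, w i) = (ennreal (real n / real (k (snd z))) * f z) * ennreal (indicator {snd z} (w i))"
        proof (cases "w i = snd z")
          case True
          then show ?thesis by (metis (no_types, lifting) True ennreal_1 indicator_simps(1) mult.right_neutral prod.collapse singletonI)
        qed (auto simp: indicator_def)
      qed
      also have "\<dots> = ennreal (1 / real n) * ((ennreal (real n / real (k (snd z))) * f z) * ennreal (\<Sum>i=1..n. indicator {snd z} (w i)))"
        by (subst sum_ennreal[symmetric]) (simp_all flip: sum_distrib_left)
      also have "\<dots> = (ennreal (1 / real n) * ennreal (real n / real (k (snd z))) * ennreal (k (snd z))) * f z"
        by (simp only: card_k mult_ac)
      also have "ennreal (1 / real n) * ennreal (real n / real (k (snd z))) * ennreal (k (snd z)) = 1"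
      proof -
        have "0 < k (snd z)" using z k by auto
        then show ?thesis using n by (simp flip: ennreal_mult)
      qed
      finally show "ennreal (1 / real n) * (\<Sum>i=1..n. ?d i z * f (fst z, w i)) = f z" by simp
    qed
    finally show ?thesis by simp
  qed
  moreover have "sets (\<mu> i) = sets borel" for i by (simp add: \<mu>_def)
  ultimately show ?thesis using that[of \<mu>] prob by blast
qed

text \<open>Converse to \<open>profile_function_le_family\<close>. The inequality is strict because
  the infima over laws and over couplings need not be attained.\<close>

lemma profile_function_less_family:
  fixes c :: "'a::t1_space \<Rightarrow> 'a \<Rightarrow> real" and H :: "'a \<Rightarrow> 't \<Rightarrow> 'b::euclidean_space"
  assumes n: "1 \<le> n" and c[measurable]: "case_prod c \<in> borel_measurable (borel \<Otimes>\<^sub>M borel)"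
    and h[measurable]: "(\<lambda>x. H x \<theta>) \<in> borel_measurable borel"
    and less: "profile_function c H n w \<theta> < a"
  obtains \<mu> where "feasible_family (\<lambda>x. H x \<theta>) n \<mu>"
    "ennreal (1 / real n) * (\<Sum>i=1..n. \<integral>\<^sup>+u. ennreal (c u (w i)) \<partial>\<mu> i) < a"
proof -
  from less obtain P where P: "prob_space P" "sets P = sets borel" "integrable P (\<lambda>x. H x \<theta>)"
      "(\<integral>x. H x \<theta> \<partial>P) = 0" "transport_cost c P (empirical_measure n w) < a"
    unfolding profile_function_def INF_less_iff by blast
  then obtain \<pi> where \<pi>: "\<pi> \<in> couplings P (empirical_measure n w)"
      "(\<integral>\<^sup>+z. ennreal (c (fst z) (snd z)) \<partial>\<pi>) < a"
    unfolding transport_cost_def INF_less_iff by blast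
  obtain \<mu> where mu: "\<And>i. i \<in> {1..n} \<Longrightarrow> prob_space (\<mu> i) \<and> sets (\<mu> i) = sets borel"
    "\<And>f. f \<in> borel_measurable (borel \<Otimes>\<^sub>M borel) \<Longrightarrow>
      (\<integral>\<^sup>+z. f z \<partial>\<pi>) = ennreal (1 / real n) * (\<Sum>i=1..n. \<integral>\<^sup>+u. f (u, w i) \<partial>\<mu> i)"
    by (rule coupling_empirical_disintegration[OF n \<pi>(1)], rule that)
  have [measurable_cong]: "sets \<pi> = sets (borel \<Otimes>\<^sub>M borel)" and P_eq: "P = distr \<pi> borel fst"
    using \<pi>(1) by (auto simp: couplings_def)
  have int_P: "(\<integral>\<^sup>+x. f x \<partial>P) = ennreal (1 / real n) * (\<Sum>i=1..n. \<integral>\<^sup>+u. f u \<partial>\<mu> i)"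
    if [measurable]: "f \<in> borel_measurable borel" for f
    unfolding P_eq by (subst nn_integral_distr) (simp_all add: mu(2))
  have int: "integrable (\<mu> i) (\<lambda>x. H x \<theta>)" if "i \<in> {1..n}" for i
  proof -
    have "\<forall>i\<in>{1..n}. integrable (\<mu> i) (\<lambda>x. H x \<theta>)"
      by (rule average_integrable_iff[OF n P(2), THEN iffD1, OF _ _ h P(3)]) (use mu(1) int_P in blast)+
    then show ?thesis using that by simp
  qed
  have "(1 / real n) *\<^sub>R (\<Sum>i=1..n. \<integral>x. H x \<theta> \<partial>\<mu> i) = (\<integral>x. H x \<theta> \<partial>P)"
    by (rule average_integral[symmetric, OF P(2)]) (use mu(1) int P(3) h int_P in blast)+
  then have "(\<Sum>i=1..n. \<integral>x. H x \<theta> \<partial>\<mu> i) = 0" using n P(4) by simp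
  then have "feasible_family (\<lambda>x. H x \<theta>) n \<mu>"
    using mu(1) int by (simp add: feasible_family_def)
  moreover have "ennreal (1 / real n) * (\<Sum>i=1..n. \<integral>\<^sup>+u. ennreal (c u (w i)) \<partial>\<mu> i) < a"
    using \<pi>(2) mu(2)[of "\<lambda>z. ennreal (c (fst z) (snd z))"] by simp
  ultimately show ?thesis by (rule that)
qed

text \<open>Integrating the pointwise bound against \<open>\<mu> i\<close> and summing over
  \<open>i\<close> removes the multiplier term, because the moments of a feasible family add up to
  zero.\<close>

lemma profile_function_weak_duality:
  fixes c :: "'a::t1_space \<Rightarrow> 'a \<Rightarrow> real" and H :: "'a \<Rightarrow> 't \<Rightarrow> 'b::euclidean_space"
  assumes n: "1 \<le> n" and c[measurable]: "case_prod c \<in> borel_measurable (borel \<Otimes>\<^sub>M borel)"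
    and c_nonneg: "\<And>u v. 0 \<le> c u v"
    and h[measurable]: "(\<lambda>x. H x \<theta>) \<in> borel_measurable borel"
    and k: "\<And>i u. i \<in> {1..n} \<Longrightarrow> k i \<le> c u (w i) + l \<bullet> H u \<theta>"
  shows "ennreal ((1 / real n) * (\<Sum>i=1..n. k i)) \<le> profile_function c H n w \<theta>"
proof (rule ccontr)
  assume "\<not> ?thesis"
  then have "profile_function c H n w \<theta> < ennreal ((1 / real n) * (\<Sum>i=1..n. k i))" by simp
  from profile_function_less_family[OF n c h this]
  obtain \<mu> where feas: "feasible_family (\<lambda>x. H x \<theta>) n \<mu>"
    and less: "ennreal (1 / real n) * (\<Sum>i=1..n. \<integral>\<^sup>+u. ennreal (c u (w i)) \<partial>\<mu> i) < ennreal ((1 / real n) * (\<Sum>i=1..n. k i))"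
    by blast
  have mu: "prob_space (\<mu> i)" "sets (\<mu> i) = sets borel" "integrable (\<mu> i) (\<lambda>x. H x \<theta>)"
    if "i \<in> {1..n}" for i
    using feas that by (auto simp: feasible_family_def)
  have meas: "(\<lambda>u. c u (w i)) \<in> borel_measurable (\<mu> i)" if "i \<in> {1..n}" for i
    using mu(2)[OF that] by (simp cong: measurable_cong_sets)
  \<comment> \<open>The assumed strict inequality makes every single cost finite, which permits the
    passage to Bochner integrals.\<close>
  have "ennreal (1 / real n) * (\<Sum>i=1..n. \<integral>\<^sup>+u. ennreal (c u (w i)) \<partial>\<mu> i) < \<top>"
    using less by (rule less_le_trans) simp
  then have fin: "(\<integral>\<^sup>+u. ennreal (c u (w i)) \<partial>\<mu> i) < \<top>" if "i \<in> {1..n}" for i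
    using n that by (auto simp: ennreal_mult_less_top)
  then have int_c: "integrable (\<mu> i) (\<lambda>u. c u (w i))" if "i \<in> {1..n}" for i
    using that meas c_nonneg by (simp add: integrable_iff_bounded)
  have "k i \<le> (\<integral>u. c u (w i) \<partial>\<mu> i) + l \<bullet> (\<integral>u. H u \<theta> \<partial>\<mu> i)" if i: "i \<in> {1..n}" for i
  proof -
    interpret prob_space "\<mu> i" by (rule mu(1)[OF i])
    have "k i = (\<integral>u. k i \<partial>\<mu> i)" using prob_space by simp
    also have "\<dots> \<le> (\<integral>u. c u (w i) + l \<bullet> H u \<theta> \<partial>\<mu> i)"
      using int_c[OF i] mu(3)[OF i] k[OF i] by (intro integral_mono) auto
    also have "\<dots> = (\<integral>u. c u (w i) \<partial>\<mu> i) + l \<bullet> (\<integral>u. H u \<theta> \<partial>\<mu> i)"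
      using int_c[OF i] mu(3)[OF i] by simp
    finally show ?thesis .
  qed
  then have "(\<Sum>i=1..n. k i) \<le> (\<Sum>i=1..n. (\<integral>u. c u (w i) \<partial>\<mu> i) + l \<bullet> (\<integral>u. H u \<theta> \<partial>\<mu> i))"
    by (intro sum_mono) auto
  also have "\<dots> = (\<Sum>i=1..n. \<integral>u. c u (w i) \<partial>\<mu> i) + l \<bullet> (\<Sum>i=1..n. \<integral>u. H u \<theta> \<partial>\<mu> i)"
    by (simp add: sum.distrib inner_sum_right)
  also have "\<dots> = (\<Sum>i=1..n. \<integral>u. c u (w i) \<partial>\<mu> i)"
    using feas by (simp add: feasible_family_def)
  finally have "ennreal ((1 / real n) * (\<Sum>i=1..n. k i)) \<le> ennreal ((1 / real n) * (\<Sum>i=1..n. \<integral>u. c u (w i) \<partial>\<mu> i))"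
    by (intro ennreal_leI mult_left_mono) auto
  also have "\<dots> = ennreal (1 / real n) * ennreal (\<Sum>i=1..n. \<integral>u. c u (w i) \<partial>\<mu> i)"
    using c_nonneg by (intro ennreal_mult) (auto intro!: sum_nonneg)
  also have "\<dots> = ennreal (1 / real n) * (\<Sum>i=1..n. ennreal (\<integral>u. c u (w i) \<partial>\<mu> i))"
    using c_nonneg by (subst sum_ennreal) auto
  also have "\<dots> = ennreal (1 / real n) * (\<Sum>i=1..n. \<integral>\<^sup>+u. ennreal (c u (w i)) \<partial>\<mu> i)"
    using c_nonneg int_c by (intro arg_cong2[where f="(*)"] sum.cong refl nn_integral_eq_integral[symmetric]) auto
  finally show False using less by simp
qed

text \<open>Sample \<open>i\<close> is moved to \<open>z i j\<close> with probability
  \<open>t j\<close>. The randomization makes the moment condition and the cost linear in the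
  weights, which are shared by all samples.\<close>

lemma profile_function_le_mixture:
  fixes c :: "'a::topological_space \<Rightarrow> 'a \<Rightarrow> real" and H :: "'a \<Rightarrow> 't \<Rightarrow> 'b::euclidean_space"
  assumes n: "1 \<le> n" and c[measurable]: "case_prod c \<in> borel_measurable (borel \<Otimes>\<^sub>M borel)"
    and c_nonneg: "\<And>u v. 0 \<le> c u v"
    and h[measurable]: "(\<lambda>x. H x \<theta>) \<in> borel_measurable borel"
    and J: "finite J" "\<And>j. j \<in> J \<Longrightarrow> 0 \<le> t j" "(\<Sum>j\<in>J. t j) = (1::real)"
    and zero: "(\<Sum>i=1..n. \<Sum>j\<in>J. t j *\<^sub>R H (z i j) \<theta>) = 0"
  shows "profile_function c H n w \<theta> \<le> ennreal ((1 / real n) * (\<Sum>i=1..n. \<Sum>j\<in>J. t j * c (z i j) (w i)))"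
proof -
  define \<mu> where "\<mu> i = distr (point_measure J t) borel (z i)" for i
  have "prob_space (point_measure J (\<lambda>j. ennreal (t j)))"
    using J by (intro prob_spaceI) (simp add: space_point_measure emeasure_point_measure_finite sum_ennreal)
  then have "prob_space (\<mu> i)" for i
    unfolding \<mu>_def by (intro prob_space.prob_space_distr) auto
  moreover have "integrable (\<mu> i) (\<lambda>x. H x \<theta>)" for i
    unfolding \<mu>_def using J by (subst integrable_distr_eq) (auto intro!: integrable_point_measure_finite)
  moreover have "(\<integral>x. H x \<theta> \<partial>\<mu> i) = (\<Sum>j\<in>J. t j *\<^sub>R H (z i j) \<theta>)" for i
    unfolding \<mu>_def using J by (subst integral_distr) (auto simp: lebesgue_integral_point_measure_finite)
  ultimately have "feasible_family (\<lambda>x. H x \<theta>) n \<mu>"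
    using zero by (simp add: feasible_family_def \<mu>_def)
  then have "profile_function c H n w \<theta> \<le> ennreal (1 / real n) * (\<Sum>i=1..n. \<integral>\<^sup>+u. ennreal (c u (w i)) \<partial>\<mu> i)"
    by (intro profile_function_le_family n c h)
  also have "\<dots> = ennreal (1 / real n) * (\<Sum>i=1..n. ennreal (\<Sum>j\<in>J. t j * c (z i j) (w i)))"
  proof -
    have "(\<integral>\<^sup>+u. ennreal (c u (w i)) \<partial>\<mu> i) = ennreal (\<Sum>j\<in>J. t j * c (z i j) (w i))" for i
    proof -
      have "(\<integral>\<^sup>+u. ennreal (c u (w i)) \<partial>\<mu> i) = (\<integral>\<^sup>+j. ennreal (c (z i j) (w i)) \<partial>point_measure J t)"
        unfolding \<mu>_def by (rule nn_integral_distr) auto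
      also have "\<dots> = (\<Sum>j\<in>J. ennreal (t j) * ennreal (c (z i j) (w i)))"
        by (rule nn_integral_point_measure_finite[OF J(1)])
      also have "\<dots> = (\<Sum>j\<in>J. ennreal (t j * c (z i j) (w i)))"
        using J(2) c_nonneg by (intro sum.cong refl ennreal_mult[symmetric]) auto
      also have "\<dots> = ennreal (\<Sum>j\<in>J. t j * c (z i j) (w i))"
        using J(2) c_nonneg by (intro sum_ennreal) auto
      finally show ?thesis .
    qed
    then show ?thesis by simp
  qed
  also have "\<dots> = ennreal (1 / real n) * ennreal (\<Sum>i=1..n. \<Sum>j\<in>J. t j * c (z i j) (w i))"
    using J c_nonneg by (subst sum_ennreal) (auto intro!: sum_nonneg)
  also have "\<dots> = ennreal ((1 / real n) * (\<Sum>i=1..n. \<Sum>j\<in>J. t j * c (z i j) (w i)))"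
    using J c_nonneg by (intro ennreal_mult[symmetric]) (auto intro!: sum_nonneg)
  finally show ?thesis .
qed

text \<open>Otherwise a hyperplane separates the convex hull of the points \<open>(y j, a j)\<close> from the ray
  below \<open>(0, v)\<close>.\<close>

lemma finite_linear_duality:
  fixes y :: "'j \<Rightarrow> 'v::euclidean_space" and a :: "'j \<Rightarrow> real"
  assumes J: "finite J" and dual: "\<And>z. \<exists>j\<in>J. a j + z \<bullet> y j \<le> v"
  obtains t where "\<And>j. j \<in> J \<Longrightarrow> 0 \<le> t j" "(\<Sum>j\<in>J. t j) = 1"
    "(\<Sum>j\<in>J. t j *\<^sub>R y j) = 0" "(\<Sum>j\<in>J. t j * a j) \<le> v"
proof -
  have ne: "J \<noteq> {}" using dual[of 0] by auto
  define P where "P = (\<lambda>j. (y j, a j)) ` J"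
  define R where "R = {(0::'v)} \<times> {..v}"
  have "convex hull P \<inter> R \<noteq> {}"
  proof
    assume disj: "convex hull P \<inter> R = {}"
    have "compact (convex hull P)" unfolding P_def using J by (intro finite_imp_compact_convex_hull) auto
    moreover have "convex hull P \<noteq> {}" using ne by (simp add: P_def)
    moreover have "convex R" "closed R" "R \<noteq> {}"
      by (auto simp: R_def intro!: convex_Times closed_Times)
    ultimately obtain c b where sep: "\<forall>x\<in>convex hull P. c \<bullet> x < b" "\<forall>x\<in>R. b < c \<bullet> x"
      using separating_hyperplane_compact_closed[of "convex hull P" R] disj by auto
    obtain z \<tau> where c: "c = (z, \<tau>)" by (cases c)
    have P: "z \<bullet> y j + \<tau> * a j < b" if "j \<in> J" for j
    proof -
      have "(y j, a j) \<in> convex hull P" using that by (intro hull_inc) (auto simp: P_def)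
      then show ?thesis using sep(1) by (force simp: c)
    qed
    have R: "b < \<tau> * r" if "r \<le> v" for r
      using sep(2) that by (auto simp: R_def c)
    \<comment> \<open>The ray extends to minus infinity, so a positive \<open>\<tau>\<close> would
      violate its bound far enough down.\<close>
    have "\<tau> \<le> 0"
    proof (rule ccontr)
      assume "\<not> \<tau> \<le> 0"
      then have "\<tau> * min v (b / \<tau>) \<le> b" by (simp add: min_def field_simps)
      then show False using R[of "min v (b / \<tau>)"] by simp
    qed
    show False
    proof (cases "\<tau> = 0")
      \<comment> \<open>A vertical hyperplane puts all \<open>y j\<close> strictly on one side. A
        multiple of \<open>z\<close> so large that \<open>B\<close> exceeds all
        \<open>\<bar>a j\<bar>\<close> and \<open>\<bar>v\<bar>\<close> together then contradicts
        \<open>dual\<close>.\<close>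
      case True
      then have b: "b < 0" using R[of v] by simp
      define B where "B = (\<Sum>j\<in>J. \<bar>a j\<bar>) + \<bar>v\<bar> + 1"
      have B: "0 < B" by (simp add: B_def add_nonneg_pos sum_nonneg)
      obtain j where j: "j \<in> J" "a j + ((B / b) *\<^sub>R z) \<bullet> y j \<le> v"
        using dual by blast
      have "z \<bullet> y j < b" using P[OF j(1)] True by simp
      then have "B / b * b < B / b * (z \<bullet> y j)"
        using B b by (intro mult_strict_left_mono_neg) (auto simp: divide_pos_neg)
      then have "B < B / b * (z \<bullet> y j)" using b by simp
      moreover have "\<bar>a j\<bar> \<le> (\<Sum>j\<in>J. \<bar>a j\<bar>)" using J j(1) by (intro member_le_sum) auto
      ultimately show False using j(2) unfolding inner_scaleR_left B_def by linarith
    next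
      case False
      then have \<tau>: "\<tau> < 0" using \<open>\<tau> \<le> 0\<close> by simp
      \<comment> \<open>The offending multiplier is read off the separating functional, normalized
        so that its last coordinate is one.\<close>
      obtain j where j: "j \<in> J" "a j + ((1 / \<tau>) *\<^sub>R z) \<bullet> y j \<le> v"
        using dual by blast
      then have "\<tau> * v \<le> \<tau> * (a j + (1 / \<tau>) * (z \<bullet> y j))"
        using \<tau> by (intro mult_left_mono_neg) auto
      also have "\<dots> = z \<bullet> y j + \<tau> * a j" using \<tau> by (simp add: field_simps)
      also have "\<dots> < b" by (rule P[OF j(1)])
      finally show False using R[of v] by simp
    qed
  qed
  then obtain x where x: "x \<in> convex hull P" "x \<in> R" by blast
  \<comment> \<open>Different indices may give the same point of \<open>P\<close>, yet weights
    indexed by \<open>J\<close> are wanted. The combinations with such weights form a convex set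
    containing \<open>P\<close>, hence its hull.\<close>
  obtain u where u: "\<forall>j\<in>J. 0 \<le> u j" "sum u J = 1" "(\<Sum>j\<in>J. u j *\<^sub>R (y j, a j)) = x"
  proof -
    let ?Q = "{\<Sum>j\<in>J. u j *\<^sub>R (y j, a j) |u. (\<forall>j\<in>J. 0 \<le> u j) \<and> sum u J = 1}"
    have "P \<subseteq> ?Q"
    proof
      fix x assume "x \<in> P"
      then obtain i where i: "i \<in> J" "x = (y i, a i)" by (auto simp: P_def)
      have "(\<Sum>j\<in>J. (if j = i then 1 else 0) *\<^sub>R (y j, a j)) = (\<Sum>j\<in>J. if j = i then (y j, a j) else 0)"
        by (intro sum.cong refl) (auto simp: zero_prod_def)
      also have "\<dots> = x" using J i by (simp only: sum.delta) simp
      finally have "x = (\<Sum>j\<in>J. (if j = i then 1 else 0) *\<^sub>R (y j, a j))" ..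
      moreover have "sum (\<lambda>j. if j = i then 1 else 0 :: real) J = 1" using J i by simp
      ultimately show "x \<in> ?Q" by (intro CollectI exI[of _ "\<lambda>j. if j = i then 1 else 0"]) simp
    qed
    moreover have "convex ?Q"
    proof (rule convexI)
      fix x x' and r r' :: real
      assume "x \<in> ?Q" "x' \<in> ?Q" and r: "0 \<le> r" "0 \<le> r'" "r + r' = 1"
      then obtain u u' where u: "x = (\<Sum>j\<in>J. u j *\<^sub>R (y j, a j))" "\<forall>j\<in>J. 0 \<le> u j" "sum u J = 1"
        "x' = (\<Sum>j\<in>J. u' j *\<^sub>R (y j, a j))" "\<forall>j\<in>J. 0 \<le> u' j" "sum u' J = 1" by blast
      have "r *\<^sub>R x + r' *\<^sub>R x' = (\<Sum>j\<in>J. (r * u j + r' * u' j) *\<^sub>R (y j, a j))"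
        unfolding u by (simp only: scaleR_sum_right scaleR_scaleR scaleR_left_distrib sum.distrib)
      moreover have "(\<Sum>j\<in>J. r * u j + r' * u' j) = 1"
        using u r by (simp add: sum.distrib flip: sum_distrib_left)
      ultimately show "r *\<^sub>R x + r' *\<^sub>R x' \<in> ?Q"
        using u r by (intro CollectI exI[of _ "\<lambda>j. r * u j + r' * u' j"]) simp
    qed
    ultimately have "x \<in> ?Q" using x(1) hull_minimal[of P ?Q convex] by blast
    then show ?thesis using that by blast
  qed
  show ?thesis
  proof (rule that[of u])
    have "(\<Sum>j\<in>J. u j *\<^sub>R y j) = fst x" "(\<Sum>j\<in>J. u j * a j) = snd x"
      unfolding u(3)[symmetric] by (simp_all add: fst_sum snd_sum)
    then show "(\<Sum>j\<in>J. u j *\<^sub>R y j) = 0" "(\<Sum>j\<in>J. u j * a j) \<le> v"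
      using x(2) by (auto simp: R_def)
  qed (use u in auto)
qed

section \<open>Measurability of the profile through open sublevel sets\<close>

lemma continuous_cost_integral:
  fixes c :: "'a::{second_countable_topology, metric_space} \<Rightarrow> 'a \<Rightarrow> real"
  assumes "finite_measure \<mu>" "sets \<mu> = sets borel"
    and c: "case_prod c \<in> borel_measurable (borel \<Otimes>\<^sub>M borel)"
    and nonneg: "\<And>u v. 0 \<le> c u v"
    and cont: "\<And>u. continuous_on UNIV (c u)"
    and growth: "\<And>r. \<exists>C. \<forall>u v v'. dist v v' \<le> r \<longrightarrow> c u v' \<le> C * (1 + c u v)"
    and int: "integrable \<mu> (\<lambda>u. c u v0)"
  shows "integrable \<mu> (\<lambda>u. c u v)" "continuous_on UNIV (\<lambda>v. \<integral>u. c u v \<partial>\<mu>)"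
proof -
  interpret finite_measure \<mu> by fact
  have meas: "(\<lambda>u. c u v) \<in> borel_measurable \<mu>" for v
    using c assms(2) by (simp cong: measurable_cong_sets)
  show int_v: "integrable \<mu> (\<lambda>u. c u v)" for v
  proof -
    obtain C where C: "\<And>u. c u v \<le> C * (1 + c u v0)"
      using growth[of "dist v0 v"] by auto
    have "integrable \<mu> (\<lambda>u. C * (1 + c u v0))" using int by simp
    then show ?thesis
      by (rule Bochner_Integration.integrable_bound)
         (use meas C nonneg in \<open>auto intro!: AE_I2 order_trans[OF _ abs_ge_self]\<close>)
  qed
  show "continuous_on UNIV (\<lambda>v. \<integral>u. c u v \<partial>\<mu>)"
  proof (rule continuous_on_sequentiallyI)
    fix s v assume s: "s \<longlonglongrightarrow> (v :: 'a)"
    obtain C where C: "\<And>u v'. dist v v' \<le> 1 \<Longrightarrow> c u v' \<le> C * (1 + c u v)"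
      using growth[of 1] by blast
    obtain n0 where n0: "\<And>n. n0 \<le> n \<Longrightarrow> dist (s n) v < 1"
      using s unfolding lim_sequentially by (metis zero_less_one)
    have "(\<lambda>n. \<integral>u. c u (s (n + n0)) \<partial>\<mu>) \<longlonglongrightarrow> (\<integral>u. c u v \<partial>\<mu>)"
    proof (rule integral_dominated_convergence)
      show "integrable \<mu> (\<lambda>u. C * (1 + c u v))" using int_v by simp
      show "AE u in \<mu>. (\<lambda>n. c u (s (n + n0))) \<longlonglongrightarrow> c u v"
      proof (rule AE_I2)
        fix u
        have "(\<lambda>n. c u (s n)) \<longlonglongrightarrow> c u v"
          using cont[of u] s by (auto simp: continuous_on_sequentially comp_def)
        then show "(\<lambda>n. c u (s (n + n0))) \<longlonglongrightarrow> c u v" by (rule LIMSEQ_ignore_initial_segment)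
      qed
      show "AE u in \<mu>. norm (c u (s (n + n0))) \<le> C * (1 + c u v)" for n
      proof (rule AE_I2)
        fix u
        have "dist v (s (n + n0)) \<le> 1" using n0[of "n + n0"] by (simp add: dist_commute)
        then show "norm (c u (s (n + n0))) \<le> C * (1 + c u v)" using C nonneg by simp
      qed
    qed (rule meas)+
    then show "(\<lambda>n. \<integral>u. c u (s n) \<partial>\<mu>) \<longlonglongrightarrow> (\<integral>u. c u v \<partial>\<mu>)" by (rule LIMSEQ_offset)
  qed
qed

text \<open>The profile function is an infimum of continuous functions of the sample, one for each
  feasible family.\<close>

lemma open_profile_function_less:
  fixes c :: "'a::{second_countable_topology, metric_space} \<Rightarrow> 'a \<Rightarrow> real" and H :: "'a \<Rightarrow> 't \<Rightarrow> 'b::euclidean_space"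
  assumes n: "1 \<le> n" and c: "case_prod c \<in> borel_measurable (borel \<Otimes>\<^sub>M borel)"
    and nonneg: "\<And>u v. 0 \<le> c u v"
    and cont: "\<And>u. continuous_on UNIV (c u)"
    and growth: "\<And>r. \<exists>C. \<forall>u v v'. dist v v' \<le> r \<longrightarrow> c u v' \<le> C * (1 + c u v)"
    and h: "(\<lambda>x. H x \<theta>) \<in> borel_measurable borel"
  shows "open {w. profile_function c H n w \<theta> < a}"
proof (subst open_subopen, intro ballI)
  fix w assume "w \<in> {w. profile_function c H n w \<theta> < a}"
  then have "profile_function c H n w \<theta> < a" by simp
  from profile_function_less_family[where H=H and \<theta>=\<theta>, OF n c h this]
  obtain \<mu> where feas: "feasible_family (\<lambda>x. H x \<theta>) n \<mu>"
    and less: "ennreal (1 / real n) * (\<Sum>i=1..n. \<integral>\<^sup>+u. ennreal (c u (w i)) \<partial>\<mu> i) < a"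
    by blast
  have mu: "prob_space (\<mu> i)" "sets (\<mu> i) = sets borel" if "i \<in> {1..n}" for i
    using feas that by (auto simp: feasible_family_def)
  have meas: "(\<lambda>u. c u v) \<in> borel_measurable (\<mu> i)" if "i \<in> {1..n}" for i v
    using c mu(2)[OF that] by (simp cong: measurable_cong_sets)
  have "ennreal (1 / real n) * (\<Sum>i=1..n. \<integral>\<^sup>+u. ennreal (c u (w i)) \<partial>\<mu> i) < \<top>"
    using less by (rule less_le_trans) simp
  then have "(\<integral>\<^sup>+u. ennreal (c u (w i)) \<partial>\<mu> i) < \<top>" if "i \<in> {1..n}" for i
    using n that by (auto simp: ennreal_mult_less_top)
  then have int: "integrable (\<mu> i) (\<lambda>u. c u (w i))" if "i \<in> {1..n}" for i
    using that meas nonneg by (simp add: integrable_iff_bounded)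
  have fin: "finite_measure (\<mu> i)" if "i \<in> {1..n}" for i
    using mu(1)[OF that] by (simp add: prob_space_def)
  note ci = continuous_cost_integral[OF fin mu(2) c nonneg cont growth int]
  define g where "g w' = (1 / real n) * (\<Sum>i=1..n. \<integral>u. c u (w' i) \<partial>\<mu> i)" for w'
  have g: "ennreal (1 / real n) * (\<Sum>i=1..n. \<integral>\<^sup>+u. ennreal (c u (w' i)) \<partial>\<mu> i) = ennreal (g w')" for w'
  proof -
    have "(\<Sum>i=1..n. \<integral>\<^sup>+u. ennreal (c u (w' i)) \<partial>\<mu> i) = (\<Sum>i=1..n. ennreal (\<integral>u. c u (w' i) \<partial>\<mu> i))"
      using nonneg ci(1) by (intro sum.cong refl nn_integral_eq_integral) auto
    also have "\<dots> = ennreal (\<Sum>i=1..n. \<integral>u. c u (w' i) \<partial>\<mu> i)"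
      using nonneg by (intro sum_ennreal) auto
    finally show ?thesis
      unfolding g_def using nonneg by (simp only:) (intro ennreal_mult[symmetric], auto intro!: sum_nonneg)
  qed
  \<comment> \<open>Sample vectors carry the product topology, so evaluation at \<open>i\<close> is
    continuous.\<close>
  have "continuous_on UNIV (\<lambda>w'. \<integral>u. c u (w' i) \<partial>\<mu> i)" if "i \<in> {1..n}" for i
    by (rule continuous_on_compose2[OF ci(2)[OF that that that]]) (auto intro!: continuous_intros)
  then have "continuous_on UNIV (\<lambda>w'. ennreal (g w'))"
    unfolding g_def by (intro continuous_on_ennreal continuous_intros) auto
  then have "open {w'. ennreal (g w') < a}"
    by (rule open_Collect_less[OF _ continuous_on_const])
  moreover have "w \<in> {w'. ennreal (g w') < a}" using less g by simp
  moreover have "{w'. ennreal (g w') < a} \<subseteq> {w'. profile_function c H n w' \<theta> < a}"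
    using profile_function_le_family[where H=H and \<theta>=\<theta>, OF n c h feas] g by (auto intro: le_less_trans)
  ultimately show "\<exists>T. open T \<and> w \<in> T \<and> T \<subseteq> {w. profile_function c H n w \<theta> < a}" by blast
qed

text \<open>Passing through the Euclidean norm replaces Minkowski's inequality for
  \<open>lp_norm\<close>, at the price of a constant; the summand \<open>1\<close> covers
  \<open>u\<close> close to \<open>v\<close>.\<close>

lemma lp_cost_growth:
  assumes q: "1 \<le> q" and rho: "0 < \<rho>"
  shows "\<exists>C. \<forall>u v v' :: real ^ 'm. dist v v' \<le> r \<longrightarrow>
    lp_norm q (u - v') powr \<rho> \<le> C * (1 + lp_norm q (u - v) powr \<rho>)"
proof -
  define m where "m = real CARD('m)"
  have m: "1 \<le> m" by (simp add: m_def Suc_le_eq)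
  define A where "A = (m * (m + \<bar>r\<bar>)) powr \<rho>"
  have A: "0 \<le> A" by (simp add: A_def)
  have "lp_norm q (u - v') powr \<rho> \<le> (A * 2 powr \<rho>) * (1 + lp_norm q (u - v) powr \<rho>)"
    if "dist v v' \<le> r" for u v v' :: "real ^ 'm"
  proof -
    let ?l = "lp_norm q (u - v)"
    have "lp_norm q (u - v') \<le> m * norm (u - v')" unfolding m_def by (rule lp_norm_le_norm[OF q])
    also have "\<dots> \<le> m * (norm (u - v) + r)"
      using norm_triangle_ineq[of "u - v" "v - v'"] that m by (intro mult_left_mono) (auto simp: dist_norm)
    also have "\<dots> \<le> m * (m * ?l + \<bar>r\<bar> * 1)"
      using norm_le_lp_norm[OF q, of "u - v"] m unfolding m_def[symmetric] by (intro mult_left_mono) auto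
    also have "\<dots> \<le> m * ((m + \<bar>r\<bar>) * (?l + 1))"
      using m by (intro mult_left_mono) (auto simp: algebra_simps)
    finally have "lp_norm q (u - v') powr \<rho> \<le> (m * ((m + \<bar>r\<bar>) * (?l + 1))) powr \<rho>"
      using rho by (intro powr_mono2) auto
    also have "\<dots> = A * (?l + 1) powr \<rho>" using m by (simp add: A_def powr_mult)
    also have "(?l + 1) powr \<rho> \<le> (2 * max ?l 1) powr \<rho>" using rho by (intro powr_mono2) auto
    also have "\<dots> = 2 powr \<rho> * max ?l 1 powr \<rho>" by (simp add: powr_mult)
    also have "max ?l 1 powr \<rho> \<le> 1 + ?l powr \<rho>" by (auto simp: max_def)
    finally show ?thesis using A by (simp add: mult_left_mono mult.assoc)
  qed
  then show ?thesis by blast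
qed

lemma lp_cost_continuous:
  assumes "1 \<le> q" "0 < \<rho>"
  shows "continuous_on S (\<lambda>v. lp_norm q (u - v) powr \<rho>)"
  using assms by (intro continuous_on_powr' continuous_on_lp_norm continuous_intros) auto

lemma lp_cost_measurable:
  assumes "1 \<le> q"
  shows "(\<lambda>(u, v). lp_norm q (u - v) powr \<rho>) \<in> borel_measurable (borel \<Otimes>\<^sub>M borel)"
proof -
  note borel_measurable_lp_norm[OF assms, measurable]
  show ?thesis by measurable
qed

text \<open>An infimum over uncountably many measures need not be measurable in general. Here upper
  semicontinuity in the sample vector secures it.\<close>

lemma profile_function_measurable:
  fixes W :: "nat \<Rightarrow> 'a \<Rightarrow> real ^ 'm" and H :: "real ^ 'm \<Rightarrow> 't \<Rightarrow> 'b::euclidean_space"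
  assumes n: "1 \<le> n" and q: "1 \<le> q" and rho: "0 < \<rho>"
    and h: "(\<lambda>x. H x \<theta>) \<in> borel_measurable borel"
    and W[measurable]: "\<And>i. W i \<in> borel_measurable M"
  shows "(\<lambda>\<omega>. profile_function (\<lambda>u w. lp_norm q (u - w) powr \<rho>) H n (\<lambda>i. W i \<omega>) \<theta>) \<in> borel_measurable M"
proof -
  have W': "(\<lambda>\<omega>. (\<lambda>i. W i \<omega>)) \<in> borel_measurable M"
    by (rule measurable_coordinatewise_then_product) (rule W)
  have "(\<lambda>w. profile_function (\<lambda>u w. lp_norm q (u - w) powr \<rho>) H n w \<theta>) \<in> borel_measurable borel"
  proof (rule borel_measurableI_less)
    fix a
    have "open {w. profile_function (\<lambda>u w. lp_norm q (u - w) powr \<rho>) H n w \<theta> < a}"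
      by (rule open_profile_function_less[where H=H and \<theta>=\<theta>, OF n lp_cost_measurable[OF q]])
         (use h lp_cost_continuous[OF q rho] lp_cost_growth[OF q rho] in auto)
    then show "{w \<in> space borel. profile_function (\<lambda>u w. lp_norm q (u - w) powr \<rho>) H n w \<theta> < a} \<in> sets borel"
      by simp
  qed
  from measurable_compose[OF W' this] show ?thesis .
qed

section \<open>Multivariate weak convergence\<close>

lemma tail_probability_small:
  fixes Y :: "'a \<Rightarrow> 'c::euclidean_space"
  assumes "prob_space M" and [measurable]: "Y \<in> borel_measurable M" and e: "0 < e"
  obtains K where "measure M {\<omega>\<in>space M. K < norm (Y \<omega>)} \<le> e"
proof -
  interpret prob_space M by fact
  let ?A = "\<lambda>k::nat. {\<omega>\<in>space M. real k < norm (Y \<omega>)}"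
  have "(\<lambda>k. prob (?A k)) \<longlonglongrightarrow> prob (\<Inter>k. ?A k)"
  proof (rule finite_Lim_measure_decseq)
    show "range ?A \<subseteq> sets M" by auto
    show "decseq ?A" unfolding decseq_def by (auto intro: le_less_trans[rotated])
  qed
  also have "(\<Inter>k. ?A k) = {}"
    using reals_Archimedean2 by (auto dest: less_asym)
  finally have "(\<lambda>k. prob (?A k)) \<longlonglongrightarrow> 0" by simp
  then have "eventually (\<lambda>k. prob (?A k) < e) sequentially"
    using e by (rule order_tendstoD)
  then obtain k where "prob (?A k) < e" by (auto simp: eventually_sequentially)
  then show ?thesis using that[of "real k"] by simp
qed

text \<open>Composing polynomials with coordinatewise sines gives bounded functions, which are
  trigonometric polynomials and hence have convergent expectations.\<close>

lemma trigonometric_polynomial_expectation_tendsto: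
  fixes X :: "nat \<Rightarrow> 'a \<Rightarrow> 'c::euclidean_space" and Y :: "'b \<Rightarrow> 'c" and L :: real
  assumes M: "prob_space M" and N: "prob_space N"
    and X[measurable]: "\<And>n. X n \<in> borel_measurable M" and Y[measurable]: "Y \<in> borel_measurable N"
    and trig: "\<And>t c. (\<lambda>n. \<integral>\<omega>. cos (t \<bullet> X n \<omega> + c) \<partial>M) \<longlonglongrightarrow> (\<integral>\<omega>. cos (t \<bullet> Y \<omega> + c) \<partial>N)"
    and p: "real_polynomial_function p"
  defines "q \<equiv> \<lambda>x. p (\<Sum>b\<in>Basis. sin ((x \<bullet> b) / L) *\<^sub>R b)"
  shows "(\<lambda>n. \<integral>\<omega>. q (X n \<omega>) \<partial>M) \<longlonglongrightarrow> (\<integral>\<omega>. q (Y \<omega>) \<partial>N)"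
proof -
  interpret M: prob_space M by fact
  interpret N: prob_space N by fact
  \<comment> \<open>The class carries an arbitrary cosine factor: convergence of the expectations of
    \<open>g\<close> alone would not survive multiplication by a further sine.\<close>
  define C where "C g \<longleftrightarrow> g \<in> borel_measurable borel \<and> (\<exists>B. \<forall>x. \<bar>g x\<bar> \<le> B) \<and>
    (\<forall>t c. (\<lambda>n. \<integral>\<omega>. g (X n \<omega>) * cos (t \<bullet> X n \<omega> + c) \<partial>M) \<longlonglongrightarrow> (\<integral>\<omega>. g (Y \<omega>) * cos (t \<bullet> Y \<omega> + c) \<partial>N))"
    for g :: "'c \<Rightarrow> real"
  have CI: "C g" if "g \<in> borel_measurable borel" "\<And>x. \<bar>g x\<bar> \<le> B"
    "\<And>t c. (\<lambda>n. \<integral>\<omega>. g (X n \<omega>) * cos (t \<bullet> X n \<omega> + c) \<partial>M) \<longlonglongrightarrow> (\<integral>\<omega>. g (Y \<omega>) * cos (t \<bullet> Y \<omega> + c) \<partial>N)" for g B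
    using that unfolding C_def by blast
  have int_cos: "integrable M (\<lambda>\<omega>. g (X n \<omega>) * cos (t \<bullet> X n \<omega> + c))"
      "integrable N (\<lambda>\<omega>. g (Y \<omega>) * cos (t \<bullet> Y \<omega> + c))" if "C g" for g n t c
  proof -
    from that obtain B where B: "\<And>x. \<bar>g x\<bar> \<le> B" and [measurable]: "g \<in> borel_measurable borel"
      unfolding C_def by blast
    have *: "\<bar>g x\<bar> * \<bar>cos y\<bar> \<le> B" for x y
      using mult_mono[OF B[of x] abs_cos_le_one[of y]] B[of x] by simp
    show "integrable M (\<lambda>\<omega>. g (X n \<omega>) * cos (t \<bullet> X n \<omega> + c))"
      by (rule M.integrable_const_bound[where B=B]) (auto simp: abs_mult *)
    show "integrable N (\<lambda>\<omega>. g (Y \<omega>) * cos (t \<bullet> Y \<omega> + c))"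
      by (rule N.integrable_const_bound[where B=B]) (auto simp: abs_mult *)
  qed
  have C_add: "C (\<lambda>x. f x + g x)" if "C f" "C g" for f g
  proof -
    from that obtain A where A: "\<And>x. \<bar>f x\<bar> \<le> A" and [measurable]: "f \<in> borel_measurable borel"
      unfolding C_def by blast
    from that obtain B where B: "\<And>x. \<bar>g x\<bar> \<le> B" and [measurable]: "g \<in> borel_measurable borel"
      unfolding C_def by blast
    have "\<bar>f x + g x\<bar> \<le> A + B" for x
      using A[of x] B[of x] by linarith
    moreover have "(\<lambda>n. \<integral>\<omega>. (f (X n \<omega>) + g (X n \<omega>)) * cos (t \<bullet> X n \<omega> + c) \<partial>M)
        \<longlonglongrightarrow> (\<integral>\<omega>. (f (Y \<omega>) + g (Y \<omega>)) * cos (t \<bullet> Y \<omega> + c) \<partial>N)" for t c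
      using that int_cos[OF that(1)] int_cos[OF that(2)]
      by (auto simp: distrib_right C_def intro: tendsto_add)
    ultimately show ?thesis by (intro CI) auto
  qed
  have C_cmult: "C (\<lambda>x. a * g x)" if "C g" for a g
  proof -
    from that obtain B where B: "\<And>x. \<bar>g x\<bar> \<le> B" and [measurable]: "g \<in> borel_measurable borel"
      unfolding C_def by blast
    have "\<bar>a * g x\<bar> \<le> \<bar>a\<bar> * B" for x
      using B[of x] by (auto simp: abs_mult intro: mult_left_mono)
    moreover have "(\<lambda>n. \<integral>\<omega>. (a * g (X n \<omega>)) * cos (t \<bullet> X n \<omega> + c) \<partial>M)
        \<longlonglongrightarrow> (\<integral>\<omega>. (a * g (Y \<omega>)) * cos (t \<bullet> Y \<omega> + c) \<partial>N)" for t c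
      using that by (auto simp: mult.assoc C_def intro: tendsto_mult_left)
    ultimately show ?thesis by (intro CI) auto
  qed
  have C_sin: "C (\<lambda>x. sin (s \<bullet> x) * g x)" if "C g" for s g
  proof -
    from that obtain B where B: "\<And>x. \<bar>g x\<bar> \<le> B" and [measurable]: "g \<in> borel_measurable borel"
      unfolding C_def by blast
    have "\<bar>sin (s \<bullet> x) * g x\<bar> \<le> B" for x
      using mult_mono[OF abs_sin_le_one[of "s \<bullet> x"] B[of x]] B[of x] by (simp add: abs_mult)
    moreover have "(\<lambda>n. \<integral>\<omega>. sin (s \<bullet> X n \<omega>) * g (X n \<omega>) * cos (t \<bullet> X n \<omega> + c) \<partial>M)
        \<longlonglongrightarrow> (\<integral>\<omega>. sin (s \<bullet> Y \<omega>) * g (Y \<omega>) * cos (t \<bullet> Y \<omega> + c) \<partial>N)" for t c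
    proof -
      \<comment> \<open>Product-to-sum formula; phase shifts by \<open>pi / 2\<close> write the
        resulting sines as cosines, so cosine factors alone close the induction.\<close>
      have eq: "sin (s \<bullet> x) * g x * cos (t \<bullet> x + c) = (1 / 2) * (g x * cos ((t + s) \<bullet> x + (c - pi / 2))) +
          (1 / 2) * (g x * cos ((s - t) \<bullet> x + (- c - pi / 2)))" for x
      proof -
        have "(t + s) \<bullet> x + (c - pi / 2) = (s \<bullet> x + (t \<bullet> x + c)) - pi / 2"
          "(s - t) \<bullet> x + (- c - pi / 2) = (s \<bullet> x - (t \<bullet> x + c)) - pi / 2"
          by (simp_all add: inner_add_left inner_diff_left)
        moreover have "cos (y - pi / 2) = sin y" for y
          using cos_sin_eq[of "y - pi / 2"] sin_minus[of "y - pi"] by (simp add: cos_diff)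
        ultimately have "cos ((t + s) \<bullet> x + (c - pi / 2)) + cos ((s - t) \<bullet> x + (- c - pi / 2)) =
            2 * (sin (s \<bullet> x) * cos (t \<bullet> x + c))"
          by (simp only: sin_add sin_diff)
        then have "g x * (cos ((t + s) \<bullet> x + (c - pi / 2)) + cos ((s - t) \<bullet> x + (- c - pi / 2))) =
            g x * (2 * (sin (s \<bullet> x) * cos (t \<bullet> x + c)))" by simp
        then show ?thesis by (simp only: distrib_left mult_ac)
      qed
      have *: "(\<lambda>n. \<integral>\<omega>. g (X n \<omega>) * cos (t \<bullet> X n \<omega> + c) \<partial>M) \<longlonglongrightarrow> (\<integral>\<omega>. g (Y \<omega>) * cos (t \<bullet> Y \<omega> + c) \<partial>N)" for t c
        using that by (simp add: C_def)
      show ?thesis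
        unfolding eq
        by (simp add: int_cos[OF that] del: times_divide_eq_left)
           (intro tendsto_intros *)
    qed
    ultimately show ?thesis by (intro CI) auto
  qed
  have C_sum: "C (\<lambda>x. \<Sum>b\<in>S. f b x)" if "finite S" "\<And>b. b \<in> S \<Longrightarrow> C (f b)" for S :: "'c set" and f
    using that
  proof (induction S)
    case empty
    then show ?case using C_cmult[of _ 0] by (auto simp: C_def intro!: exI[of _ 0])
  qed (auto intro!: C_add)
  \<comment> \<open>With \<open>g\<close> arbitrary, the case of a product of polynomials is the
    composition of the two induction hypotheses.\<close>
  have "C (\<lambda>x. p (\<Sum>b\<in>Basis. sin ((x \<bullet> b) / L) *\<^sub>R b) * g x)" if "C g" for g
    using p that
  proof (induction arbitrary: g)
    case (linear p)
    have "p (\<Sum>b\<in>Basis. sin ((x \<bullet> b) / L) *\<^sub>R b) * g x =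
        (\<Sum>b\<in>Basis. p b * (sin (((1 / L) *\<^sub>R b) \<bullet> x) * g x))" for x
    proof -
      interpret bounded_linear p by fact
      show ?thesis by (simp add: sum scaleR sum_distrib_left sum_distrib_right inner_commute mult_ac)
    qed
    then show ?case using linear by (simp only:) (intro C_sum C_cmult C_sin, auto)
  next
    case (const c)
    then show ?case by (rule C_cmult)
  next
    case (add f h)
    show ?case
      using C_add[OF add.IH(1)[OF add.prems] add.IH(2)[OF add.prems]] by (simp add: distrib_right)
  next
    case (mult f h)
    show ?case
      using mult.IH(1)[OF mult.IH(2)[OF mult.prems]] by (simp add: mult.assoc)
  qed
  moreover have "C (\<lambda>x. 1)" 
  proof (rule CI)
    show "\<bar>1 :: real\<bar> \<le> 1" for x :: 'c by simp
  qed (use trig in auto)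
  ultimately have "C (\<lambda>x. q x * 1)" unfolding q_def by blast
  then have "\<forall>t c. (\<lambda>n. \<integral>\<omega>. (q (X n \<omega>) * 1) * cos (t \<bullet> X n \<omega> + c) \<partial>M) \<longlonglongrightarrow> (\<integral>\<omega>. (q (Y \<omega>) * 1) * cos (t \<bullet> Y \<omega> + c) \<partial>N)"
    unfolding C_def by (elim conjE)
  from this[rule_format, of 0 0] show ?thesis by simp
qed

lemma cos_expectations_imp_weak_convergence:
  fixes X :: "nat \<Rightarrow> 'a \<Rightarrow> 'c::euclidean_space" and Y :: "'b \<Rightarrow> 'c"
  assumes M: "prob_space M" and N: "prob_space N"
    and X[measurable]: "\<And>n. X n \<in> borel_measurable M" and Y[measurable]: "Y \<in> borel_measurable N"
    and trig: "\<And>t c. (\<lambda>n. \<integral>\<omega>. cos (t \<bullet> X n \<omega> + c) \<partial>M) \<longlonglongrightarrow> (\<integral>\<omega>. cos (t \<bullet> Y \<omega> + c) \<partial>N)"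
    and tight: "\<And>e. 0 < e \<Longrightarrow> \<exists>K. \<forall>n. measure M {\<omega>\<in>space M. K < norm (X n \<omega>)} \<le> e"
    and f: "continuous_on UNIV f" "\<And>x. \<bar>f x\<bar> \<le> (B::real)"
  shows "(\<lambda>n. \<integral>\<omega>. f (X n \<omega>) \<partial>M) \<longlonglongrightarrow> (\<integral>\<omega>. f (Y \<omega>) \<partial>N)"
proof (rule LIMSEQ_I)
  fix d :: real assume "0 < d"
  interpret M: prob_space M by fact
  interpret N: prob_space N by fact
  have B: "0 \<le> B" using f(2)[of 0] by linarith
  \<comment> \<open>Either integral changes by at most \<open>e + (2 * B + e) * e\<close>, hence by
    at most \<open>2 * (1 + B) * e\<close>, under approximation. The constant keeps this below
    \<open>d / 4\<close>, one of three such shares of \<open>d\<close>.\<close>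
  define e where "e = min 1 (d / (16 * (1 + B)))"
  have e: "0 < e" "e \<le> 1" "16 * (1 + B) * e \<le> d"
  proof -
    show "0 < e" "e \<le> 1" using \<open>0 < d\<close> B by (auto simp: e_def)
    have "16 * (1 + B) * e \<le> 16 * (1 + B) * (d / (16 * (1 + B)))"
      using B by (intro mult_left_mono) (auto simp: e_def)
    then show "16 * (1 + B) * e \<le> d" using B by simp
  qed
  obtain K1 where K1: "\<And>n. M.prob {\<omega>\<in>space M. K1 < norm (X n \<omega>)} \<le> e"
    using tight[OF e(1)] by blast
  obtain K2 where K2: "N.prob {\<omega>\<in>space N. K2 < norm (Y \<omega>)} \<le> e"
    using tail_probability_small[OF N Y e(1)] by blast
  define L where "L = max 1 (max K1 K2)"
  have L: "1 \<le> L" "K1 \<le> L" "K2 \<le> L" by (auto simp: L_def)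
  define \<phi> where "\<phi> x = (\<Sum>b\<in>Basis. sin ((x \<bullet> b) / L) *\<^sub>R b)" for x :: 'c
  \<comment> \<open>\<open>g\<close> undoes the sines:
    \<open>\<bar>x \<bullet> b\<bar> \<le> L\<close> puts \<open>x \<bullet> b / L\<close> into
    \<open>[-1, 1]\<close>, where \<open>arcsin\<close> inverts \<open>sin\<close> because
    \<open>1 \<le> pi / 2\<close>.\<close>
  define g where "g y = f (\<Sum>b\<in>Basis. (L * arcsin (y \<bullet> b)) *\<^sub>R b)" for y
  have "continuous_on (cbox (- One) One) g"
    unfolding g_def
    by (rule continuous_on_compose2[OF f(1)]) (auto simp: mem_box intro!: continuous_intros)
  then obtain p where p: "real_polynomial_function p" "\<And>y. y \<in> cbox (- One) One \<Longrightarrow> \<bar>g y - p y\<bar> < e"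
    using Stone_Weierstrass_real_polynomial_function[OF compact_cbox _ e(1)] by blast
  have \<phi>: "\<phi> x \<in> cbox (- One) One" for x
    by (auto simp: mem_box \<phi>_def)
  \<comment> \<open>\<open>\<phi>\<close> maps every point into the cube, so the polynomial inherits
    the bound of \<open>f\<close> everywhere, also where it does not approximate
    \<open>f\<close>.\<close>
  have p_bound: "\<bar>p (\<phi> x)\<bar> \<le> B + e" for x
    using p(2)[OF \<phi>[of x]] f(2)[of "\<Sum>b\<in>Basis. (L * arcsin (\<phi> x \<bullet> b)) *\<^sub>R b"] unfolding g_def by linarith
  have g_eq: "g (\<phi> x) = f x" if "norm x \<le> L" for x
  proof -
    have "L * arcsin (\<phi> x \<bullet> b) = x \<bullet> b" if b: "b \<in> Basis" for b
    proof -
      have "\<bar>x \<bullet> b\<bar> \<le> L" using Basis_le_norm[OF b, of x] \<open>norm x \<le> L\<close> by linarith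
      then have "\<bar>x \<bullet> b / L\<bar> \<le> 1" using L by simp
      then have "- 1 \<le> x \<bullet> b / L" "x \<bullet> b / L \<le> 1" by linarith+
      then have "arcsin (sin (x \<bullet> b / L)) = x \<bullet> b / L"
        using pi_ge_two by (intro arcsin_sin) linarith+
      moreover have "L \<noteq> 0" using L by linarith
      ultimately show ?thesis using b by (simp add: \<phi>_def)
    qed
    then have "(\<Sum>b\<in>Basis. (L * arcsin (\<phi> x \<bullet> b)) *\<^sub>R b) = (\<Sum>b\<in>Basis. (x \<bullet> b) *\<^sub>R b)"
      by (intro sum.cong) (simp_all only:)
    then show ?thesis by (simp only: g_def euclidean_representation)
  qed
  have diff: "\<bar>f x - p (\<phi> x)\<bar> \<le> e + (2 * B + e) * indicator {x. L < norm x} x" for x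
  proof (cases "norm x \<le> L")
    case True
    then show ?thesis using p(2)[OF \<phi>[of x]] g_eq[OF True] by simp
  next
    case False
    then show ?thesis using p_bound[of x] f(2)[of x] e(1) by simp
  qed
  have q_meas[measurable]: "(\<lambda>x. p (\<phi> x)) \<in> borel_measurable borel"
  proof (rule borel_measurable_continuous_onI)
    have "continuous_on UNIV p"
      using p(1) by (simp add: continuous_on_polymonial_function real_polynomial_function_eq)
    then show "continuous_on UNIV (\<lambda>x. p (\<phi> x))"
      unfolding \<phi>_def by (rule continuous_on_compose2) (use L in \<open>auto intro!: continuous_intros\<close>)
  qed
  have f_meas[measurable]: "f \<in> borel_measurable borel" 
    using f(1) by (rule borel_measurable_continuous_onI)
  have approx: "\<bar>(\<integral>\<omega>. f (Z \<omega>) \<partial>Q) - (\<integral>\<omega>. p (\<phi> (Z \<omega>)) \<partial>Q)\<bar> \<le> e + (2 * B + e) * e"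
    if Q: "prob_space Q" and Z[measurable]: "Z \<in> borel_measurable Q"
      and tail: "measure Q {\<omega>\<in>space Q. L < norm (Z \<omega>)} \<le> e" for Q :: "'z measure" and Z
  proof -
    interpret Q: prob_space Q by fact
    let ?A = "{\<omega>\<in>space Q. L < norm (Z \<omega>)}"
    have int: "integrable Q (\<lambda>\<omega>. f (Z \<omega>))" "integrable Q (\<lambda>\<omega>. p (\<phi> (Z \<omega>)))"
      by (rule Q.integrable_const_bound[where B=B] Q.integrable_const_bound[where B="B + e"];
          use f(2) p_bound in auto)+
    have "\<bar>(\<integral>\<omega>. f (Z \<omega>) \<partial>Q) - (\<integral>\<omega>. p (\<phi> (Z \<omega>)) \<partial>Q)\<bar> = \<bar>\<integral>\<omega>. f (Z \<omega>) - p (\<phi> (Z \<omega>)) \<partial>Q\<bar>"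
      using int by simp
    also have "\<dots> \<le> (\<integral>\<omega>. \<bar>f (Z \<omega>) - p (\<phi> (Z \<omega>))\<bar> \<partial>Q)"
      by (rule integral_abs_bound)
    also have "\<dots> \<le> (\<integral>\<omega>. e + (2 * B + e) * indicator ?A \<omega> \<partial>Q)"
    proof (rule integral_mono)
      show "integrable Q (\<lambda>\<omega>. \<bar>f (Z \<omega>) - p (\<phi> (Z \<omega>))\<bar>)" using int by simp
      show "integrable Q (\<lambda>\<omega>. e + (2 * B + e) * indicator ?A \<omega>)"
        by (intro Bochner_Integration.integrable_add integrable_mult_right) (auto simp: Q.emeasure_eq_measure)
      show "\<bar>f (Z \<omega>) - p (\<phi> (Z \<omega>))\<bar> \<le> e + (2 * B + e) * indicator ?A \<omega>" if "\<omega> \<in> space Q" for \<omega>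
        using diff[of "Z \<omega>"] that by (simp add: indicator_def)
    qed
    also have "\<dots> = e + (2 * B + e) * Q.prob ?A"
      by (subst Bochner_Integration.integral_add) (auto simp: Q.emeasure_eq_measure Q.prob_space)
    also have "\<dots> \<le> e + (2 * B + e) * e"
      using tail B e by (intro add_left_mono mult_left_mono) auto
    finally show ?thesis .
  qed
  have tail_mono: "measure Q {\<omega>\<in>space Q. L < norm (Z \<omega>)} \<le> e"
    if "prob_space Q" "Z \<in> borel_measurable Q" "measure Q {\<omega>\<in>space Q. K < norm (Z \<omega>)} \<le> e" "K \<le> L"
    for Q :: "'z measure" and Z :: "'z \<Rightarrow> 'c" and K
  proof -
    interpret Q: prob_space Q by fact
    note [measurable] = that(2)
    have "measure Q {\<omega>\<in>space Q. L < norm (Z \<omega>)} \<le> measure Q {\<omega>\<in>space Q. K < norm (Z \<omega>)}"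
      using that(4) by (intro Q.finite_measure_mono) auto
    then show ?thesis using that(3) by simp
  qed
  have small: "e + (2 * B + e) * e \<le> d / 4"
  proof -
    have "(2 * B + e) * e \<le> (2 * B + 1) * e" using e by (intro mult_right_mono) auto
    then have "e + (2 * B + e) * e \<le> 2 * (1 + B) * e" by (simp add: algebra_simps)
    also have "\<dots> \<le> d / 4" using e(3) \<open>0 < d\<close> by (simp add: algebra_simps)
    finally show ?thesis .
  qed
  have "(\<lambda>n. \<integral>\<omega>. p (\<phi> (X n \<omega>)) \<partial>M) \<longlonglongrightarrow> (\<integral>\<omega>. p (\<phi> (Y \<omega>)) \<partial>N)"
    unfolding \<phi>_def by (rule trigonometric_polynomial_expectation_tendsto[OF M N X Y trig p(1)])
  from LIMSEQ_D[OF this, of "d / 4"] obtain n0 where n0: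
    "\<And>n. n \<ge> n0 \<Longrightarrow> \<bar>(\<integral>\<omega>. p (\<phi> (X n \<omega>)) \<partial>M) - (\<integral>\<omega>. p (\<phi> (Y \<omega>)) \<partial>N)\<bar> < d / 4"
    using \<open>0 < d\<close> by auto
  show "\<exists>n0. \<forall>n\<ge>n0. norm ((\<integral>\<omega>. f (X n \<omega>) \<partial>M) - (\<integral>\<omega>. f (Y \<omega>) \<partial>N)) < d"
  proof (intro exI allI impI)
    fix n assume "n0 \<le> n"
    have "\<bar>(\<integral>\<omega>. f (X n \<omega>) \<partial>M) - (\<integral>\<omega>. p (\<phi> (X n \<omega>)) \<partial>M)\<bar> \<le> d / 4"
      using approx[OF M X tail_mono[OF M X K1 L(2)], of n] small by linarith
    moreover have "\<bar>(\<integral>\<omega>. f (Y \<omega>) \<partial>N) - (\<integral>\<omega>. p (\<phi> (Y \<omega>)) \<partial>N)\<bar> \<le> d / 4"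
      using approx[OF N Y tail_mono[OF N Y K2 L(3)]] small by linarith
    ultimately show "norm ((\<integral>\<omega>. f (X n \<omega>) \<partial>M) - (\<integral>\<omega>. f (Y \<omega>) \<partial>N)) < d"
      using n0[OF \<open>n0 \<le> n\<close>] unfolding real_norm_def by linarith
  qed
qed

section \<open>Averages of independent identically distributed samples\<close>

text \<open>Exceptional sets need not be measurable themselves, only contained in small measurable sets.\<close>

definition high_probability :: "'a measure \<Rightarrow> (nat \<Rightarrow> 'a \<Rightarrow> bool) \<Rightarrow> bool" where
  "high_probability M P \<longleftrightarrow>
     (\<forall>e>0. \<forall>\<^sub>F n in sequentially. \<exists>B\<in>sets M. measure M B \<le> e \<and> (\<forall>\<omega>\<in>space M - B. P n \<omega>))"

lemma high_probability_mono:
  assumes "high_probability M P"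
    and "\<forall>\<^sub>F n in sequentially. \<forall>\<omega>\<in>space M. P n \<omega> \<longrightarrow> Q n \<omega>"
  shows "high_probability M Q"
  unfolding high_probability_def
proof (intro allI impI)
  fix e :: real assume "0 < e"
  from assms(1)[unfolded high_probability_def, rule_format, OF this] assms(2)
  show "\<forall>\<^sub>F n in sequentially. \<exists>B\<in>sets M. measure M B \<le> e \<and> (\<forall>\<omega>\<in>space M - B. Q n \<omega>)"
    by eventually_elim blast
qed

lemma high_probability_conj:
  assumes "finite_measure M" "high_probability M P" "high_probability M Q"
  shows "high_probability M (\<lambda>n \<omega>. P n \<omega> \<and> Q n \<omega>)"
  unfolding high_probability_def
proof (intro allI impI)
  interpret finite_measure M by fact
  fix e :: real assume "0 < e"
  then have "0 < e / 2" by simp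
  from assms(2)[unfolded high_probability_def, rule_format, OF this]
       assms(3)[unfolded high_probability_def, rule_format, OF this]
  show "\<forall>\<^sub>F n in sequentially. \<exists>B\<in>sets M. measure M B \<le> e \<and> (\<forall>\<omega>\<in>space M - B. P n \<omega> \<and> Q n \<omega>)"
  proof eventually_elim
    case (elim n)
    then obtain A B where AB: "A \<in> sets M" "B \<in> sets M" "measure M A \<le> e / 2" "measure M B \<le> e / 2"
      "\<forall>\<omega>\<in>space M - A. P n \<omega>" "\<forall>\<omega>\<in>space M - B. Q n \<omega>" by blast
    have "measure M (A \<union> B) \<le> e"
      using measure_Un_le[of A M B] AB by linarith
    then show ?case using AB by (intro bexI[of _ "A \<union> B"]) auto
  qed
qed

lemma high_probability_True:
  assumes "\<And>n \<omega>. \<omega> \<in> space M \<Longrightarrow> P n \<omega>"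
  shows "high_probability M P"
  unfolding high_probability_def using assms by (auto intro!: always_eventually exI bexI[of _ "{}"])

lemma high_probability_finite_Ball:
  assumes "finite_measure M" "finite J" "\<And>j. j \<in> J \<Longrightarrow> high_probability M (P j)"
  shows "high_probability M (\<lambda>n \<omega>. \<forall>j\<in>J. P j n \<omega>)"
  using assms(2,3)
proof (induction J)
  case empty
  show ?case by (rule high_probability_True) simp
next
  case (insert j J)
  have "high_probability M (\<lambda>n \<omega>. P j n \<omega> \<and> (\<forall>j\<in>J. P j n \<omega>))"
    using insert by (intro high_probability_conj assms(1)) auto
  then show ?case by (rule high_probability_mono) auto
qed

text \<open>Half of the allowed probability pays for leaving the event \<open>T\<close>, half for
  exceptions inside it. This reduces claims to bounded values of the normalized sum, where
  compactness is available.\<close>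

lemma high_probability_tight:
  assumes M: "finite_measure M"
    and T: "\<And>K n. {\<omega>\<in>space M. \<not> T K n \<omega>} \<in> sets M"
    and tight: "\<And>e. 0 < e \<Longrightarrow> \<exists>K. \<forall>n. measure M {\<omega>\<in>space M. \<not> T K n \<omega>} \<le> e"
    and P: "\<And>K. high_probability M (\<lambda>n \<omega>. T K n \<omega> \<longrightarrow> P n \<omega>)"
  shows "high_probability M P"
  unfolding high_probability_def
proof (intro allI impI)
  interpret finite_measure M by fact
  fix e :: real assume "0 < e"
  then have e: "0 < e / 2" by simp
  obtain K where K: "\<And>n. measure M {\<omega>\<in>space M. \<not> T K n \<omega>} \<le> e / 2"
    using tight[OF e] by blast
  from P[of K, unfolded high_probability_def, rule_format, OF e]
  show "\<forall>\<^sub>F n in sequentially. \<exists>B\<in>sets M. measure M B \<le> e \<and> (\<forall>\<omega>\<in>space M - B. P n \<omega>)"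
  proof eventually_elim
    case (elim n)
    then obtain A where A: "A \<in> sets M" "measure M A \<le> e / 2"
      "\<forall>\<omega>\<in>space M - A. T K n \<omega> \<longrightarrow> P n \<omega>" by blast
    let ?B = "{\<omega>\<in>space M. \<not> T K n \<omega>}"
    have "measure M (A \<union> ?B) \<le> e"
      using measure_Un_le[OF A(1) T, of K n] A K[of n] by linarith
    then show ?case using A T by (intro bexI[of _ "A \<union> ?B"]) auto
  qed
qed

lemma high_probability_L1:
  fixes Z :: "nat \<Rightarrow> 'a \<Rightarrow> real"
  assumes "finite_measure M" and int: "\<And>n. integrable M (Z n)"
    and nn: "\<And>n \<omega>. 0 \<le> Z n \<omega>"
    and lim: "(\<lambda>n. \<integral>\<omega>. Z n \<omega> \<partial>M) \<longlonglongrightarrow> 0" and e: "0 < e"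
  shows "high_probability M (\<lambda>n \<omega>. Z n \<omega> < e)"
  unfolding high_probability_def
proof (intro allI impI)
  fix d :: real assume "0 < d"
  then have "0 < d * e" using e by simp
  from order_tendstoD(2)[OF lim this]
  show "\<forall>\<^sub>F n in sequentially. \<exists>B\<in>sets M. measure M B \<le> d \<and> (\<forall>\<omega>\<in>space M - B. Z n \<omega> < e)"
  proof eventually_elim
    case (elim n)
    have [measurable]: "Z n \<in> borel_measurable M" using int by auto
    have "measure M {\<omega>\<in>space M. Z n \<omega> \<ge> e} \<le> (\<integral>\<omega>. Z n \<omega> \<partial>M) / e"
      using int nn e by (intro integral_Markov_inequality_measure[where A="space M"]) auto
    also have "\<dots> \<le> d" using elim e by (simp add: field_simps)
    finally show ?case by (intro bexI[of _ "{\<omega>\<in>space M. Z n \<omega> \<ge> e}"]) auto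
  qed
qed

text \<open>The one-dimensional central limit theorem sums over \<open>i < n\<close>, whereas the
  samples are numbered from one and \<open>W 0\<close> stands for the generic vector; the shift
  reconciles the two.\<close>

lemma (in prob_space) indep_vars_Suc:
  assumes "indep_vars (\<lambda>_. S) X (UNIV :: nat set)"
  shows "indep_vars (\<lambda>_. S) (\<lambda>i. X (Suc i)) UNIV"
proof -
  have rv: "random_variable S (X i)" for i
    using assms by (simp add: indep_vars_def2)
  have ind: "indep_sets (\<lambda>i. {X i -` A \<inter> space M |A. A \<in> sets S}) UNIV"
    using assms by (simp add: indep_vars_def2)
  have "indep_sets (\<lambda>i. {X (Suc i) -` A \<inter> space M |A. A \<in> sets S}) UNIV"
  proof (rule indep_setsI)
    show "{X (Suc i) -` A \<inter> space M |A. A \<in> sets S} \<subseteq> events" for i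
      using rv by (auto intro: measurable_sets)
    fix A :: "nat \<Rightarrow> 'a set" and J :: "nat set"
    assume J: "J \<noteq> {}" "finite J" and A: "\<forall>j\<in>J. A j \<in> {X (Suc j) -` A \<inter> space M |A. A \<in> sets S}"
    have "prob (\<Inter>j\<in>Suc ` J. A (j - 1)) = (\<Prod>j\<in>Suc ` J. prob (A (j - 1)))"
      by (rule indep_setsD[OF ind]) (use J A in auto)
    then show "prob (\<Inter>j\<in>J. A j) = (\<Prod>j\<in>J. prob (A j))"
      by (simp add: prod.reindex)
  qed
  then show ?thesis using rv by (simp add: indep_vars_def2)
qed

section \<open>Second moments and laws of large numbers\<close>

locale iid_sequence = prob_space +
  fixes W :: "nat \<Rightarrow> 'a \<Rightarrow> 'c::topological_space"
  assumes indep: "indep_vars (\<lambda>_. borel) W UNIV"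
    and ident: "\<And>i. distr M borel (W i) = distr M borel (W 0)"
begin

lemma W_measurable [measurable]: "W i \<in> borel_measurable M"
  using indep by (auto simp: indep_vars_def2)

lemma integrable_iid_iff:
  fixes g :: "'c \<Rightarrow> 'd::{banach, second_countable_topology}"
  assumes [measurable]: "g \<in> borel_measurable borel"
  shows "integrable M (\<lambda>\<omega>. g (W i \<omega>)) \<longleftrightarrow> integrable M (\<lambda>\<omega>. g (W 0 \<omega>))"
  using integrable_distr_eq[of "W i" M borel g] integrable_distr_eq[of "W 0" M borel g] ident[of i]
  by simp

lemma expectation_iid:
  fixes g :: "'c \<Rightarrow> 'd::{banach, second_countable_topology}"
  assumes [measurable]: "g \<in> borel_measurable borel"
  shows "(\<integral>\<omega>. g (W i \<omega>) \<partial>M) = (\<integral>\<omega>. g (W 0 \<omega>) \<partial>M)"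
  using integral_distr[of "W i" M borel g] integral_distr[of "W 0" M borel g] ident[of i]
  by simp

text \<open>Independence and centring annihilate the products with \<open>i \<noteq> j\<close>, so
  the second moment of the sum grows only linearly.\<close>

lemma
  fixes g :: "'c \<Rightarrow> real"
  assumes g[measurable]: "g \<in> borel_measurable borel"
    and sq: "integrable M (\<lambda>\<omega>. (g (W 0 \<omega>))\<^sup>2)" and mean: "expectation (\<lambda>\<omega>. g (W 0 \<omega>)) = 0"
  shows integrable_square_iid_sum: "integrable M (\<lambda>\<omega>. (\<Sum>i=1..n. g (W i \<omega>))\<^sup>2)"
    and expectation_square_iid_sum:
      "expectation (\<lambda>\<omega>. (\<Sum>i=1..n. g (W i \<omega>))\<^sup>2) = real n * expectation (\<lambda>\<omega>. (g (W 0 \<omega>))\<^sup>2)"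
proof -
  have int: "integrable M (\<lambda>\<omega>. g (W i \<omega>))" for i
    using square_integrable_imp_integrable[OF _ sq] by (subst integrable_iid_iff) auto
  have mean_i: "expectation (\<lambda>\<omega>. g (W i \<omega>)) = 0" for i
    using mean by (subst expectation_iid) auto
  have cross: "integrable M (\<lambda>\<omega>. g (W i \<omega>) * g (W j \<omega>)) \<and>
      expectation (\<lambda>\<omega>. g (W i \<omega>) * g (W j \<omega>)) = (if i = j then expectation (\<lambda>\<omega>. (g (W 0 \<omega>))\<^sup>2) else 0)" for i j
  proof (cases "i = j")
    case True
    have "(\<lambda>x. (g x)\<^sup>2) \<in> borel_measurable borel" by simp
    from integrable_iid_iff[OF this, of i] expectation_iid[OF this, of i] sq
    show ?thesis using True by (simp add: power2_eq_square)
  next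
    case False
    have "indep_vars (\<lambda>_. borel) (\<lambda>i \<omega>. g (W i \<omega>)) {i, j}"
      by (rule indep_vars_compose2[OF indep_vars_subset[OF indep]]) auto
    from indep_vars_lebesgue_integral[OF _ this] indep_vars_integrable[OF _ this]
    show ?thesis using False int mean_i by simp
  qed
  have eq: "(\<Sum>i=1..n. g (W i \<omega>))\<^sup>2 = (\<Sum>i=1..n. \<Sum>j=1..n. g (W i \<omega>) * g (W j \<omega>))" for \<omega>
    by (simp add: power2_eq_square sum_product)
  show "integrable M (\<lambda>\<omega>. (\<Sum>i=1..n. g (W i \<omega>))\<^sup>2)"
    unfolding eq using cross by (intro Bochner_Integration.integrable_sum) auto
  have "expectation (\<lambda>\<omega>. (\<Sum>i=1..n. g (W i \<omega>))\<^sup>2) = 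
      (\<Sum>i=1..n. \<Sum>j=1..n. expectation (\<lambda>\<omega>. g (W i \<omega>) * g (W j \<omega>)))"
    unfolding eq using cross by (simp add: Bochner_Integration.integral_sum Bochner_Integration.integrable_sum)
  also have "\<dots> = real n * expectation (\<lambda>\<omega>. (g (W 0 \<omega>))\<^sup>2)"
    using cross by (simp add: sum.delta)
  finally show "expectation (\<lambda>\<omega>. (\<Sum>i=1..n. g (W i \<omega>))\<^sup>2) = real n * expectation (\<lambda>\<omega>. (g (W 0 \<omega>))\<^sup>2)" .
qed

text \<open>The inequality \<open>\<bar>z\<bar> \<le> e + z\<^sup>2 / e\<close> reduces the mean
  deviation to a variance, and \<open>4 * B\<^sup>2\<close> bounds the square of the centred
  function.\<close>

lemma average_bounded_L1:
  fixes g :: "'c \<Rightarrow> real"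
  assumes g[measurable]: "g \<in> borel_measurable borel" and B: "\<And>x. \<bar>g x\<bar> \<le> B"
    and n: "1 \<le> n" and e: "0 < e"
  shows "expectation (\<lambda>\<omega>. \<bar>(1 / real n) * (\<Sum>i=1..n. g (W i \<omega>)) - expectation (\<lambda>\<omega>. g (W 0 \<omega>))\<bar>)
    \<le> e + 4 * B\<^sup>2 / (real n * e)"
proof -
  define m where "m = expectation (\<lambda>\<omega>. g (W 0 \<omega>))"
  have intg: "integrable M (\<lambda>\<omega>. g (W i \<omega>))" for i
    by (rule integrable_const_bound[where B=B]) (use B in auto)
  have "0 \<le> B" using B[of undefined] by linarith
  have m: "\<bar>m\<bar> \<le> B"
  proof -
    have "\<bar>m\<bar> \<le> expectation (\<lambda>\<omega>. \<bar>g (W 0 \<omega>)\<bar>)" unfolding m_def by (rule integral_abs_bound)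
    also have "\<dots> \<le> expectation (\<lambda>\<omega>. B)" using intg B by (intro integral_mono) auto
    finally show ?thesis by (simp add: prob_space)
  qed
  let ?g = "\<lambda>x. g x - m"
  have sq: "(?g x)\<^sup>2 \<le> 4 * B\<^sup>2" for x
  proof -
    have "\<bar>?g x\<bar> \<le> 2 * B" using B[of x] m by linarith
    then have "\<bar>?g x\<bar>\<^sup>2 \<le> (2 * B)\<^sup>2" by (rule power_mono) simp
    then show ?thesis by (simp add: power_mult_distrib)
  qed
  have sq_int: "integrable M (\<lambda>\<omega>. (?g (W 0 \<omega>))\<^sup>2)"
    by (rule integrable_const_bound[where B="4 * B\<^sup>2"]) (use sq in auto)
  have mean: "expectation (\<lambda>\<omega>. ?g (W 0 \<omega>)) = 0"
    using intg by (simp add: m_def prob_space)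
  define Z where "Z \<omega> = (\<Sum>i=1..n. ?g (W i \<omega>)) / real n" for \<omega>
  have Z_eq: "(1 / real n) * (\<Sum>i=1..n. g (W i \<omega>)) - m = Z \<omega>" for \<omega>
    using n by (simp add: Z_def sum_subtractf field_simps)
  have gm: "?g \<in> borel_measurable borel" by simp
  note sum_sq = integrable_square_iid_sum[OF gm sq_int mean, of n]
    expectation_square_iid_sum[OF gm sq_int mean, of n]
  have Z2: "integrable M (\<lambda>\<omega>. (Z \<omega>)\<^sup>2)" 
    unfolding Z_def power_divide using sum_sq by auto
  have "expectation (\<lambda>\<omega>. (Z \<omega>)\<^sup>2) = expectation (\<lambda>\<omega>. (?g (W 0 \<omega>))\<^sup>2) / real n"
    unfolding Z_def power_divide using sum_sq n by (simp add: power2_eq_square)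
  also have "\<dots> \<le> expectation (\<lambda>\<omega>. 4 * B\<^sup>2) / real n"
    using sq sq_int by (intro divide_right_mono integral_mono) auto
  finally have EZ2: "expectation (\<lambda>\<omega>. (Z \<omega>)\<^sup>2) \<le> 4 * B\<^sup>2 / real n" by (simp add: prob_space)
  have le: "\<bar>z\<bar> \<le> e + z\<^sup>2 / e" for z :: real
  proof (cases "\<bar>z\<bar> \<le> e")
    case False
    then have "e * \<bar>z\<bar> \<le> \<bar>z\<bar> * \<bar>z\<bar>" using e by (intro mult_right_mono) auto
    then have "\<bar>z\<bar> \<le> z\<^sup>2 / e" using e by (simp add: field_simps power2_eq_square)
    then show ?thesis using e by linarith
  next
    case True
    have "0 \<le> z\<^sup>2 / e" using e by simp
    then show ?thesis using True by linarith
  qed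
  have "expectation (\<lambda>\<omega>. \<bar>Z \<omega>\<bar>) \<le> expectation (\<lambda>\<omega>. e + (Z \<omega>)\<^sup>2 / e)"
  proof (rule integral_mono)
    show "integrable M (\<lambda>\<omega>. \<bar>Z \<omega>\<bar>)" using intg by (auto simp: Z_def)
  qed (use Z2 le in auto)
  also have "\<dots> = e + expectation (\<lambda>\<omega>. (Z \<omega>)\<^sup>2) / e"
    using Z2 by (simp add: prob_space)
  also have "\<dots> \<le> e + 4 * B\<^sup>2 / real n / e"
    using EZ2 e by (intro add_left_mono divide_right_mono) auto
  finally show ?thesis unfolding m_def[symmetric] Z_eq by simp
qed

text \<open>Truncation: cutting \<open>g\<close> off at level \<open>k\<close> costs the same small
  amount in mean for every \<open>n\<close>, by identical distribution, and the truncated function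
  falls under the bounded case.\<close>

lemma average_L1:
  fixes g :: "'c \<Rightarrow> real"
  assumes g[measurable]: "g \<in> borel_measurable borel" and int: "integrable M (\<lambda>\<omega>. g (W 0 \<omega>))"
  shows "(\<lambda>n. expectation (\<lambda>\<omega>. \<bar>(1 / real n) * (\<Sum>i=1..n. g (W i \<omega>)) - expectation (\<lambda>\<omega>. g (W 0 \<omega>))\<bar>)) \<longlonglongrightarrow> 0"
proof (rule LIMSEQ_I)
  fix r :: real assume "0 < r"
  define t where "t k x = max (- real k) (min (real k) (g x))" for k :: nat and x
  have [measurable]: "t k \<in> borel_measurable borel" for k unfolding t_def by measurable
  have "(\<lambda>k. expectation (\<lambda>\<omega>. \<bar>g (W 0 \<omega>) - t k (W 0 \<omega>)\<bar>)) \<longlonglongrightarrow> expectation (\<lambda>\<omega>. 0)"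
  proof (rule integral_dominated_convergence)
    show "integrable M (\<lambda>\<omega>. \<bar>g (W 0 \<omega>)\<bar>)" using int by simp
    show "AE \<omega> in M. (\<lambda>k. \<bar>g (W 0 \<omega>) - t k (W 0 \<omega>)\<bar>) \<longlonglongrightarrow> 0"
    proof (rule AE_I2, rule tendsto_eventually)
      fix \<omega>
      obtain k0 :: nat where "\<bar>g (W 0 \<omega>)\<bar> \<le> real k0" using real_arch_simple by blast
      then show "\<forall>\<^sub>F k in sequentially. \<bar>g (W 0 \<omega>) - t k (W 0 \<omega>)\<bar> = 0"
        by (intro eventually_sequentiallyI[of k0]) (auto simp: t_def max_def min_def)
    qed
    show "AE \<omega> in M. norm \<bar>g (W 0 \<omega>) - t k (W 0 \<omega>)\<bar> \<le> \<bar>g (W 0 \<omega>)\<bar>" for k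
      by (rule AE_I2) (auto simp: t_def max_def min_def)
  qed auto
  then have "\<forall>\<^sub>F k in sequentially. expectation (\<lambda>\<omega>. \<bar>g (W 0 \<omega>) - t k (W 0 \<omega>)\<bar>) < r / 5"
    using \<open>0 < r\<close> by (intro order_tendstoD(2)) auto
  then obtain k where k: "expectation (\<lambda>\<omega>. \<bar>g (W 0 \<omega>) - t k (W 0 \<omega>)\<bar>) < r / 5"
    by (auto simp: eventually_sequentially)
  have tb: "\<bar>t k x\<bar> \<le> real k" for x by (auto simp: t_def)
  have int_t: "integrable M (\<lambda>\<omega>. t k (W i \<omega>))" for i
    by (rule integrable_const_bound[where B="real k"]) (use tb in auto)
  have int_g: "integrable M (\<lambda>\<omega>. g (W i \<omega>))" for i
    using int by (subst integrable_iid_iff) auto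
  \<comment> \<open>From \<open>N\<close> on, the variance term is at most \<open>r / 5\<close>.
    Together with two truncation errors below \<open>r / 5\<close> and the free parameter
    \<open>r / 5\<close> this stays below \<open>r\<close>.\<close>
  define N where "N = nat \<lceil>4 * (real k)\<^sup>2 / (r / 5)\<^sup>2\<rceil> + 1"
  show "\<exists>n0. \<forall>n\<ge>n0. norm (expectation (\<lambda>\<omega>. \<bar>(1 / real n) * (\<Sum>i=1..n. g (W i \<omega>)) - expectation (\<lambda>\<omega>. g (W 0 \<omega>))\<bar>) - 0) < r"
  proof (intro exI allI impI)
    fix n assume "N \<le> n"
    then have n: "1 \<le> n" by (simp add: N_def)
    have "4 * (real k)\<^sup>2 / (r / 5)\<^sup>2 \<le> real n"
      using \<open>N \<le> n\<close> unfolding N_def by linarith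
    then have n_large: "4 * (real k)\<^sup>2 / (real n * (r / 5)) \<le> r / 5"
      using n \<open>0 < r\<close> by (simp add: field_simps power2_eq_square)
    let ?A = "\<lambda>g \<omega>. (1 / real n) * (\<Sum>i=1..n. g (W i \<omega>))"
    let ?d = "\<lambda>x. \<bar>g x - t k x\<bar>"
    have E_d: "expectation (?A ?d) = expectation (\<lambda>\<omega>. ?d (W 0 \<omega>))"
    proof -
      have "expectation (\<lambda>\<omega>. ?d (W i \<omega>)) = expectation (\<lambda>\<omega>. ?d (W 0 \<omega>))" for i
        by (rule expectation_iid) auto
      then have "(\<Sum>i=1..n. expectation (\<lambda>\<omega>. ?d (W i \<omega>))) = (\<Sum>i=1..n. expectation (\<lambda>\<omega>. ?d (W 0 \<omega>)))"
        by (intro sum.cong refl)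
      moreover have "expectation (?A ?d) = (1 / real n) * (\<Sum>i=1..n. expectation (\<lambda>\<omega>. ?d (W i \<omega>)))"
        using int_g int_t by (subst integral_mult_right_zero, subst Bochner_Integration.integral_sum) auto
      ultimately show ?thesis using n by simp
    qed
    have pw: "\<bar>?A g \<omega> - expectation (\<lambda>\<omega>. g (W 0 \<omega>))\<bar> \<le> ?A ?d \<omega> +
        \<bar>?A (t k) \<omega> - expectation (\<lambda>\<omega>. t k (W 0 \<omega>))\<bar> + expectation (\<lambda>\<omega>. ?d (W 0 \<omega>))" for \<omega>
    proof -
      have "\<bar>?A g \<omega> - ?A (t k) \<omega>\<bar> = \<bar>?A (\<lambda>x. g x - t k x) \<omega>\<bar>"
        by (simp add: sum_subtractf diff_divide_distrib)
      also have "\<dots> \<le> ?A ?d \<omega>"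
        by (simp add: abs_mult divide_right_mono sum_abs)
      finally have 1: "\<bar>?A g \<omega> - ?A (t k) \<omega>\<bar> \<le> ?A ?d \<omega>" .
      have "\<bar>expectation (\<lambda>\<omega>. g (W 0 \<omega>)) - expectation (\<lambda>\<omega>. t k (W 0 \<omega>))\<bar> = 
          \<bar>expectation (\<lambda>\<omega>. g (W 0 \<omega>) - t k (W 0 \<omega>))\<bar>"
        using int_g int_t by simp
      also have "\<dots> \<le> expectation (\<lambda>\<omega>. ?d (W 0 \<omega>))" by (rule integral_abs_bound)
      finally show ?thesis using 1 by linarith
    qed
    have "expectation (\<lambda>\<omega>. \<bar>?A g \<omega> - expectation (\<lambda>\<omega>. g (W 0 \<omega>))\<bar>) \<le>
        expectation (\<lambda>\<omega>. ?A ?d \<omega> + \<bar>?A (t k) \<omega> - expectation (\<lambda>\<omega>. t k (W 0 \<omega>))\<bar> + expectation (\<lambda>\<omega>. ?d (W 0 \<omega>)))"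
      using pw int_g int_t by (intro integral_mono) auto
    also have "\<dots> = expectation (?A ?d) + expectation (\<lambda>\<omega>. \<bar>?A (t k) \<omega> - expectation (\<lambda>\<omega>. t k (W 0 \<omega>))\<bar>) + expectation (\<lambda>\<omega>. ?d (W 0 \<omega>))"
      using int_g int_t by (subst Bochner_Integration.integral_add Bochner_Integration.integral_add, auto simp: prob_space)+
    also have "\<dots> \<le> expectation (\<lambda>\<omega>. ?d (W 0 \<omega>)) + (r / 5 + 4 * (real k)\<^sup>2 / (real n * (r / 5))) + expectation (\<lambda>\<omega>. ?d (W 0 \<omega>))"
      unfolding E_d using \<open>0 < r\<close> n tb by (intro add_mono average_bounded_L1) auto
    also have "\<dots> < r" using k n_large \<open>0 < r\<close> by linarith
    finally show "norm (expectation (\<lambda>\<omega>. \<bar>?A g \<omega> - expectation (\<lambda>\<omega>. g (W 0 \<omega>))\<bar>) - 0) < r"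
      by (simp add: integral_nonneg)
  qed
qed

lemma high_probability_average:
  fixes g :: "'c \<Rightarrow> real"
  assumes g[measurable]: "g \<in> borel_measurable borel" and int: "integrable M (\<lambda>\<omega>. g (W 0 \<omega>))"
    and e: "0 < e"
  shows "high_probability M (\<lambda>n \<omega>. \<bar>(1 / real n) * (\<Sum>i=1..n. g (W i \<omega>)) - expectation (\<lambda>\<omega>. g (W 0 \<omega>))\<bar> < e)"
proof (rule high_probability_L1[OF _ _ _ average_L1[OF g int] e])
  show "finite_measure M" by (rule finite_measure_axioms)
  have "integrable M (\<lambda>\<omega>. g (W i \<omega>))" for i
    using int by (subst integrable_iid_iff) auto
  then show "integrable M (\<lambda>\<omega>. \<bar>(1 / real n) * (\<Sum>i=1..n. g (W i \<omega>)) - expectation (\<lambda>\<omega>. g (W 0 \<omega>))\<bar>)" for n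
    by auto
qed auto

text \<open>Difference quotients depend on \<open>n\<close>, so a law of large numbers for a fixed
  function must be combined with dominated convergence: the mean of
  \<open>\<bar>g n - g'\<bar>\<close> tends to zero and bounds the mean error of the
  averages.\<close>

lemma high_probability_average_sequence:
  fixes g :: "nat \<Rightarrow> 'c \<Rightarrow> real"
  assumes gn[measurable]: "\<And>n. g n \<in> borel_measurable borel"
    and G[measurable]: "G \<in> borel_measurable borel" and int: "integrable M (\<lambda>\<omega>. G (W 0 \<omega>))"
    and bound: "\<And>n x. \<bar>g n x\<bar> \<le> G x"
    and lim: "\<And>x. (\<lambda>n. g n x) \<longlonglongrightarrow> g' x"
    and e: "0 < e"
  shows "high_probability M (\<lambda>n \<omega>. \<bar>(1 / real n) * (\<Sum>i=1..n. g n (W i \<omega>)) - expectation (\<lambda>\<omega>. g' (W 0 \<omega>))\<bar> < e)"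
proof -
  have [measurable]: "g' \<in> borel_measurable borel"
    by (rule borel_measurable_LIMSEQ_real[OF lim gn])
  have bound': "\<bar>g' x\<bar> \<le> G x" for x
    by (rule Lim_bounded[OF tendsto_rabs[OF lim]]) (use bound in auto)
  have intg': "integrable M (\<lambda>\<omega>. g' (W i \<omega>))" "integrable M (\<lambda>\<omega>. g n (W i \<omega>))" for i n
  proof -
    have "integrable M (\<lambda>\<omega>. G (W i \<omega>))" using int by (subst integrable_iid_iff) auto
    then show "integrable M (\<lambda>\<omega>. g' (W i \<omega>))" "integrable M (\<lambda>\<omega>. g n (W i \<omega>))"
      by (rule Bochner_Integration.integrable_bound,
          use bound bound' in \<open>auto intro!: AE_I2 order_trans[OF _ abs_ge_self]\<close>)+
  qed
  define d where "d n x = \<bar>g n x - g' x\<bar>" for n x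
  have [measurable]: "d n \<in> borel_measurable borel" for n unfolding d_def by measurable
  have "(\<lambda>n. expectation (\<lambda>\<omega>. d n (W 0 \<omega>))) \<longlonglongrightarrow> expectation (\<lambda>\<omega>. 0)"
  proof (rule integral_dominated_convergence)
    show "integrable M (\<lambda>\<omega>. 2 * G (W 0 \<omega>))" using int by simp
    show "AE \<omega> in M. (\<lambda>n. d n (W 0 \<omega>)) \<longlonglongrightarrow> 0"
    proof (rule AE_I2)
      fix \<omega>
      have "(\<lambda>n. \<bar>g n (W 0 \<omega>) - g' (W 0 \<omega>)\<bar>) \<longlonglongrightarrow> \<bar>g' (W 0 \<omega>) - g' (W 0 \<omega>)\<bar>"
        by (intro tendsto_intros lim)
      then show "(\<lambda>n. d n (W 0 \<omega>)) \<longlonglongrightarrow> 0" by (simp add: d_def)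
    qed
    show "AE \<omega> in M. norm (d n (W 0 \<omega>)) \<le> 2 * G (W 0 \<omega>)" for n
    proof (rule AE_I2)
      fix \<omega> show "norm (d n (W 0 \<omega>)) \<le> 2 * G (W 0 \<omega>)"
        using bound[of n "W 0 \<omega>"] bound'[of "W 0 \<omega>"] by (simp add: d_def)
    qed
  qed auto
  moreover have "expectation (\<lambda>\<omega>. d m (W i \<omega>)) = expectation (\<lambda>\<omega>. d m (W 0 \<omega>))" for i m
    by (rule expectation_iid) auto
  then have "(\<Sum>i=1..n. expectation (\<lambda>\<omega>. d m (W i \<omega>))) = (\<Sum>i=1..n. expectation (\<lambda>\<omega>. d m (W 0 \<omega>)))" for n m
    by (intro sum.cong refl)
  \<comment> \<open>The convention \<open>1 / 0 = 0\<close> makes the average vanish for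
    \<open>n = 0\<close>.\<close>
  then have "expectation (\<lambda>\<omega>. (1 / real n) * (\<Sum>i=1..n. d n (W i \<omega>))) = (if n = 0 then 0 else expectation (\<lambda>\<omega>. d n (W 0 \<omega>)))" for n
    using intg' by (subst integral_mult_right_zero, subst Bochner_Integration.integral_sum) (auto simp: d_def)
  ultimately have lim0: "(\<lambda>n. expectation (\<lambda>\<omega>. (1 / real n) * (\<Sum>i=1..n. d n (W i \<omega>)))) \<longlonglongrightarrow> 0"
    by (auto elim!: Lim_transform_eventually intro!: eventually_sequentiallyI[of 1])
  have "high_probability M (\<lambda>n \<omega>. (1 / real n) * (\<Sum>i=1..n. d n (W i \<omega>)) < e / 2)"
  proof (rule high_probability_L1[OF _ _ _ lim0])
    show "finite_measure M" by (rule finite_measure_axioms)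
    show "integrable M (\<lambda>\<omega>. 1 / real n * (\<Sum>i = 1..n. d n (W i \<omega>)))" for n
      using intg' by (auto simp: d_def)
    show "0 \<le> 1 / real n * (\<Sum>i = 1..n. d n (W i \<omega>))" for n \<omega>
      by (auto simp: d_def intro!: sum_nonneg divide_nonneg_nonneg)
  qed (use e in auto)
  moreover have "high_probability M (\<lambda>n \<omega>. \<bar>(1 / real n) * (\<Sum>i=1..n. g' (W i \<omega>)) - expectation (\<lambda>\<omega>. g' (W 0 \<omega>))\<bar> < e / 2)"
    using intg' e by (intro high_probability_average) auto
  ultimately have "high_probability M (\<lambda>n \<omega>. (1 / real n) * (\<Sum>i=1..n. d n (W i \<omega>)) < e / 2 \<and>
      \<bar>(1 / real n) * (\<Sum>i=1..n. g' (W i \<omega>)) - expectation (\<lambda>\<omega>. g' (W 0 \<omega>))\<bar> < e / 2)"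
    by (intro high_probability_conj finite_measure_axioms)
  then show ?thesis
  proof (rule high_probability_mono, intro always_eventually allI ballI impI)
    fix n \<omega>
    assume *: "(1 / real n) * (\<Sum>i=1..n. d n (W i \<omega>)) < e / 2 \<and>
      \<bar>(1 / real n) * (\<Sum>i=1..n. g' (W i \<omega>)) - expectation (\<lambda>\<omega>. g' (W 0 \<omega>))\<bar> < e / 2"
    have "\<bar>(1 / real n) * (\<Sum>i=1..n. g n (W i \<omega>)) - (1 / real n) * (\<Sum>i=1..n. g' (W i \<omega>))\<bar>
        = (1 / real n) * \<bar>\<Sum>i=1..n. g n (W i \<omega>) - g' (W i \<omega>)\<bar>"
      by (simp add: sum_subtractf abs_mult flip: right_diff_distrib diff_divide_distrib)
    also have "\<dots> \<le> (1 / real n) * (\<Sum>i=1..n. d n (W i \<omega>))"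
      unfolding d_def by (intro mult_left_mono sum_abs) auto
    finally show "\<bar>(1 / real n) * (\<Sum>i=1..n. g n (W i \<omega>)) - expectation (\<lambda>\<omega>. g' (W 0 \<omega>))\<bar> < e"
      using * by linarith
  qed
qed

end

section \<open>Central limit theorems\<close>

lemma integral_normal_law_scale:
  assumes \<sigma>: "0 < \<sigma>" and f[measurable]: "f \<in> borel_measurable borel"
  shows "(\<integral>x. f (\<sigma> * x) \<partial>std_normal_distribution) = (\<integral>x. f x \<partial>normal_law 0 (\<sigma>\<^sup>2) :: real)"
proof -
  have d: "distributed std_normal_distribution lborel (\<lambda>x. x) std_normal_density"
    by (auto simp: distributed_def distr_id2)
  interpret prob_space std_normal_distribution by (rule prob_space_normal_density) simp
  have "distributed std_normal_distribution lborel (\<lambda>x. 0 + \<sigma> * x) (normal_density (0 + \<sigma> * 0) (\<bar>\<sigma>\<bar> * 1))"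
    by (rule normal_density_affine[OF d]) (use \<sigma> in auto)
  then have "distr std_normal_distribution lborel (\<lambda>x. \<sigma> * x) = density lborel (normal_density 0 \<sigma>)"
    using \<sigma> by (simp add: distributed_def)
  then have *: "distr std_normal_distribution lborel (\<lambda>x. \<sigma> * x) = normal_law 0 (\<sigma>\<^sup>2)"
    using \<sigma> by (simp add: normal_law_def)
  show ?thesis unfolding *[symmetric] by (subst integral_distr) auto
qed

context iid_sequence
begin

text \<open>Directions of zero variance must be included, as the covariance matrix may be singular;
  there the sums vanish almost surely and \<open>normal_law\<close> is a point mass. Otherwise
  \<open>cos (\<sigma> * x + c)\<close> undoes the standardization of the sums.\<close>

lemma central_limit_cos:
  fixes g :: "'c \<Rightarrow> real"
  assumes g[measurable]: "g \<in> borel_measurable borel"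
    and sq: "integrable M (\<lambda>\<omega>. (g (W 0 \<omega>))\<^sup>2)" and mean: "expectation (\<lambda>\<omega>. g (W 0 \<omega>)) = 0"
  shows "(\<lambda>n. expectation (\<lambda>\<omega>. cos ((\<Sum>i=1..n. g (W i \<omega>)) / sqrt (real n) + c))) \<longlonglongrightarrow>
    (\<integral>x. cos (x + c) \<partial>normal_law 0 (expectation (\<lambda>\<omega>. (g (W 0 \<omega>))\<^sup>2)))"
proof -
  define v where "v = expectation (\<lambda>\<omega>. (g (W 0 \<omega>))\<^sup>2)"
  have "0 \<le> v" unfolding v_def by simp
  have int: "integrable M (\<lambda>\<omega>. g (W i \<omega>))" for i
    using square_integrable_imp_integrable[OF _ sq] by (subst integrable_iid_iff) auto
  have mean_i: "expectation (\<lambda>\<omega>. g (W i \<omega>)) = 0" for i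
    using mean by (subst expectation_iid) auto
  have g2: "(\<lambda>x. (g x)\<^sup>2) \<in> borel_measurable borel" by simp
  have sq_i: "integrable M (\<lambda>\<omega>. (g (W i \<omega>))\<^sup>2)" "expectation (\<lambda>\<omega>. (g (W i \<omega>))\<^sup>2) = v" for i
    using integrable_iid_iff[OF g2, of i] expectation_iid[OF g2, of i] sq by (simp_all add: v_def)
  show ?thesis
  proof (cases "v = 0")
    case True
    have "AE \<omega> in M. (g (W i \<omega>))\<^sup>2 = 0" for i
      using sq_i[of i] True by (subst integral_nonneg_eq_0_iff_AE[symmetric]) auto
    then have "AE \<omega> in M. \<forall>i. g (W i \<omega>) = 0"
      by (simp add: AE_all_countable)
    then have "expectation (\<lambda>\<omega>. cos ((\<Sum>i=1..n. g (W i \<omega>)) / sqrt (real n) + c)) = expectation (\<lambda>\<omega>. cos c)" for n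
      by (intro integral_cong_AE) (auto elim!: eventually_mono)
    moreover have "(\<integral>x. cos (x + c) \<partial>normal_law 0 0) = cos c"
      by (simp add: normal_law_def integral_return)
    ultimately show ?thesis unfolding v_def[symmetric] True by (simp add: prob_space)
  next
    case False
    then have v: "0 < v" using \<open>0 \<le> v\<close> by simp
    define \<sigma> where "\<sigma> = sqrt v"
    have \<sigma>: "0 < \<sigma>" "\<sigma>\<^sup>2 = v" using v by (auto simp: \<sigma>_def)
    let ?X = "\<lambda>i \<omega>. g (W (Suc i) \<omega>)"
    let ?D = "\<lambda>n. distr M borel (\<lambda>\<omega>. (\<Sum>i<n. ?X i \<omega>) / sqrt (real n * \<sigma>\<^sup>2))"
    have clt: "weak_conv_m ?D std_normal_distribution"
    proof (rule central_limit_theorem_zero_mean)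
      show "indep_vars (\<lambda>_. borel) ?X UNIV"
        by (rule indep_vars_compose2[OF indep_vars_Suc[OF indep]]) auto
      show "distr M borel (?X n) = distr (distr M borel (W 0)) borel g" for n
        by (subst ident[of "Suc n", symmetric], subst distr_distr) (auto simp: comp_def)
      show "variance (?X n) = \<sigma>\<^sup>2" for n
        using sq_i(2) by (simp add: mean_i \<sigma>)
    qed (use \<sigma> mean_i sq_i in auto)
    have "(\<lambda>n. integral\<^sup>L (?D n) (\<lambda>x. cos (\<sigma> * x + c))) \<longlonglongrightarrow> (\<integral>x. cos (\<sigma> * x + c) \<partial>std_normal_distribution)"
    proof (rule weak_conv_imp_integral_bdd_continuous_conv[OF _ _ clt, where B=1])
      show "real_distribution (?D n)" for n
        by (rule real_distribution_distr) measurable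
      show "real_distribution std_normal_distribution" by (rule real_dist_normal_dist)
    qed (auto intro!: continuous_intros)
    moreover have "integral\<^sup>L (?D n) (\<lambda>x. cos (\<sigma> * x + c)) = expectation (\<lambda>\<omega>. cos ((\<Sum>i=1..n. g (W i \<omega>)) / sqrt (real n) + c))" for n
    proof -
      have "(\<Sum>i<n. ?X i \<omega>) = (\<Sum>i=1..n. g (W i \<omega>))" for \<omega>
        by (simp add: sum.atLeast1_atMost_eq)
      moreover have "\<sigma> * (S / sqrt (real n * \<sigma>\<^sup>2)) = S / sqrt (real n)" for S
        using \<sigma>(1) by (simp add: real_sqrt_mult)
      ultimately show ?thesis by (subst integral_distr) auto
    qed
    moreover have "(\<integral>x. cos (\<sigma> * x + c) \<partial>std_normal_distribution) = (\<integral>x. cos (x + c) \<partial>normal_law 0 v)"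
      using integral_normal_law_scale[OF \<sigma>(1), of "\<lambda>x. cos (x + c)"] by (simp add: \<sigma>(2))
    ultimately show ?thesis unfolding v_def[symmetric] by simp
  qed
qed

text \<open>The normalization keeps the second moment of the sum below \<open>V\<close> for all
  \<open>n\<close>, so Markov's inequality gives one \<open>K\<close> for all of them.\<close>

lemma normalized_sum_tight:
  fixes h :: "'c \<Rightarrow> 'd::euclidean_space"
  assumes h[measurable]: "h \<in> borel_measurable borel"
    and sq: "integrable M (\<lambda>\<omega>. (norm (h (W 0 \<omega>)))\<^sup>2)" and mean: "expectation (\<lambda>\<omega>. h (W 0 \<omega>)) = 0"
    and e: "0 < e"
  shows "\<exists>K. \<forall>n. prob {\<omega>\<in>space M. K < norm ((1 / sqrt (real n)) *\<^sub>R (\<Sum>i=1..n. h (W i \<omega>)))} \<le> e"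
proof -
  let ?H = "\<lambda>n \<omega>. (1 / sqrt (real n)) *\<^sub>R (\<Sum>i=1..n. h (W i \<omega>))"
  define V where "V = (\<Sum>b\<in>(Basis::'d set). expectation (\<lambda>\<omega>. (h (W 0 \<omega>) \<bullet> b)\<^sup>2))"
  have "0 \<le> V" unfolding V_def by (intro sum_nonneg) auto
  have int: "integrable M (\<lambda>\<omega>. h (W 0 \<omega>))"
  proof -
    have "integrable M (\<lambda>\<omega>. norm (h (W 0 \<omega>)))"
      by (rule square_integrable_imp_integrable[OF _ sq]) measurable
    then show ?thesis by (rule integrable_norm_cancel) measurable
  qed
  have comp: "integrable M (\<lambda>\<omega>. (h (W 0 \<omega>) \<bullet> b)\<^sup>2)" "expectation (\<lambda>\<omega>. h (W 0 \<omega>) \<bullet> b) = 0" if "b \<in> Basis" for b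
  proof -
    have "(h (W 0 \<omega>) \<bullet> b)\<^sup>2 \<le> (norm (h (W 0 \<omega>)))\<^sup>2" for \<omega>
      using Basis_le_norm[OF that, of "h (W 0 \<omega>)"] by (intro abs_le_square_iff[THEN iffD1]) simp
    then have "norm ((h (W 0 \<omega>) \<bullet> b)\<^sup>2) \<le> norm ((norm (h (W 0 \<omega>)))\<^sup>2)" for \<omega>
      by (simp only: real_norm_def abs_power2)
    then show "integrable M (\<lambda>\<omega>. (h (W 0 \<omega>) \<bullet> b)\<^sup>2)"
      by (intro Bochner_Integration.integrable_bound[OF sq] AE_I2) measurable
    show "expectation (\<lambda>\<omega>. h (W 0 \<omega>) \<bullet> b) = 0"
      using integral_inner_left[OF int, of b] mean by simp
  qed
  have E: "integrable M (\<lambda>\<omega>. (norm (?H n \<omega>))\<^sup>2) \<and> expectation (\<lambda>\<omega>. (norm (?H n \<omega>))\<^sup>2) \<le> V" for n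
  proof -
    have eq: "(norm (?H n \<omega>))\<^sup>2 = (1 / real n) * (\<Sum>b\<in>Basis. (\<Sum>i=1..n. h (W i \<omega>) \<bullet> b)\<^sup>2)" for \<omega>
    proof -
      have "(norm S)\<^sup>2 = (\<Sum>b\<in>Basis. (S \<bullet> b)\<^sup>2)" for S :: 'd
        by (subst power2_norm_eq_inner, subst euclidean_inner) (simp add: power2_eq_square)
      from this[of "\<Sum>i=1..n. h (W i \<omega>)"] show ?thesis
        by (simp only: norm_scaleR power_mult_distrib inner_sum_left) (simp add: power_divide)
    qed
    have hb: "(\<lambda>x. h x \<bullet> b) \<in> borel_measurable borel" for b by simp
    have sums: "integrable M (\<lambda>\<omega>. (\<Sum>i=1..n. h (W i \<omega>) \<bullet> b)\<^sup>2)"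
      "expectation (\<lambda>\<omega>. (\<Sum>i=1..n. h (W i \<omega>) \<bullet> b)\<^sup>2) = real n * expectation (\<lambda>\<omega>. (h (W 0 \<omega>) \<bullet> b)\<^sup>2)"
      if "b \<in> Basis" for b
      by (rule integrable_square_iid_sum[OF hb comp[OF that]] expectation_square_iid_sum[OF hb comp[OF that]])+
    have int_eq: "integrable M (\<lambda>\<omega>. (norm (?H n \<omega>))\<^sup>2)"
      unfolding eq by (intro integrable_mult_right Bochner_Integration.integrable_sum sums(1))
    have "expectation (\<lambda>\<omega>. (norm (?H n \<omega>))\<^sup>2) =
        (1 / real n) * expectation (\<lambda>\<omega>. \<Sum>b\<in>Basis. (\<Sum>i=1..n. h (W i \<omega>) \<bullet> b)\<^sup>2)"
      unfolding eq by (rule integral_mult_right_zero)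
    also have "\<dots> = (1 / real n) * (\<Sum>b\<in>Basis. real n * expectation (\<lambda>\<omega>. (h (W 0 \<omega>) \<bullet> b)\<^sup>2))"
      using sums by (subst Bochner_Integration.integral_sum) (simp_all cong: sum.cong)
    also have "\<dots> = (1 / real n) * (real n * V)"
      unfolding V_def by (simp only: sum_distrib_left)
    \<comment> \<open>An inequality, since the left side is \<open>0\<close> for
      \<open>n = 0\<close>.\<close>
    also have "\<dots> \<le> V" using \<open>0 \<le> V\<close> by simp
    finally show ?thesis using int_eq by blast
  qed
  \<comment> \<open>The summand \<open>1\<close> keeps \<open>K\<close> positive when
    \<open>V = 0\<close>.\<close>
  define K where "K = sqrt ((V + 1) / e)"
  have K: "0 < K" "K\<^sup>2 = (V + 1) / e" using e \<open>0 \<le> V\<close> by (auto simp: K_def)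
  have "prob {\<omega>\<in>space M. K < norm (?H n \<omega>)} \<le> e" for n
  proof -
    have "prob {\<omega>\<in>space M. K < norm (?H n \<omega>)} \<le> prob {\<omega>\<in>space M. K\<^sup>2 \<le> (norm (?H n \<omega>))\<^sup>2}"
    proof (rule finite_measure_mono)
      show "{\<omega>\<in>space M. K < norm (?H n \<omega>)} \<subseteq> {\<omega>\<in>space M. K\<^sup>2 \<le> (norm (?H n \<omega>))\<^sup>2}"
        using K(1) by (intro Collect_mono conj_mono impI power_mono) (simp_all only: less_imp_le)
    qed measurable
    also have "\<dots> \<le> expectation (\<lambda>\<omega>. (norm (?H n \<omega>))\<^sup>2) / K\<^sup>2"
      by (rule integral_Markov_inequality_measure[where A="space M"]) (use E[of n] K(1) in \<open>simp_all only: zero_le_power2 AE_I2 sets.top zero_less_power\<close>)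
    also have "\<dots> \<le> V / K\<^sup>2" using E[of n] by (intro divide_right_mono) (simp_all only: zero_le_power2)
    also have "\<dots> \<le> e" using e \<open>0 \<le> V\<close> unfolding K(2) by (simp add: field_simps)
    finally show ?thesis .
  qed
  then show ?thesis by blast
qed

text \<open>Cramer-Wold: joint normality is given through linear functionals, and the quadratic form
  of the covariance matrix at \<open>t\<close> is the variance of
  \<open>t \<bullet> h (W 0 \<omega>)\<close>, so each direction is a one-dimensional limit.\<close>

lemma multivariate_central_limit_theorem:
  fixes h :: "'c \<Rightarrow> real ^ 'r" and H :: "'b \<Rightarrow> real ^ 'r"
  assumes h[measurable]: "h \<in> borel_measurable borel"
    and sq: "integrable M (\<lambda>\<omega>. (norm (h (W 0 \<omega>)))\<^sup>2)" and mean: "expectation (\<lambda>\<omega>. h (W 0 \<omega>)) = 0"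
    and H: "normal_vector N H 0 (\<chi> i j. \<integral>\<omega>. h (W 0 \<omega>) $ i * h (W 0 \<omega>) $ j \<partial>M)"
    and f: "continuous_on UNIV f" "\<And>x. \<bar>f x\<bar> \<le> (B::real)"
  shows "(\<lambda>n. expectation (\<lambda>\<omega>. f ((1 / sqrt (real n)) *\<^sub>R (\<Sum>i=1..n. h (W i \<omega>))))) \<longlonglongrightarrow> (\<integral>\<omega>. f (H \<omega>) \<partial>N)"
proof (rule cos_expectations_imp_weak_convergence[OF _ _ _ _ _ _ f])
  let ?H = "\<lambda>n \<omega>. (1 / sqrt (real n)) *\<^sub>R (\<Sum>i=1..n. h (W i \<omega>))"
  let ?\<Sigma> = "\<chi> i j. \<integral>\<omega>. h (W 0 \<omega>) $ i * h (W 0 \<omega>) $ j \<partial>M"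
  show "prob_space M" by (rule prob_space_axioms)
  show "prob_space N" and H_meas[measurable]: "H \<in> borel_measurable N"
    using H by (auto simp: normal_vector_def)
  show "?H n \<in> borel_measurable M" for n by measurable
  show "\<exists>K. \<forall>n. prob {\<omega> \<in> space M. K < norm (?H n \<omega>)} \<le> e" if "0 < e" for e
    by (rule normalized_sum_tight[OF h sq mean that])
  fix t :: "real ^ 'r" and c :: real
  have int: "integrable M (\<lambda>\<omega>. h (W 0 \<omega>))"
  proof -
    have "integrable M (\<lambda>\<omega>. norm (h (W 0 \<omega>)))"
      by (rule square_integrable_imp_integrable[OF _ sq]) measurable
    then show ?thesis by (rule integrable_norm_cancel) measurable
  qed
  have sq_t: "integrable M (\<lambda>\<omega>. (t \<bullet> h (W 0 \<omega>))\<^sup>2)"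
  proof (rule Bochner_Integration.integrable_bound)
    show "integrable M (\<lambda>\<omega>. (norm t)\<^sup>2 * (norm (h (W 0 \<omega>)))\<^sup>2)" using sq by simp
    have "(t \<bullet> h (W 0 \<omega>))\<^sup>2 \<le> (norm t * norm (h (W 0 \<omega>)))\<^sup>2" for \<omega>
      using Cauchy_Schwarz_ineq2[of t "h (W 0 \<omega>)"] by (intro abs_le_square_iff[THEN iffD1]) (simp add: abs_mult)
    then show "AE \<omega> in M. norm ((t \<bullet> h (W 0 \<omega>))\<^sup>2) \<le> norm ((norm t)\<^sup>2 * (norm (h (W 0 \<omega>)))\<^sup>2)"
      by (simp add: power_mult_distrib)
  qed measurable
  have mean_t: "expectation (\<lambda>\<omega>. t \<bullet> h (W 0 \<omega>)) = 0"
    using integral_inner_right[OF int, of t] mean by simp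
  have prod_int: "integrable M (\<lambda>\<omega>. h (W 0 \<omega>) $ i * h (W 0 \<omega>) $ j)" for i j
  proof (rule Bochner_Integration.integrable_bound[OF sq])
    show "AE \<omega> in M. norm (h (W 0 \<omega>) $ i * h (W 0 \<omega>) $ j) \<le> norm ((norm (h (W 0 \<omega>)))\<^sup>2)"
      by (auto simp: abs_mult power2_eq_square intro!: mult_mono component_le_norm_cart)
    have "(\<lambda>x :: real ^ 'r. x $ i) \<in> borel_measurable borel" for i
      by (intro borel_measurable_continuous_onI continuous_intros)
    note this[measurable]
    show "(\<lambda>\<omega>. h (W 0 \<omega>) $ i * h (W 0 \<omega>) $ j) \<in> borel_measurable M" by measurable
  qed
  have var: "t \<bullet> (?\<Sigma> *v t) = expectation (\<lambda>\<omega>. (t \<bullet> h (W 0 \<omega>))\<^sup>2)"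
  proof -
    have eq: "(t \<bullet> h (W 0 \<omega>))\<^sup>2 = (\<Sum>i\<in>UNIV. \<Sum>j\<in>UNIV. t $ i * (h (W 0 \<omega>) $ i * h (W 0 \<omega>) $ j * t $ j))" for \<omega>
      by (simp add: power2_eq_square inner_vec_def sum_product mult_ac)
    show ?thesis
      unfolding eq using prod_int
      by (simp add: inner_vec_def matrix_vector_mult_def Bochner_Integration.integral_sum
          Bochner_Integration.integrable_sum sum_distrib_left)
  qed
  have "(\<lambda>n. expectation (\<lambda>\<omega>. cos ((\<Sum>i=1..n. t \<bullet> h (W i \<omega>)) / sqrt (real n) + c))) \<longlonglongrightarrow>
    (\<integral>x. cos (x + c) \<partial>normal_law 0 (expectation (\<lambda>\<omega>. (t \<bullet> h (W 0 \<omega>))\<^sup>2)))"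
    by (rule central_limit_cos[OF _ sq_t mean_t]) measurable
  also have "normal_law 0 (expectation (\<lambda>\<omega>. (t \<bullet> h (W 0 \<omega>))\<^sup>2)) = distr N borel (\<lambda>\<omega>. t \<bullet> H \<omega>)"
    using H unfolding normal_vector_def by (simp add: var)
  also have "(\<integral>x. cos (x + c) \<partial>distr N borel (\<lambda>\<omega>. t \<bullet> H \<omega>)) = (\<integral>\<omega>. cos (t \<bullet> H \<omega> + c) \<partial>N)"
    by (subst integral_distr) auto
  finally show "(\<lambda>n. expectation (\<lambda>\<omega>. cos (t \<bullet> ?H n \<omega> + c))) \<longlonglongrightarrow> (\<integral>\<omega>. cos (t \<bullet> H \<omega> + c) \<partial>N)"
    by (simp add: inner_sum_right)
qed

end

section \<open>Perturbation of a smooth moment function\<close>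

lemma powr_add_le:
  fixes x y a :: real
  assumes "0 \<le> x" "0 \<le> y" "0 \<le> a"
  shows "(x + y) powr a \<le> 2 powr a * (x powr a + y powr a)"
proof -
  have "(x + y) powr a \<le> (2 * max x y) powr a"
    using assms by (intro powr_mono2) auto
  also have "\<dots> = 2 powr a * max x y powr a"
    using assms by (simp add: powr_mult)
  also have "\<dots> \<le> 2 powr a * (x powr a + y powr a)"
    by (intro mult_left_mono) (auto simp: max_def)
  finally show ?thesis .
qed

text \<open>Where the right side is negative, \<open>x powr (\<rho> - 1)\<close> is below
  \<open>U / k\<close>, which bounds \<open>x\<close>. The constant is not the exact minimum but has
  its homogeneity \<open>\<rho> / (\<rho> - 1)\<close> in \<open>U\<close>.\<close>

lemma powr_linear_lower_bound:
  fixes k U x \<rho> :: real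
  assumes "1 < \<rho>" "0 < k" "0 \<le> U" "0 \<le> x"
  shows "- (U * (U / k) powr (1 / (\<rho> - 1))) \<le> k * x powr \<rho> - U * x"
proof (cases "U * x \<le> k * x powr \<rho>")
  case True
  have "0 \<le> U * (U / k) powr (1 / (\<rho> - 1))" using assms by simp
  then show ?thesis using True by linarith
next
  case False
  then have "x > 0" using assms by (cases "x = 0") auto
  have "x powr \<rho> = x * x powr (\<rho> - 1)"
    using powr_mult_base[of x "\<rho> - 1"] \<open>x > 0\<close> by simp
  then have "x * (k * x powr (\<rho> - 1)) < x * U" using False by (simp add: mult_ac)
  then have "k * x powr (\<rho> - 1) < U" using \<open>x > 0\<close> by simp
  then have "x powr (\<rho> - 1) \<le> U / k" using assms by (simp add: field_simps)
  then have "(x powr (\<rho> - 1)) powr (1 / (\<rho> - 1)) \<le> (U / k) powr (1 / (\<rho> - 1))"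
    using assms by (intro powr_mono2) auto
  then have "x \<le> (U / k) powr (1 / (\<rho> - 1))" using assms \<open>x > 0\<close> by (simp add: powr_powr)
  then have "U * x \<le> U * (U / k) powr (1 / (\<rho> - 1))" using assms by (intro mult_left_mono) auto
  moreover have "0 \<le> k * x powr \<rho>" using assms by simp
  ultimately show ?thesis by linarith
qed

text \<open>\<open>growth\<close> is condition A5 in Euclidean norms and for all \<open>w\<close>;
  \<open>smooth_moment_growth\<close> derives it.\<close>

locale smooth_moment =
  fixes f :: "real ^ 'm \<Rightarrow> real ^ 'r" and D :: "real ^ 'm \<Rightarrow> real ^ 'm ^ 'r"
    and p q :: ennreal and \<rho> C :: real
  assumes rho: "1 < \<rho>" and q: "1 \<le> q" and conj: "1 / p + 1 / q = 1"
    and deriv: "\<And>w. (f has_derivative (\<lambda>v. D w *v v)) (at w)"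
    and cont_D: "continuous_on UNIV D"
    and C_nonneg: "0 \<le> C"
    and growth: "\<And>w v. norm (D w *v v) \<le> C * (1 + norm w powr (\<rho> - 1)) * norm v"
begin

lemma p_ge_1: "1 \<le> p"
  by (rule conjugate_exponent_ge_1[OF q conj])

lemma continuous_f: "continuous_on S f"
  using deriv by (meson has_derivative_at_withinI has_derivative_continuous_on)

lemma continuous_vector_matrix: "continuous_on UNIV (\<lambda>w. z v* D w)"
  unfolding vector_matrix_mult_def using cont_D by (intro continuous_intros continuous_on_vec_lambda)

lemma continuous_matrix_vector: "continuous_on UNIV (\<lambda>w. D w *v v)"
  unfolding matrix_vector_mult_def using cont_D by (intro continuous_intros continuous_on_vec_lambda)

text \<open>The minimum over \<open>d\<close> of
  \<open>lp_norm q d powr \<rho> + \<rho> * (z \<bullet> (D w *v d))\<close>, by the Legendre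
  transform computed above.\<close>

definition local_value :: "real ^ 'r \<Rightarrow> real ^ 'm \<Rightarrow> real" where
  "local_value z w = - (\<rho> - 1) * lp_norm p (z v* D w) powr (\<rho> / (\<rho> - 1))"

text \<open>Here the difference quotient replaces the derivative. Multiplied by
  \<open>t powr \<rho>\<close>, this is the cost of moving \<open>w\<close> by
  \<open>t *\<^sub>R d\<close> plus the change of the moment at the multiplier
  \<open>\<rho> * t powr (\<rho> - 1)\<close> times \<open>z\<close>.\<close>

definition perturbed_cost :: "real ^ 'r \<Rightarrow> real \<Rightarrow> real ^ 'm \<Rightarrow> real ^ 'm \<Rightarrow> real" where
  "perturbed_cost z t w d = lp_norm q d powr \<rho> + (\<rho> / t) * (z \<bullet> (f (w + t *\<^sub>R d) - f w))"

lemma local_value_nonpos: "local_value z w \<le> 0"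
  using rho by (simp add: local_value_def mult_nonpos_nonneg)

lemma local_value_le: "local_value z w \<le> lp_norm q d powr \<rho> + \<rho> * (z \<bullet> (D w *v d))"
  using lp_norm_powr_linear_ge[OF q conj rho, of "z v* D w" d]
  by (simp add: local_value_def dot_lmul_matrix)

lemma local_value_attained: "\<exists>d. lp_norm q d powr \<rho> + \<rho> * (z \<bullet> (D w *v d)) \<le> local_value z w"
  using lp_norm_powr_linear_attained[OF q conj rho, of "z v* D w"]
  by (simp add: local_value_def dot_lmul_matrix)

lemma continuous_local_value: "continuous_on UNIV (local_value z)"
  unfolding local_value_def using rho
  by (intro continuous_intros continuous_on_powr' continuous_on_lp_norm p_ge_1 continuous_vector_matrix) auto

lemma norm_difference_le:
  "norm (f (w + d) - f w) \<le> C * (1 + (norm w + norm d) powr (\<rho> - 1)) * norm d"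
proof -
  let ?S = "cball 0 (norm w + norm d) :: (real ^ 'm) set"
  have "norm (f (w + d) - f w) \<le> C * (1 + (norm w + norm d) powr (\<rho> - 1)) * norm ((w + d) - w)"
  proof (rule differentiable_bound[where S="?S" and f'="\<lambda>x v. D x *v v"])
    show "convex ?S" by (rule convex_cball)
    show "(f has_derivative (*v) (D x)) (at x within ?S)" for x
      using deriv by (rule has_derivative_at_withinI)
    show "onorm ((*v) (D x)) \<le> C * (1 + (norm w + norm d) powr (\<rho> - 1))" if "x \<in> ?S" for x
    proof (rule onorm_le)
      fix v :: "real ^ 'm"
      have "norm x powr (\<rho> - 1) \<le> (norm w + norm d) powr (\<rho> - 1)"
        using that rho by (intro powr_mono2) auto
      then have "C * (1 + norm x powr (\<rho> - 1)) * norm v \<le> C * (1 + (norm w + norm d) powr (\<rho> - 1)) * norm v"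
        using C_nonneg by (intro mult_right_mono mult_left_mono) auto
      then show "norm (D x *v v) \<le> C * (1 + (norm w + norm d) powr (\<rho> - 1)) * norm v"
        using growth[of x v] by linarith
    qed
  qed (auto intro: order_trans[OF norm_triangle_ineq])
  then show ?thesis by simp
qed

text \<open>By the growth condition the difference quotient has a part linear in
  \<open>norm d\<close> and a part of order \<open>t powr (\<rho> - 1) * norm d powr \<rho>\<close>.
  For small \<open>t\<close> half of the cost absorbs the latter.\<close>

lemma perturbed_cost_lower_bound:
  obtains k a t0 where "0 < k" "0 \<le> a" "0 < t0"
    "\<And>t w d. 0 < t \<Longrightarrow> t \<le> t0 \<Longrightarrow>
      k * norm d powr \<rho> - a * (1 + norm w powr (\<rho> - 1)) * norm d \<le> perturbed_cost z t w d"
proof -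
  define c where "c = (1 / real CARD('m)) powr \<rho>"
  have c: "0 < c" by (simp add: c_def)
  define a where "a = \<rho> * norm z * C * 2 powr (\<rho> - 1)"
  have a: "0 \<le> a" using rho C_nonneg by (simp add: a_def)
  \<comment> \<open>\<open>t0\<close> solves \<open>(a + 1) * t0 powr (\<rho> - 1) = c / 2\<close>;
    adding \<open>1\<close> keeps the quotient meaningful for \<open>a = 0\<close>.\<close>
  define t0 where "t0 = (c / (2 * (a + 1))) powr (1 / (\<rho> - 1))"
  have t0: "0 < t0" using c a by (simp add: t0_def)
  show ?thesis
  proof (rule that[of "c / 2" a t0])
    fix t :: real and w d :: "real ^ 'm" assume t: "0 < t" "t \<le> t0"
    have "t powr (\<rho> - 1) \<le> t0 powr (\<rho> - 1)" using t rho by (intro powr_mono2) auto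
    also have "\<dots> = c / (2 * (a + 1))" using rho c a by (simp add: t0_def powr_powr)
    finally have "(a + 1) * t powr (\<rho> - 1) \<le> (a + 1) * (c / (2 * (a + 1)))"
      using a by (intro mult_left_mono) auto
    also have "\<dots> = c / 2" using a by (simp add: field_simps)
    finally have "(a + 1) * t powr (\<rho> - 1) \<le> c / 2" .
    moreover have "a * t powr (\<rho> - 1) \<le> (a + 1) * t powr (\<rho> - 1)" by (intro mult_right_mono) auto
    ultimately have at: "a * t powr (\<rho> - 1) \<le> c / 2" by linarith
    have 1: "c * norm d powr \<rho> \<le> lp_norm q d powr \<rho>"
    proof -
      have "(1 / real CARD('m)) * norm d \<le> lp_norm q d"
        using norm_le_lp_norm[OF q, of d] by (simp add: field_simps)
      then have "((1 / real CARD('m)) * norm d) powr \<rho> \<le> lp_norm q d powr \<rho>"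
        using rho by (intro powr_mono2) auto
      then show ?thesis by (simp add: c_def powr_mult del: times_divide_eq_left)
    qed
    have "\<bar>z \<bullet> (f (w + t *\<^sub>R d) - f w)\<bar> \<le> norm z * norm (f (w + t *\<^sub>R d) - f w)"
      by (rule Cauchy_Schwarz_ineq2)
    also have "\<dots> \<le> norm z * (C * (1 + (norm w + t * norm d) powr (\<rho> - 1)) * (t * norm d))"
      using norm_difference_le[of w "t *\<^sub>R d"] t by (intro mult_left_mono) auto
    also have "\<dots> \<le> norm z * (C * (2 powr (\<rho> - 1) * ((1 + norm w powr (\<rho> - 1)) + t powr (\<rho> - 1) * norm d powr (\<rho> - 1))) * (t * norm d))"
    proof -
      have "(norm w + t * norm d) powr (\<rho> - 1) \<le> 2 powr (\<rho> - 1) * (norm w powr (\<rho> - 1) + (t * norm d) powr (\<rho> - 1))"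
        using t rho by (intro powr_add_le) auto
      moreover have "1 \<le> (2::real) powr (\<rho> - 1)"
        using powr_mono[of 0 "\<rho> - 1" "2::real"] rho by simp
      ultimately have "1 + (norm w + t * norm d) powr (\<rho> - 1) \<le> 2 powr (\<rho> - 1) * ((1 + norm w powr (\<rho> - 1)) + t powr (\<rho> - 1) * norm d powr (\<rho> - 1))"
        using t by (simp add: powr_mult algebra_simps)
      then show ?thesis using t C_nonneg by (intro mult_left_mono mult_right_mono) auto
    qed
    finally have "(\<rho> / t) * \<bar>z \<bullet> (f (w + t *\<^sub>R d) - f w)\<bar> \<le> (\<rho> / t) * \<dots>"
      using t rho by (intro mult_left_mono) auto
    also have "\<dots> = a * (1 + norm w powr (\<rho> - 1)) * norm d + a * t powr (\<rho> - 1) * (norm d * norm d powr (\<rho> - 1))"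
      using t by (simp add: a_def field_simps)
    also have "norm d * norm d powr (\<rho> - 1) = norm d powr \<rho>"
      using powr_mult_base[of "norm d" "\<rho> - 1"] by simp
    also have "a * t powr (\<rho> - 1) * norm d powr \<rho> \<le> c / 2 * norm d powr \<rho>"
      using at by (intro mult_right_mono) auto
    finally have "(\<rho> / t) * \<bar>z \<bullet> (f (w + t *\<^sub>R d) - f w)\<bar> \<le> a * (1 + norm w powr (\<rho> - 1)) * norm d + c / 2 * norm d powr \<rho>"
      by simp
    moreover have "\<bar>(\<rho> / t) * (z \<bullet> (f (w + t *\<^sub>R d) - f w))\<bar> = (\<rho> / t) * \<bar>z \<bullet> (f (w + t *\<^sub>R d) - f w)\<bar>"
      using t rho by (simp add: abs_mult)
    ultimately show "c / 2 * norm d powr \<rho> - a * (1 + norm w powr (\<rho> - 1)) * norm d \<le> perturbed_cost z t w d"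
      using 1 unfolding perturbed_cost_def by linarith
  qed (use c a t0 in auto)
qed

text \<open>Minimizing the previous bound over \<open>norm d\<close> raises
  \<open>1 + norm w powr (\<rho> - 1)\<close> to the conjugate exponent
  \<open>\<rho> / (\<rho> - 1)\<close>. The result has order \<open>norm w powr \<rho>\<close>,
  which is integrable by A5.\<close>

lemma perturbed_cost_envelope:
  obtains E t0 where "0 \<le> E" "0 < t0"
    "\<And>t w d. 0 < t \<Longrightarrow> t \<le> t0 \<Longrightarrow> - E * (1 + norm w powr \<rho>) \<le> perturbed_cost z t w d"
proof -
  obtain k a t0 where k: "0 < k" "0 \<le> a" "0 < t0"
    and lb: "\<And>t w d. 0 < t \<Longrightarrow> t \<le> t0 \<Longrightarrow>
      k * norm d powr \<rho> - a * (1 + norm w powr (\<rho> - 1)) * norm d \<le> perturbed_cost z t w d"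
    by (rule perturbed_cost_lower_bound[of z], rule that)
  define s where "s = \<rho> / (\<rho> - 1)"
  have s: "0 < s" "1 + 1 / (\<rho> - 1) = s" "(\<rho> - 1) * s = \<rho>" using rho by (auto simp: s_def field_simps)
  define E where "E = (1 / k) powr (1 / (\<rho> - 1)) * (a powr s * 2 powr s)"
  show ?thesis
  proof (rule that[of E t0])
    show "0 \<le> E" by (simp add: E_def)
    fix t :: real and w d :: "real ^ 'm" assume t: "0 < t" "t \<le> t0"
    let ?U = "a * (1 + norm w powr (\<rho> - 1))"
    have U: "0 \<le> ?U" using k by simp
    have "?U * (?U / k) powr (1 / (\<rho> - 1)) = (1 / k) powr (1 / (\<rho> - 1)) * (?U * ?U powr (1 / (\<rho> - 1)))"
      using U k by (simp add: powr_divide)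
    also have "?U * ?U powr (1 / (\<rho> - 1)) = ?U powr s"
      using powr_mult_base[OF U, of "1 / (\<rho> - 1)"] by (simp add: s(2))
    also have "\<dots> = a powr s * (1 + norm w powr (\<rho> - 1)) powr s"
      using k by (simp add: powr_mult)
    also have "(1 / k) powr (1 / (\<rho> - 1)) * \<dots> \<le> (1 / k) powr (1 / (\<rho> - 1)) * (a powr s * (2 powr s * (1 powr s + (norm w powr (\<rho> - 1)) powr s)))"
      using s by (intro mult_left_mono powr_add_le) auto
    also have "\<dots> = E * (1 + norm w powr \<rho>)"
      by (simp add: E_def powr_powr s(3))
    finally have "?U * (?U / k) powr (1 / (\<rho> - 1)) \<le> E * (1 + norm w powr \<rho>)" .
    then show "- E * (1 + norm w powr \<rho>) \<le> perturbed_cost z t w d"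
      using powr_linear_lower_bound[OF rho k(1) U norm_ge_zero[of d]] lb[OF t, of d w] by linarith
  qed (use k in auto)
qed

text \<open>Large displacements are too expensive, and on bounded ones the difference quotient
  converges uniformly.\<close>

lemma perturbed_cost_eventually_ge:
  assumes e: "0 < e"
  obtains t1 where "0 < t1"
    "\<And>t d. 0 < t \<Longrightarrow> t \<le> t1 \<Longrightarrow> local_value z w - e \<le> perturbed_cost z t w d"
proof -
  obtain k a t0 where k: "0 < k" "0 \<le> a" "0 < t0"
    and lb: "\<And>t w d. 0 < t \<Longrightarrow> t \<le> t0 \<Longrightarrow>
      k * norm d powr \<rho> - a * (1 + norm w powr (\<rho> - 1)) * norm d \<le> perturbed_cost z t w d"
    by (rule perturbed_cost_lower_bound[of z], rule that)
  define U where "U = a * (1 + norm w powr (\<rho> - 1))"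
  have U: "0 \<le> U" using k by (simp add: U_def)
  \<comment> \<open>Beyond norm \<open>K\<close> the lower bound of the cost is nonnegative, whereas
    \<open>local_value\<close> is at most zero.\<close>
  define K where "K = (U / k) powr (1 / (\<rho> - 1)) + 1"
  have K: "0 < K" by (simp add: K_def add_nonneg_pos)
  \<comment> \<open>Linearization error per unit of displacement: after multiplication by
    \<open>\<rho>\<close>, \<open>norm z\<close> and \<open>K\<close> it is at most
    \<open>e\<close>, also for \<open>z = 0\<close>.\<close>
  define e' where "e' = e / (\<rho> * (norm z + 1) * K)"
  have nz: "0 < norm z + 1" by (simp add: add_nonneg_pos)
  have e': "0 < e'" using e rho K nz by (simp add: e'_def)
  from deriv[of w] obtain r where r: "0 < r"
    "\<And>y. norm (y - w) < r \<Longrightarrow> norm (f y - f w - D w *v (y - w)) \<le> e' * norm (y - w)"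
    unfolding has_derivative_at_alt using e' by blast
  define t1 where "t1 = min t0 (r / (2 * K))"
  show ?thesis
  proof (rule that[of t1])
    show "0 < t1" using k r K by (simp add: t1_def)
    fix t :: real and d :: "real ^ 'm" assume t: "0 < t" "t \<le> t1"
    show "local_value z w - e \<le> perturbed_cost z t w d"
    proof (cases "norm d \<le> K")
      case False
      then have d: "K < norm d" by simp
      have "U / k = ((U / k) powr (1 / (\<rho> - 1))) powr (\<rho> - 1)" using U k rho by (simp add: powr_powr)
      also have "\<dots> \<le> norm d powr (\<rho> - 1)"
        using d rho by (intro powr_mono2) (auto simp: K_def)
      finally have "U \<le> k * norm d powr (\<rho> - 1)" using k by (simp add: field_simps)
      then have "U * norm d \<le> k * norm d powr (\<rho> - 1) * norm d" by (intro mult_right_mono) auto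
      also have "\<dots> = k * norm d powr \<rho>"
        using powr_mult_base[of "norm d" "\<rho> - 1"] by (simp add: mult_ac)
      finally have "0 \<le> perturbed_cost z t w d"
        using lb[of t d w] t unfolding t1_def U_def by simp
      then show ?thesis using local_value_nonpos[of z w] e by linarith
    next
      case True
      have "norm (t *\<^sub>R d) \<le> t1 * K" using t True by (auto intro!: mult_mono)
      also have "\<dots> \<le> r / (2 * K) * K" using K by (intro mult_right_mono) (auto simp: t1_def)
      also have "\<dots> < r" using K r by simp
      finally have "norm (f (w + t *\<^sub>R d) - f w - D w *v (t *\<^sub>R d)) \<le> e' * norm (t *\<^sub>R d)"
        using r(2)[of "w + t *\<^sub>R d"] by simp
      also have "\<dots> \<le> e' * (t * K)" using t True e' by (auto intro!: mult_left_mono)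
      finally have 1: "norm (f (w + t *\<^sub>R d) - f w - t *\<^sub>R (D w *v d)) \<le> e' * (t * K)"
        by (simp add: matrix_vector_mult_scaleR)
      have "\<bar>z \<bullet> (f (w + t *\<^sub>R d) - f w - t *\<^sub>R (D w *v d))\<bar> \<le> norm z * (e' * (t * K))"
        using 1 by (intro order_trans[OF Cauchy_Schwarz_ineq2] mult_left_mono) auto
      also have "\<dots> \<le> (norm z + 1) * (e' * (t * K))" using e' t K by (intro mult_right_mono) auto
      also have "A * (e / (\<rho> * A * K) * (t * K)) = t * (e / \<rho>)" if "A \<noteq> 0" for A
        using that K rho by simp
      from this[of "norm z + 1"] have "(norm z + 1) * (e' * (t * K)) = t * (e / \<rho>)"
        using nz by (simp add: e'_def)
      finally have "(\<rho> / t) * (- (z \<bullet> (f (w + t *\<^sub>R d) - f w - t *\<^sub>R (D w *v d)))) \<le> (\<rho> / t) * (t * (e / \<rho>))"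
        using t rho by (intro mult_left_mono) auto
      also have "\<dots> = e" using t rho by simp
      finally have "\<rho> * (z \<bullet> (D w *v d)) - e \<le> (\<rho> / t) * (z \<bullet> (f (w + t *\<^sub>R d) - f w))"
        using t rho by (simp add: inner_diff_right inner_add_right field_simps)
      then show ?thesis using local_value_le[of z w d] unfolding perturbed_cost_def by linarith
    qed
  qed
qed

text \<open>The worst error, over all displacements, of putting the derivative in place of the
  difference quotient; truncation at zero makes it a nonnegative correction.\<close>

definition duality_gap :: "real ^ 'r \<Rightarrow> real \<Rightarrow> real ^ 'm \<Rightarrow> real" where
  "duality_gap z t w = (SUP d. max 0 (local_value z w - perturbed_cost z t w d))"

text \<open>The envelope makes the supremum finite and dominates it integrably. The supremum is
  uncountable, but its superlevel sets are unions of open sets, hence open.\<close>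

lemma duality_gap_properties:
  obtains E t0 where "0 \<le> E" "0 < t0"
    "\<And>t w. 0 < t \<Longrightarrow> t \<le> t0 \<Longrightarrow> 0 \<le> duality_gap z t w \<and> duality_gap z t w \<le> E * (1 + norm w powr \<rho>)"
    "\<And>t w d. 0 < t \<Longrightarrow> t \<le> t0 \<Longrightarrow> local_value z w - duality_gap z t w \<le> perturbed_cost z t w d"
    "\<And>t. 0 < t \<Longrightarrow> t \<le> t0 \<Longrightarrow> duality_gap z t \<in> borel_measurable borel"
proof -
  obtain E t0 where E: "0 \<le> E" "0 < t0"
    and lb: "\<And>t w d. 0 < t \<Longrightarrow> t \<le> t0 \<Longrightarrow> - E * (1 + norm w powr \<rho>) \<le> perturbed_cost z t w d"
    by (rule perturbed_cost_envelope[of z], rule that)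
  have bound: "max 0 (local_value z w - perturbed_cost z t w d) \<le> E * (1 + norm w powr \<rho>)"
    if "0 < t" "t \<le> t0" for t w d
  proof -
    have "0 \<le> E * (1 + norm w powr \<rho>)" using E by simp
    then show ?thesis using lb[OF that, of w d] local_value_nonpos[of z w] by simp
  qed
  have bdd: "bdd_above (range (\<lambda>d. max 0 (local_value z w - perturbed_cost z t w d)))"
    if "0 < t" "t \<le> t0" for t w
    using bound[OF that] by (intro bdd_aboveI2)
  have upper: "max 0 (local_value z w - perturbed_cost z t w d) \<le> duality_gap z t w"
    if "0 < t" "t \<le> t0" for t w d
    unfolding duality_gap_def by (rule cSUP_upper[OF UNIV_I bdd[OF that]])
  show ?thesis
  proof (rule that[of E t0])
    fix t w assume t: "0 < t" "t \<le> t0"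
    have "duality_gap z t w \<le> E * (1 + norm w powr \<rho>)"
      unfolding duality_gap_def using bound[OF t] by (intro cSUP_least) auto
    moreover have "0 \<le> duality_gap z t w" using upper[OF t, of w 0] by linarith
    ultimately show "0 \<le> duality_gap z t w \<and> duality_gap z t w \<le> E * (1 + norm w powr \<rho>)" by simp
  next
    fix t :: real and w d :: "real ^ 'm" assume t: "0 < t" "t \<le> t0"
    show "local_value z w - duality_gap z t w \<le> perturbed_cost z t w d"
      using upper[OF t, of w d] by linarith
  next
    fix t assume t: "0 < t" "t \<le> t0"
    show "duality_gap z t \<in> borel_measurable borel"
    proof (rule borel_measurableI_greater)
      fix a
      have "{w. a < duality_gap z t w} = (\<Union>d. {w. a < max 0 (local_value z w - perturbed_cost z t w d)})"
        unfolding duality_gap_def using bdd[OF t] by (auto simp: less_cSUP_iff)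
      moreover have "open {w. a < max 0 (local_value z w - perturbed_cost z t w d)}" for d
      proof (intro open_Collect_less continuous_intros continuous_local_value)
        have "continuous_on UNIV (\<lambda>w. f (w + t *\<^sub>R d))"
          by (rule continuous_on_compose2[OF continuous_f[of UNIV]]) (auto intro!: continuous_intros)
        then show "continuous_on UNIV (\<lambda>w. perturbed_cost z t w d)"
          unfolding perturbed_cost_def using continuous_f by (intro continuous_intros)
      qed
      ultimately have "open {w. a < duality_gap z t w}" by (simp add: open_UN)
      then show "{w \<in> space borel. a < duality_gap z t w} \<in> sets borel" by simp
    qed
  qed (use E in auto)
qed

lemma duality_gap_tendsto:
  assumes t: "t \<longlonglongrightarrow> 0" "\<And>n. 0 < t n"
  shows "(\<lambda>n. duality_gap z (t n) w) \<longlonglongrightarrow> 0"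
proof (rule LIMSEQ_I)
  fix e :: real assume "0 < e"
  then have "0 < e / 2" by simp
  obtain t1 where t1: "0 < t1"
    "\<And>t d. 0 < t \<Longrightarrow> t \<le> t1 \<Longrightarrow> local_value z w - e / 2 \<le> perturbed_cost z t w d"
    by (rule perturbed_cost_eventually_ge[OF \<open>0 < e / 2\<close>, of z w], rule that)
  obtain n0 where n0: "\<And>n. n0 \<le> n \<Longrightarrow> t n < t1"
    using order_tendstoD(2)[OF t(1) t1(1)] by (auto simp: eventually_sequentially)
  show "\<exists>n0. \<forall>n\<ge>n0. norm (duality_gap z (t n) w - 0) < e"
  proof (intro exI allI impI)
    fix n assume n: "n0 \<le> n"
    have b: "max 0 (local_value z w - perturbed_cost z (t n) w d) \<le> e / 2" for d
      using t1(2)[OF t(2)[of n], of d] n0[OF n] \<open>0 < e\<close> by (simp add: max_def)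
    have "duality_gap z (t n) w \<le> e / 2"
      unfolding duality_gap_def using b by (intro cSUP_least) auto
    moreover have "max 0 (local_value z w - perturbed_cost z (t n) w 0) \<le> duality_gap z (t n) w"
      unfolding duality_gap_def by (rule cSUP_upper[OF UNIV_I bdd_aboveI2[OF b]])
    ultimately show "norm (duality_gap z (t n) w - 0) < e" using \<open>0 < e\<close> by simp
  qed
qed

section \<open>Difference quotients along bounded displacements\<close>

lemma difference_quotient_bound:
  assumes "0 < t" "t \<le> 1" "norm d \<le> K"
  shows "norm ((1 / t) *\<^sub>R (f (w + t *\<^sub>R d) - f w)) \<le> C * (1 + (norm w + K) powr (\<rho> - 1)) * K"
proof -
  have "0 \<le> K" using assms(3) norm_ge_zero[of d] by linarith
  have td: "norm (t *\<^sub>R d) \<le> K"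
    using mult_mono[of t 1 "norm d" K] assms \<open>0 \<le> K\<close> by simp
  have "norm ((1 / t) *\<^sub>R (f (w + t *\<^sub>R d) - f w)) \<le> (1 / t) * (C * (1 + (norm w + norm (t *\<^sub>R d)) powr (\<rho> - 1)) * norm (t *\<^sub>R d))"
    using assms norm_difference_le[of w "t *\<^sub>R d"] unfolding norm_scaleR
    by (intro mult_mono) auto
  also have "\<dots> = C * (1 + (norm w + norm (t *\<^sub>R d)) powr (\<rho> - 1)) * norm d"
    using assms by simp
  also have "\<dots> \<le> C * (1 + (norm w + K) powr (\<rho> - 1)) * K"
    using assms rho C_nonneg td
    by (intro mult_mono mult_left_mono add_left_mono powr_mono2 add_mono) auto
  finally show ?thesis .
qed

lemma difference_quotient_tendsto:
  assumes t: "t \<longlonglongrightarrow> 0" "\<And>n. 0 < t n"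
  shows "(\<lambda>n. (1 / t n) *\<^sub>R (f (w + t n *\<^sub>R d) - f w)) \<longlonglongrightarrow> D w *v d"
proof (rule LIMSEQ_I)
  fix e :: real assume "0 < e"
  define e' where "e' = e / (norm d + 1)"
  have nd: "0 < norm d + 1" by (simp add: add_nonneg_pos)
  have e': "0 < e'" "e' * norm d < e" using \<open>0 < e\<close> nd by (auto simp: e'_def field_simps)
  from deriv[of w] obtain r where r: "0 < r"
    "\<And>y. norm (y - w) < r \<Longrightarrow> norm (f y - f w - D w *v (y - w)) \<le> e' * norm (y - w)"
    unfolding has_derivative_at_alt using e'(1) by blast
  have "(\<lambda>n. norm (t n *\<^sub>R d)) \<longlonglongrightarrow> norm (0 *\<^sub>R d)"
    by (intro tendsto_intros t)
  then have "\<forall>\<^sub>F n in sequentially. norm (t n *\<^sub>R d) < r" using r(1) by (intro order_tendstoD(2)) auto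
  then obtain n0 where n0: "\<And>n. n0 \<le> n \<Longrightarrow> norm (t n *\<^sub>R d) < r" by (auto simp: eventually_sequentially)
  show "\<exists>n0. \<forall>n\<ge>n0. norm ((1 / t n) *\<^sub>R (f (w + t n *\<^sub>R d) - f w) - D w *v d) < e"
  proof (intro exI allI impI)
    fix n assume n: "n0 \<le> n"
    have "norm (f (w + t n *\<^sub>R d) - f w - t n *\<^sub>R (D w *v d)) \<le> e' * (t n * norm d)"
      using r(2)[of "w + t n *\<^sub>R d"] n0[OF n] t(2)[of n] by (simp add: matrix_vector_mult_scaleR)
    then have "norm ((1 / t n) *\<^sub>R (f (w + t n *\<^sub>R d) - f w - t n *\<^sub>R (D w *v d))) \<le> (1 / t n) * (e' * (t n * norm d))"
      using t(2)[of n] unfolding norm_scaleR by (intro mult_mono) auto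
    also have "\<dots> = e' * norm d" using t(2)[of n] by simp
    also have "(1 / t n) *\<^sub>R (f (w + t n *\<^sub>R d) - f w - t n *\<^sub>R (D w *v d)) = (1 / t n) *\<^sub>R (f (w + t n *\<^sub>R d) - f w) - D w *v d"
      using t(2)[of n] by (simp add: scaleR_right_diff_distrib)
    finally show "norm ((1 / t n) *\<^sub>R (f (w + t n *\<^sub>R d) - f w) - D w *v d) < e"
      using e'(2) by linarith
  qed
qed

end

section \<open>The dual value\<close>

lemma powr_minus_1_le:
  fixes x a :: real
  assumes "0 \<le> x" "1 \<le> a"
  shows "x powr (a - 1) \<le> 1 + x powr a"
proof (cases "x \<le> 1")
  case True
  have "x powr (a - 1) \<le> 1 powr (a - 1)" using True assms by (intro powr_mono2) auto
  then show ?thesis using powr_ge_zero[of x a] unfolding powr_one_eq_one by linarith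
next
  case False
  have "x powr (a - 1) \<le> x powr a" using False by (intro powr_mono) auto
  then show ?thesis by simp
qed

locale sampled_moment = iid_sequence M W + smooth_moment f D p q \<rho> C
  for M :: "'a measure" and W :: "nat \<Rightarrow> 'a \<Rightarrow> real ^ 'm"
    and f :: "real ^ 'm \<Rightarrow> real ^ 'r" and D :: "real ^ 'm \<Rightarrow> real ^ 'm ^ 'r"
    and p q :: ennreal and \<rho> C :: real +
  assumes moment: "integrable M (\<lambda>\<omega>. norm (W 0 \<omega>) powr \<rho>)"
    and square: "integrable M (\<lambda>\<omega>. (norm (f (W 0 \<omega>)))\<^sup>2)"
    and mean_zero: "expectation (\<lambda>\<omega>. f (W 0 \<omega>)) = 0"
    and nondegenerate: "\<And>z. z \<noteq> 0 \<Longrightarrow> 0 < prob {\<omega> \<in> space M. 0 < lp_norm p (z v* D (W 0 \<omega>))}"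
begin

definition mean_value :: "real ^ 'r \<Rightarrow> real" where
  "mean_value z = expectation (\<lambda>\<omega>. local_value z (W 0 \<omega>))"

definition dual_objective :: "real ^ 'r \<Rightarrow> real ^ 'r \<Rightarrow> real" where
  "dual_objective x z = \<rho> * (z \<bullet> x) + mean_value z"

definition dual_value :: "real ^ 'r \<Rightarrow> real" where
  "dual_value x = (SUP z. dual_objective x z)"

abbreviation (input) s :: real where "s \<equiv> \<rho> / (\<rho> - 1)"

lemma s_gt_1: "1 < s"
  using rho by simp

lemma borel_measurable_local_value [measurable]: "local_value z \<in> borel_measurable borel"
  by (rule borel_measurable_continuous_onI[OF continuous_local_value])

lemma borel_measurable_f [measurable]: "f \<in> borel_measurable borel"
  by (rule borel_measurable_continuous_onI[OF continuous_f])

text \<open>The dual norm of \<open>z v* D w\<close> grows like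
  \<open>norm w powr (\<rho> - 1)\<close>; the conjugate exponent turns this into the power
  \<open>\<rho>\<close>, the moment that is available.\<close>

lemma local_value_bound:
  obtains K where "0 \<le> K" "\<And>z w. \<bar>local_value z w\<bar> \<le> K * norm z powr s * (1 + norm w powr \<rho>)"
proof -
  define m where "m = real CARD('m)"
  have m: "0 \<le> m" by (simp add: m_def)
  define K where "K = (\<rho> - 1) * ((m * C) powr s * 2 powr s)"
  show ?thesis
  proof (rule that[of K])
    show "0 \<le> K" using rho by (simp add: K_def)
    fix z w
    have "lp_norm p (z v* D w) \<le> m * norm (z v* D w)"
      unfolding m_def by (rule lp_norm_le_norm[OF p_ge_1])
    also have "\<dots> \<le> m * (C * (1 + norm w powr (\<rho> - 1)) * norm z)"
      using growth m by (intro mult_left_mono norm_vector_matrix_le) auto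
    finally have "lp_norm p (z v* D w) powr s \<le> (m * (C * (1 + norm w powr (\<rho> - 1)) * norm z)) powr s"
      using rho by (intro powr_mono2) auto
    also have "\<dots> = (m * C) powr s * norm z powr s * (1 + norm w powr (\<rho> - 1)) powr s"
      using m C_nonneg by (simp add: powr_mult)
    also have "\<dots> \<le> (m * C) powr s * norm z powr s * (2 powr s * (1 powr s + (norm w powr (\<rho> - 1)) powr s))"
      using rho by (intro mult_left_mono powr_add_le) auto
    also have "\<dots> = ((m * C) powr s * 2 powr s) * norm z powr s * (1 + norm w powr \<rho>)"
      using rho by (simp add: powr_powr)
    finally have "(\<rho> - 1) * lp_norm p (z v* D w) powr s \<le> (\<rho> - 1) * (((m * C) powr s * 2 powr s) * norm z powr s * (1 + norm w powr \<rho>))"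
      using rho by (intro mult_left_mono) auto
    then show "\<bar>local_value z w\<bar> \<le> K * norm z powr s * (1 + norm w powr \<rho>)"
      using rho by (simp add: local_value_def K_def abs_mult mult.assoc)
  qed
qed

lemma integrable_envelope: "integrable M (\<lambda>\<omega>. a * (1 + norm (W 0 \<omega>) powr \<rho>))"
  using moment by simp

lemma integrable_local_value: "integrable M (\<lambda>\<omega>. local_value z (W 0 \<omega>))"
proof -
  obtain K where K: "0 \<le> K" "\<And>z w. \<bar>local_value z w\<bar> \<le> K * norm z powr s * (1 + norm w powr \<rho>)"
    by (rule local_value_bound, rule that)
  show ?thesis
    by (rule Bochner_Integration.integrable_bound[OF integrable_envelope[of "K * norm z powr s"]])
       (use K in \<open>auto intro!: AE_I2 order_trans[OF _ abs_ge_self]\<close>)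
qed

lemma local_value_scaleR: "local_value (r *\<^sub>R z) w = \<bar>r\<bar> powr s * local_value z w"
proof -
  have "(r *\<^sub>R z) v* D w = r *\<^sub>R (z v* D w)"
    by (simp add: vec_eq_iff vector_matrix_mult_def sum_distrib_left mult_ac)
  then show ?thesis
    by (simp add: local_value_def lp_norm_scaleR[OF p_ge_1] powr_mult)
qed

lemma mean_value_scaleR: "mean_value (r *\<^sub>R z) = \<bar>r\<bar> powr s * mean_value z"
  by (simp add: mean_value_def local_value_scaleR)

lemma mean_value_0 [simp]: "mean_value 0 = 0"
  using mean_value_scaleR[of 0 0] s_gt_1 by simp

lemma continuous_mean_value: "continuous_on UNIV mean_value"
proof (rule continuous_on_sequentiallyI)
  fix u :: "nat \<Rightarrow> real ^ 'r" and z assume u: "u \<longlonglongrightarrow> z"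
  obtain B where B: "\<And>n. norm (u n) \<le> B"
    using convergent_imp_Bseq[of u] u by (auto simp: convergent_def Bseq_def)
  have "0 \<le> B" using B[of 0] norm_ge_zero[of "u 0"] by linarith
  obtain K where K: "0 \<le> K" "\<And>z w. \<bar>local_value z w\<bar> \<le> K * norm z powr s * (1 + norm w powr \<rho>)"
    by (rule local_value_bound, rule that)
  show "(\<lambda>n. mean_value (u n)) \<longlonglongrightarrow> mean_value z"
    unfolding mean_value_def
  proof (rule integral_dominated_convergence)
    show "integrable M (\<lambda>\<omega>. K * B powr s * (1 + norm (W 0 \<omega>) powr \<rho>))" by (rule integrable_envelope)
    show "AE \<omega> in M. (\<lambda>n. local_value (u n) (W 0 \<omega>)) \<longlonglongrightarrow> local_value z (W 0 \<omega>)"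
    proof (rule AE_I2)
      fix \<omega>
      have "continuous_on UNIV (\<lambda>z. local_value z (W 0 \<omega>))"
        unfolding local_value_def vector_matrix_mult_def using s_gt_1
        by (intro continuous_intros continuous_on_powr' continuous_on_lp_norm p_ge_1 continuous_on_vec_lambda) auto
      then show "(\<lambda>n. local_value (u n) (W 0 \<omega>)) \<longlonglongrightarrow> local_value z (W 0 \<omega>)"
        using u by (auto simp: continuous_on_sequentially comp_def)
    qed
    show "AE \<omega> in M. norm (local_value (u n) (W 0 \<omega>)) \<le> K * B powr s * (1 + norm (W 0 \<omega>) powr \<rho>)" for n
    proof (rule AE_I2)
      fix \<omega>
      have "norm (u n) powr s \<le> B powr s" using B[of n] s_gt_1 by (intro powr_mono2) auto
      then have "K * norm (u n) powr s * (1 + norm (W 0 \<omega>) powr \<rho>) \<le> K * B powr s * (1 + norm (W 0 \<omega>) powr \<rho>)"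
        using K(1) by (intro mult_right_mono mult_left_mono) auto
      then show "norm (local_value (u n) (W 0 \<omega>)) \<le> K * B powr s * (1 + norm (W 0 \<omega>) powr \<rho>)"
        using K(2)[of "u n" "W 0 \<omega>"] by simp
    qed
  qed measurable
qed

lemma mean_value_nonpos: "mean_value z \<le> 0"
proof -
  have "0 \<le> expectation (\<lambda>\<omega>. - local_value z (W 0 \<omega>))"
    using local_value_nonpos by (intro Bochner_Integration.integral_nonneg) simp
  then show ?thesis by (simp add: mean_value_def)
qed

text \<open>A nonpositive function with zero mean vanishes almost surely, which the nondegeneracy
  condition A4 rules out.\<close>

lemma mean_value_neg:
  assumes "z \<noteq> 0"
  shows "mean_value z < 0"
proof (rule ccontr)
  assume "\<not> mean_value z < 0"
  then have "mean_value z = 0" using mean_value_nonpos[of z] by linarith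
  then have "expectation (\<lambda>\<omega>. - local_value z (W 0 \<omega>)) = 0" by (simp add: mean_value_def)
  then have "AE \<omega> in M. - local_value z (W 0 \<omega>) = 0"
    using integrable_local_value local_value_nonpos by (subst (asm) integral_nonneg_eq_0_iff_AE) auto
  then have "AE \<omega> in M. \<not> 0 < lp_norm p (z v* D (W 0 \<omega>))"
    by eventually_elim (use rho in \<open>auto simp: local_value_def\<close>)
  then have "prob {\<omega> \<in> space M. 0 < lp_norm p (z v* D (W 0 \<omega>))} = 0"
    by (simp add: emeasure_eq_0_AE measure_def)
  then show False using nondegenerate[OF assms] by simp
qed

text \<open>Compactness makes negativity uniform on the unit sphere, and homogeneity spreads it to
  all of the space.\<close>

lemma mean_value_coercive:
  obtains \<delta> where "0 < \<delta>" "\<And>z. mean_value z \<le> - \<delta> * norm z powr s"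
proof -
  have "sphere (0::real ^ 'r) 1 \<noteq> {}" by (auto intro!: exI[of _ "axis undefined 1"] simp: norm_axis_1)
  then obtain z0 where z0: "norm z0 = 1" "\<And>z. norm z = 1 \<Longrightarrow> mean_value z \<le> mean_value z0"
    using continuous_attains_sup[OF compact_sphere _ continuous_on_subset[OF continuous_mean_value], of 0 1]
    by auto
  have "z0 \<noteq> 0" using z0(1) by auto
  show ?thesis
  proof (rule that[of "- mean_value z0"])
    show "0 < - mean_value z0" using mean_value_neg[OF \<open>z0 \<noteq> 0\<close>] by simp
    fix z :: "real ^ 'r"
    show "mean_value z \<le> - (- mean_value z0) * norm z powr s"
    proof (cases "z = 0")
      case False
      have "mean_value z = norm z powr s * mean_value ((1 / norm z) *\<^sub>R z)"
        using mean_value_scaleR[of "norm z" "(1 / norm z) *\<^sub>R z"] False by simp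
      also have "\<dots> \<le> norm z powr s * mean_value z0"
        using z0(2)[of "(1 / norm z) *\<^sub>R z"] False by (intro mult_left_mono) auto
      finally show ?thesis by (simp add: mult_ac)
    qed simp
  qed
qed

text \<open>A power above one beats the linear term, uniformly for bounded \<open>x\<close>. The
  margin \<open>-1\<close> will absorb approximation errors in
  \<open>high_probability_le_value\<close>.\<close>

lemma dual_objective_coercive:
  obtains K where "0 < K" "\<And>x z. norm x \<le> B \<Longrightarrow> K \<le> norm z \<Longrightarrow> dual_objective x z \<le> -1"
proof -
  obtain \<delta> where \<delta>: "0 < \<delta>" "\<And>z. mean_value z \<le> - \<delta> * norm z powr s"
    by (rule mean_value_coercive, rule that)
  \<comment> \<open>For \<open>norm z \<ge> K\<close> the coefficient
    \<open>\<delta> * norm z powr (s - 1)\<close> is at least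
    \<open>\<rho> * \<bar>B\<bar> + 1\<close>, since
    \<open>s - 1 = 1 / (\<rho> - 1)\<close>.\<close>
  define A where "A = (\<rho> * \<bar>B\<bar> + 1) / \<delta>"
  have A: "0 \<le> A" using rho \<delta> by (simp add: A_def)
  define K where "K = max 1 (A powr (\<rho> - 1))"
  show ?thesis
  proof (rule that[of K])
    show "0 < K" by (simp add: K_def)
    fix x z :: "real ^ 'r" assume x: "norm x \<le> B" and z: "K \<le> norm z"
    have "A = (A powr (\<rho> - 1)) powr (s - 1)"
      using rho A by (simp add: powr_powr field_simps)
    also have "\<dots> \<le> norm z powr (s - 1)"
      using z s_gt_1 by (intro powr_mono2) (auto simp: K_def)
    finally have "\<delta> * A \<le> \<delta> * norm z powr (s - 1)" using \<delta> by (intro mult_left_mono) auto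
    then have "norm z * (\<rho> * \<bar>B\<bar> + 1) \<le> norm z * (\<delta> * norm z powr (s - 1))"
      using \<delta> by (intro mult_left_mono) (auto simp: A_def)
    also have "\<dots> = \<delta> * norm z powr s"
      using powr_mult_base[of "norm z" "s - 1"] by (simp add: mult_ac)
    finally have 1: "mean_value z \<le> - (norm z * (\<rho> * \<bar>B\<bar> + 1))" using \<delta>(2)[of z] by simp
    have "z \<bullet> x \<le> norm z * norm x" by (rule norm_cauchy_schwarz)
    also have "\<dots> \<le> norm z * \<bar>B\<bar>" using x by (intro mult_left_mono) auto
    finally have "\<rho> * (z \<bullet> x) \<le> \<rho> * (norm z * \<bar>B\<bar>)" using rho by (intro mult_left_mono) auto
    then have "dual_objective x z \<le> - norm z"
      using 1 by (simp add: dual_objective_def algebra_simps)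
    then show "dual_objective x z \<le> -1" using z by (simp add: K_def)
  qed
qed

section \<open>Attainment and continuity of the dual value\<close>

lemma dual_objective_0 [simp]: "dual_objective x 0 = 0"
  by (simp add: dual_objective_def)

lemma continuous_dual_objective: "continuous_on UNIV (dual_objective x)"
  unfolding dual_objective_def[abs_def] by (intro continuous_intros continuous_mean_value)

lemma dual_objective_attained: "\<exists>z. \<forall>z'. dual_objective x z' \<le> dual_objective x z"
proof -
  obtain K where K: "0 < K" "\<And>x' z. norm x' \<le> norm x \<Longrightarrow> K \<le> norm z \<Longrightarrow> dual_objective x' z \<le> -1"
    by (rule dual_objective_coercive[of "norm x"], rule that)
  have "cball (0::real ^ 'r) K \<noteq> {}" using K by simp
  then obtain z where "\<forall>z'\<in>cball 0 K. dual_objective x z' \<le> dual_objective x z"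
    using continuous_attains_sup[OF compact_cball _ continuous_on_subset[OF continuous_dual_objective], of 0 K]
    by blast
  then have z: "dual_objective x z' \<le> dual_objective x z" if "norm z' \<le> K" for z'
    using that by simp
  have "dual_objective x z' \<le> dual_objective x z" for z'
  proof (cases "norm z' \<le> K")
    case False
    then have "dual_objective x z' \<le> -1" using K(2)[of x z'] by simp
    moreover have "0 \<le> dual_objective x z" using z[of 0] K by simp
    ultimately show ?thesis by linarith
  qed (rule z)
  then show ?thesis by blast
qed

lemma dual_value_attained: "\<exists>z. dual_value x = dual_objective x z"
proof -
  obtain z where z: "\<And>z'. dual_objective x z' \<le> dual_objective x z"
    using dual_objective_attained by blast
  then have "dual_value x = dual_objective x z"
    unfolding dual_value_def by (intro cSup_eq_maximum) auto
  then show ?thesis by blast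
qed

lemma dual_objective_le_value: "dual_objective x z \<le> dual_value x"
proof -
  obtain z0 where z0: "\<And>z'. dual_objective x z' \<le> dual_objective x z0"
    using dual_objective_attained by blast
  show ?thesis
    unfolding dual_value_def by (rule cSUP_upper[OF UNIV_I bdd_aboveI2[OF z0]])
qed

lemma dual_value_nonneg: "0 \<le> dual_value x"
  using dual_objective_le_value[of x 0] by simp

lemma continuous_dual_value: "continuous_on UNIV dual_value"
proof (rule convex_on_continuous)
  show "convex_on UNIV dual_value"
  proof (rule convex_onI)
    fix t :: real and x y :: "real ^ 'r" assume t: "0 < t" "t < 1"
    obtain z where z: "dual_value ((1 - t) *\<^sub>R x + t *\<^sub>R y) = dual_objective ((1 - t) *\<^sub>R x + t *\<^sub>R y) z"
      using dual_value_attained by blast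
    also have "\<dots> = (1 - t) * dual_objective x z + t * dual_objective y z"
      by (simp add: dual_objective_def inner_add_right algebra_simps)
    also have "\<dots> \<le> (1 - t) * dual_value x + t * dual_value y"
      using t by (intro add_mono mult_left_mono dual_objective_le_value) auto
    finally show "dual_value ((1 - t) *\<^sub>R x + t *\<^sub>R y) \<le> (1 - t) * dual_value x + t * dual_value y" .
  qed simp
qed simp

text \<open>The witness picks the best of the first \<open>k\<close> vectors of a dense sequence.\<close>

lemma near_optimal_displacement:
  assumes e: "0 < e"
  obtains \<delta> K where "\<delta> \<in> borel_measurable borel" "\<And>w. norm (\<delta> w) \<le> K"
    "expectation (\<lambda>\<omega>. lp_norm q (\<delta> (W 0 \<omega>)) powr \<rho> + \<rho> * (z \<bullet> (D (W 0 \<omega>) *v \<delta> (W 0 \<omega>)))) < mean_value z + e"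
proof -
  define val where "val w d = lp_norm q d powr \<rho> + \<rho> * (z \<bullet> (D w *v d))" for w d
  obtain S :: "(real ^ 'm) set" where S: "countable S" "\<And>X. open X \<Longrightarrow> X \<noteq> {} \<Longrightarrow> \<exists>d\<in>S. d \<in> X"
    by (rule countable_dense_setE, rule that)
  have "S \<noteq> {}" using S(2)[of UNIV] by auto
  define enum where "enum = from_nat_into S"
  have enum: "range enum = S" unfolding enum_def using range_from_nat_into[OF \<open>S \<noteq> {}\<close> S(1)] .
  \<comment> \<open>Starting from the zero displacement, the values begin at \<open>0\<close> and
    decrease towards \<open>local_value z w\<close>, whose modulus is therefore an integrable
    majorant. Each stage takes finitely many values and so is bounded.\<close>
  define \<delta> where "\<delta> = rec_nat (\<lambda>w. 0) (\<lambda>k \<delta> w. if val w (enum k) < val w (\<delta> w) then enum k else \<delta> w)"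
  have \<delta>_0: "\<delta> 0 w = 0" and \<delta>_Suc: "\<delta> (Suc k) w = (if val w (enum k) < val w (\<delta> k w) then enum k else \<delta> k w)" for k w
    by (simp_all add: \<delta>_def)
  have val_Suc: "val w (\<delta> (Suc k) w) = min (val w (enum k)) (val w (\<delta> k w))" for k w
    by (simp add: \<delta>_Suc min_def)
  have val_0: "val w (\<delta> 0 w) = 0" for w
    using q rho by (simp add: val_def \<delta>_0)
  have val_cont: "continuous_on UNIV (\<lambda>w. val w d)" for d
    unfolding val_def by (intro continuous_intros continuous_matrix_vector)
  have val_meas[measurable]: "(\<lambda>w. val w (\<delta> k w)) \<in> borel_measurable borel" for k
  proof (induction k)
    case (Suc k)
    have "(\<lambda>w. val w (enum k)) \<in> borel_measurable borel"
      by (rule borel_measurable_continuous_onI[OF val_cont])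
    then show ?case unfolding val_Suc using Suc by measurable
  qed (simp add: val_0)
  have \<delta>_meas: "\<delta> k \<in> borel_measurable borel" for k
  proof (induction k)
    case (Suc k)
    have [measurable]: "(\<lambda>w. val w (enum k)) \<in> borel_measurable borel"
      by (rule borel_measurable_continuous_onI[OF val_cont])
    have "\<delta> (Suc k) = (\<lambda>w. if val w (enum k) < val w (\<delta> k w) then enum k else \<delta> k w)"
      by (rule ext) (rule \<delta>_Suc)
    then show ?case using Suc by (simp add: measurable_If)
  qed (simp add: \<delta>_0[abs_def])
  have \<delta>_bound: "\<exists>K. \<forall>w. norm (\<delta> k w) \<le> K" for k
  proof (induction k)
    case (Suc k)
    then obtain K where "\<And>w. norm (\<delta> k w) \<le> K" by blast
    then have "norm (\<delta> (Suc k) w) \<le> max K (norm (enum k))" for w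
      by (auto simp: \<delta>_Suc le_max_iff_disj)
    then show ?case by blast
  qed (auto simp: \<delta>_0)
  have val_ge: "local_value z w \<le> val w d" for w d
    unfolding val_def by (rule local_value_le)
  have val_decr: "val w (\<delta> (k + j) w) \<le> val w (\<delta> k w)" for w k j
    by (induction j) (auto simp: val_Suc min_def)
  have lim: "(\<lambda>k. val w (\<delta> k w)) \<longlonglongrightarrow> local_value z w" for w
  proof (rule LIMSEQ_I)
    fix r :: real assume "0 < r"
    obtain d0 where d0: "val w d0 \<le> local_value z w"
      using local_value_attained[of z w] unfolding val_def by blast
    have "continuous_on UNIV (val w)"
      unfolding val_def[abs_def] using q rho
      by (intro continuous_intros continuous_on_powr' continuous_on_lp_norm matrix_vector_mult_linear_continuous_on) auto
    then have "open {d. val w d < local_value z w + r}"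
      by (intro open_Collect_less continuous_intros)
    moreover have "d0 \<in> {d. val w d < local_value z w + r}" using d0 \<open>0 < r\<close> by simp
    ultimately obtain d where "d \<in> S" "val w d < local_value z w + r"
      using S(2)[of "{d. val w d < local_value z w + r}"] by blast
    then obtain j where j: "val w (enum j) < local_value z w + r" using enum by blast
    show "\<exists>k0. \<forall>k\<ge>k0. norm (val w (\<delta> k w) - local_value z w) < r"
    proof (intro exI allI impI)
      fix k assume "Suc j \<le> k"
      then have "val w (\<delta> k w) \<le> val w (\<delta> (Suc j) w)"
        using val_decr[of w "Suc j" "k - Suc j"] by simp
      also have "\<dots> < local_value z w + r" using j by (simp add: val_Suc)
      finally show "norm (val w (\<delta> k w) - local_value z w) < r" using val_ge[of w "\<delta> k w"] by simp
    qed
  qed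
  have "(\<lambda>k. expectation (\<lambda>\<omega>. val (W 0 \<omega>) (\<delta> k (W 0 \<omega>)))) \<longlonglongrightarrow> mean_value z"
    unfolding mean_value_def
  proof (rule integral_dominated_convergence)
    show "integrable M (\<lambda>\<omega>. \<bar>local_value z (W 0 \<omega>)\<bar>)" using integrable_local_value by simp
    show "AE \<omega> in M. (\<lambda>k. val (W 0 \<omega>) (\<delta> k (W 0 \<omega>))) \<longlonglongrightarrow> local_value z (W 0 \<omega>)"
      using lim by simp
    show "AE \<omega> in M. norm (val (W 0 \<omega>) (\<delta> k (W 0 \<omega>))) \<le> \<bar>local_value z (W 0 \<omega>)\<bar>" for k
    proof (rule AE_I2)
      fix \<omega>
      show "norm (val (W 0 \<omega>) (\<delta> k (W 0 \<omega>))) \<le> \<bar>local_value z (W 0 \<omega>)\<bar>"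
        using val_ge[of "W 0 \<omega>" "\<delta> k (W 0 \<omega>)"] val_decr[of "W 0 \<omega>" 0 k] by (simp add: val_0)
    qed
    show "(\<lambda>\<omega>. val (W 0 \<omega>) (\<delta> k (W 0 \<omega>))) \<in> borel_measurable M" for k
      by (rule measurable_compose[OF W_measurable val_meas])
  qed measurable
  then have "\<forall>\<^sub>F k in sequentially. expectation (\<lambda>\<omega>. val (W 0 \<omega>) (\<delta> k (W 0 \<omega>))) < mean_value z + e"
    using e by (intro order_tendstoD(2)) auto
  then obtain k where "expectation (\<lambda>\<omega>. val (W 0 \<omega>) (\<delta> k (W 0 \<omega>))) < mean_value z + e"
    by (auto simp: eventually_sequentially)
  moreover obtain K where "\<And>w. norm (\<delta> k w) \<le> K" using \<delta>_bound by blast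
  ultimately show ?thesis using that \<delta>_meas unfolding val_def by blast
qed

end

section \<open>The scaled profile\<close>

locale sampled_profile = sampled_moment M W f D p q \<rho> C
  for M :: "'a measure" and W :: "nat \<Rightarrow> 'a \<Rightarrow> real ^ 'm"
    and f :: "real ^ 'm \<Rightarrow> real ^ 'r" and D :: "real ^ 'm \<Rightarrow> real ^ 'm ^ 'r"
    and p q :: ennreal and \<rho> C :: real +
  fixes h :: "real ^ 'm \<Rightarrow> 't \<Rightarrow> real ^ 'r" and \<theta> :: 't
  assumes h_eq: "\<And>w. h w \<theta> = f w"
begin

definition normalized_sum :: "nat \<Rightarrow> 'a \<Rightarrow> real ^ 'r" where
  "normalized_sum n \<omega> = (1 / sqrt (real n)) *\<^sub>R (\<Sum>i=1..n. f (W i \<omega>))"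

definition profile :: "nat \<Rightarrow> 'a \<Rightarrow> ennreal" where
  "profile n \<omega> = profile_function (\<lambda>u w. lp_norm q (u - w) powr \<rho>) h n (\<lambda>i. W i \<omega>) \<theta>"

definition scaled_profile :: "nat \<Rightarrow> 'a \<Rightarrow> real" where
  "scaled_profile n \<omega> = real n powr (\<rho> / 2) * enn2real (profile n \<omega>)"

lemma borel_measurable_h: "(\<lambda>w. h w \<theta>) \<in> borel_measurable borel"
  by (simp add: h_eq)

lemma integrable_f: "integrable M (\<lambda>\<omega>. f (W i \<omega>))"
proof -
  have "integrable M (\<lambda>\<omega>. norm (f (W 0 \<omega>)))"
    by (rule square_integrable_imp_integrable[OF _ square]) measurable
  then have "integrable M (\<lambda>\<omega>. f (W 0 \<omega>))" by (rule integrable_norm_cancel) measurable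
  then show ?thesis by (subst integrable_iid_iff) auto
qed

lemma integrable_lp_cost: "integrable M (\<lambda>\<omega>. lp_norm q (W 0 \<omega> - v) powr \<rho>)"
proof -
  obtain C' where C': "\<And>u. lp_norm q (u - v) powr \<rho> \<le> C' * (1 + lp_norm q (u - 0) powr \<rho>)"
    using lp_cost_growth[OF q, of \<rho> "dist 0 v"] rho by (metis less_trans order_refl zero_less_one)
  define m where "m = real CARD('m)"
  have le: "lp_norm q (u - v) powr \<rho> \<le> \<bar>C'\<bar> * (1 + (m powr \<rho>) * norm u powr \<rho>)" for u
  proof -
    have "lp_norm q u powr \<rho> \<le> (m * norm u) powr \<rho>"
      using lp_norm_le_norm[OF q, of u] rho unfolding m_def by (intro powr_mono2) auto
    then have "1 + lp_norm q u powr \<rho> \<le> 1 + (m powr \<rho>) * norm u powr \<rho>"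
      by (simp add: powr_mult m_def)
    then have "\<bar>C'\<bar> * (1 + lp_norm q u powr \<rho>) \<le> \<bar>C'\<bar> * (1 + (m powr \<rho>) * norm u powr \<rho>)"
      by (intro mult_left_mono) auto
    moreover have "C' * (1 + lp_norm q u powr \<rho>) \<le> \<bar>C'\<bar> * (1 + lp_norm q u powr \<rho>)"
      by (intro mult_right_mono) auto
    ultimately show ?thesis using C'[of u] by simp
  qed
  note borel_measurable_lp_norm[OF q, measurable]
  have "integrable M (\<lambda>\<omega>. \<bar>C'\<bar> * (1 + (m powr \<rho>) * norm (W 0 \<omega>) powr \<rho>))"
    using moment by simp
  then show ?thesis
    by (rule Bochner_Integration.integrable_bound)
       (use le in \<open>auto intro!: AE_I2 order_trans[OF _ abs_ge_self]\<close>)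
qed

text \<open>The law of \<open>W\<close> itself has zero moment, and its expected cost to any given
  point is finite by the moment assumption.\<close>

lemma profile_finite:
  assumes n: "1 \<le> n"
  shows "profile n \<omega> < \<infinity>"
proof -
  note borel_measurable_lp_norm[OF q, measurable]
  let ?\<mu> = "\<lambda>i::nat. distr M borel (W 0)"
  have "feasible_family (\<lambda>w. h w \<theta>) n ?\<mu>"
    unfolding feasible_family_def h_eq using integrable_f mean_zero
    by (auto simp: integrable_distr_eq integral_distr intro!: prob_space_distr)
  then have "profile n \<omega> \<le> ennreal (1 / real n) * (\<Sum>i=1..n. \<integral>\<^sup>+u. ennreal (lp_norm q (u - W i \<omega>) powr \<rho>) \<partial>?\<mu> i)"
    unfolding profile_def by (intro profile_function_le_family n lp_cost_measurable q borel_measurable_h)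
  also have "\<dots> < \<infinity>"
  proof -
    have "(\<integral>\<^sup>+u. ennreal (lp_norm q (u - v) powr \<rho>) \<partial>distr M borel (W 0)) < \<top>" for v
      using integrable_lp_cost[of v] by (subst nn_integral_distr) (auto simp: integrable_iff_bounded)
    then show ?thesis by (simp add: ennreal_mult_less_top)
  qed
  finally show ?thesis .
qed

lemma scaled_profile_measurable: "scaled_profile n \<in> borel_measurable M"
proof (cases "n = 0")
  \<comment> \<open>\<open>0 powr (\<rho> / 2) = 0\<close> turns the index \<open>0\<close> into the
    zero function.\<close>
  case True
  then show ?thesis by (simp add: scaled_profile_def[abs_def])
next
  case False
  have "profile n \<in> borel_measurable M"
    unfolding profile_def[abs_def] using False q rho
    by (intro profile_function_measurable borel_measurable_h) auto
  then show ?thesis unfolding scaled_profile_def[abs_def] by measurable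
qed

lemma normalized_sum_measurable [measurable]: "normalized_sum n \<in> borel_measurable M"
  unfolding normalized_sum_def[abs_def] by measurable

lemma root_scaling:
  assumes "1 \<le> n" "t = 1 / sqrt (real n)"
  shows "real n powr (\<rho> / 2) * t powr \<rho> = 1" "0 < t" "(1 / real n) * (1 / t) = 1 / sqrt (real n)"
proof -
  have "sqrt (real n) / real n = 1 / sqrt (real n)"
    using assms(1) by (subst frac_eq_eq) auto
  then show "(1 / real n) * (1 / t) = 1 / sqrt (real n)"
    using assms by simp
  have "t = real n powr (- (1 / 2))"
    using assms by (simp add: powr_minus_divide powr_half_sqrt)
  then show "real n powr (\<rho> / 2) * t powr \<rho> = 1"
    using assms by (simp add: powr_powr flip: powr_add)
qed (use assms in auto)

text \<open>Substituting \<open>u = w + t *\<^sub>R d\<close> turns the pointwise hypothesis of weak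
  duality into a bound for \<open>perturbed_cost\<close>; \<open>n powr (\<rho> / 2)\<close> cancels
  \<open>t powr \<rho>\<close>, and the moments at the samples form the linear term.\<close>

lemma scaled_profile_ge:
  assumes n: "1 \<le> n" and t: "t = 1 / sqrt (real n)"
    and gap: "\<And>w d. local_value z w - gap w \<le> perturbed_cost z t w d"
  shows "\<rho> * (z \<bullet> normalized_sum n \<omega>) + (1 / real n) * (\<Sum>i=1..n. local_value z (W i \<omega>) - gap (W i \<omega>))
    \<le> scaled_profile n \<omega>"
proof -
  note sc = root_scaling[OF n t]
  \<comment> \<open>This is \<open>\<rho> * t powr (\<rho> - 1)\<close>, the scale of the multiplier
    at which cost and moment change both carry the factor \<open>t powr \<rho>\<close>.\<close>
  define l where "l = \<rho> * (t powr \<rho> / t)"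
  define k where "k i = t powr \<rho> * (local_value z (W i \<omega>) - gap (W i \<omega>)) + l * (z \<bullet> f (W i \<omega>))" for i
  have "k i \<le> lp_norm q (u - W i \<omega>) powr \<rho> + (l *\<^sub>R z) \<bullet> h u \<theta>" for i u
  proof -
    define d where "d = (1 / t) *\<^sub>R (u - W i \<omega>)"
    have td: "t *\<^sub>R d = u - W i \<omega>" using sc(2) by (simp add: d_def)
    then have lp: "t powr \<rho> * lp_norm q d powr \<rho> = lp_norm q (u - W i \<omega>) powr \<rho>"
      using sc(2) lp_norm_scaleR[OF q, of t d] by (simp add: powr_mult)
    have "t powr \<rho> * (local_value z (W i \<omega>) - gap (W i \<omega>)) \<le> t powr \<rho> * perturbed_cost z t (W i \<omega>) d"
      by (intro mult_left_mono gap) simp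
    also have "\<dots> = lp_norm q (u - W i \<omega>) powr \<rho> + l * (z \<bullet> (f u - f (W i \<omega>)))"
      by (simp add: perturbed_cost_def td distrib_left lp l_def)
    finally show ?thesis by (simp add: k_def h_eq inner_diff_right right_diff_distrib)
  qed
  then have "ennreal ((1 / real n) * (\<Sum>i=1..n. k i)) \<le> profile n \<omega>"
    unfolding profile_def
    by (intro profile_function_weak_duality[where H=h and \<theta>=\<theta> and l="l *\<^sub>R z"] n lp_cost_measurable q borel_measurable_h) auto
  then have "enn2real (ennreal ((1 / real n) * (\<Sum>i=1..n. k i))) \<le> enn2real (profile n \<omega>)"
    using profile_finite[OF n, of \<omega>] by (intro enn2real_mono) auto
  \<comment> \<open>Conversion through \<open>ennreal\<close> truncates at zero, which can only
    raise a lower bound.\<close>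
  moreover have "r \<le> enn2real (ennreal r)" for r
    by (cases "0 \<le> r") (auto simp: ennreal_neg)
  ultimately have "(1 / real n) * (\<Sum>i=1..n. k i) \<le> enn2real (profile n \<omega>)"
    by (rule order_trans[rotated])
  then have "real n powr (\<rho> / 2) * ((1 / real n) * (\<Sum>i=1..n. k i)) \<le> scaled_profile n \<omega>"
    unfolding scaled_profile_def by (intro mult_left_mono) auto
  moreover have "real n powr (\<rho> / 2) * ((1 / real n) * (\<Sum>i=1..n. k i)) =
      (real n powr (\<rho> / 2) * t powr \<rho>) * (\<rho> * ((1 / real n) * (1 / t)) * (\<Sum>i=1..n. z \<bullet> f (W i \<omega>))
       + (1 / real n) * (\<Sum>i=1..n. local_value z (W i \<omega>) - gap (W i \<omega>)))"
  proof -
    have sum_k: "(\<Sum>i=1..n. k i) = t powr \<rho> * (\<Sum>i=1..n. local_value z (W i \<omega>) - gap (W i \<omega>)) + l * (\<Sum>i=1..n. z \<bullet> f (W i \<omega>))"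
      unfolding k_def sum.distrib sum_distrib_left ..
    have "N * ((1 / m) * (T * A + \<rho> * (T / t) * B)) = (N * T) * (\<rho> * ((1 / m) * (1 / t)) * B + (1 / m) * A)" for N m T A B :: real
      by (simp add: algebra_simps add_divide_distrib)
    then show ?thesis unfolding sum_k l_def .
  qed
  moreover note sc(3)
  ultimately show ?thesis
    by (simp only: sc(1) normalized_sum_def inner_sum_right inner_scaleR_right mult_1_left mult.assoc)
qed

text \<open>Since the mixing weights are shared by all samples, the moment condition and the cost
  involve each displacement field only through its sample average; this leaves a linear program with
  one variable per field.\<close>

lemma scaled_profile_le:
  fixes \<delta> :: "'j \<Rightarrow> real ^ 'm \<Rightarrow> real ^ 'm"
  assumes n: "1 \<le> n" and t: "t = 1 / sqrt (real n)" and J: "finite J" and v: "0 \<le> v"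
    and dual: "\<And>z. \<exists>j\<in>J. (1 / real n) * (\<Sum>i=1..n. lp_norm q (\<delta> j (W i \<omega>)) powr \<rho>) +
      \<rho> * (z \<bullet> (normalized_sum n \<omega> + (1 / real n) *\<^sub>R
        (\<Sum>i=1..n. (1 / t) *\<^sub>R (f (W i \<omega> + t *\<^sub>R \<delta> j (W i \<omega>)) - f (W i \<omega>))))) \<le> v"
  shows "scaled_profile n \<omega> \<le> v"
proof -
  note sc = root_scaling[OF n t]
  define a where "a j = (1 / real n) * (\<Sum>i=1..n. lp_norm q (\<delta> j (W i \<omega>)) powr \<rho>)" for j
  define y where "y j = normalized_sum n \<omega> + (1 / real n) *\<^sub>R
        (\<Sum>i=1..n. (1 / t) *\<^sub>R (f (W i \<omega> + t *\<^sub>R \<delta> j (W i \<omega>)) - f (W i \<omega>)))" for j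
  \<comment> \<open>The moments at the original samples cancel, leaving the normalized sum at the
    moved points.\<close>
  have y_eq: "y j = (1 / sqrt (real n)) *\<^sub>R (\<Sum>i=1..n. f (W i \<omega> + t *\<^sub>R \<delta> j (W i \<omega>)))" for j
    by (simp add: y_def normalized_sum_def scaleR_sum_right[symmetric] sc(3) sum_subtractf
        scaleR_right_diff_distrib del: times_divide_eq_left times_divide_eq_right)
  \<comment> \<open>Evaluating \<open>dual\<close> at \<open>z / \<rho>\<close> absorbs its factor
    \<open>\<rho>\<close>.\<close>
  have "\<exists>j\<in>J. a j + z \<bullet> y j \<le> v" for z
    using dual[of "(1 / \<rho>) *\<^sub>R z"] rho by (simp add: a_def y_def)
  then obtain \<tau> where \<tau>: "\<And>j. j \<in> J \<Longrightarrow> 0 \<le> \<tau> j" "(\<Sum>j\<in>J. \<tau> j) = 1"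
    "(\<Sum>j\<in>J. \<tau> j *\<^sub>R y j) = 0" "(\<Sum>j\<in>J. \<tau> j * a j) \<le> v"
    using finite_linear_duality[OF J, of a y v] by blast
  let ?z = "\<lambda>i j. W i \<omega> + t *\<^sub>R \<delta> j (W i \<omega>)"
  have zero: "(\<Sum>i=1..n. \<Sum>j\<in>J. \<tau> j *\<^sub>R h (?z i j) \<theta>) = 0"
  proof -
    have "(\<Sum>i=1..n. \<Sum>j\<in>J. \<tau> j *\<^sub>R h (?z i j) \<theta>) = (\<Sum>j\<in>J. \<tau> j *\<^sub>R (\<Sum>i=1..n. f (?z i j)))"
      unfolding h_eq scaleR_sum_right by (rule sum.swap)
    also have "\<dots> = sqrt (real n) *\<^sub>R (\<Sum>j\<in>J. \<tau> j *\<^sub>R y j)"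
      unfolding y_eq scaleR_sum_right[of "sqrt (real n)"] scaleR_scaleR
      using n by (intro sum.cong refl) simp
    finally show ?thesis by (simp add: \<tau>)
  qed
  have "profile n \<omega> \<le> ennreal ((1 / real n) * (\<Sum>i=1..n. \<Sum>j\<in>J. \<tau> j * lp_norm q (?z i j - W i \<omega>) powr \<rho>))"
    unfolding profile_def
    by (rule profile_function_le_mixture[where H=h and \<theta>=\<theta>, OF n lp_cost_measurable[OF q] _ borel_measurable_h J \<tau>(1,2) zero]) simp
  also have "(\<Sum>i=1..n. \<Sum>j\<in>J. \<tau> j * lp_norm q (?z i j - W i \<omega>) powr \<rho>) =
      t powr \<rho> * (\<Sum>j\<in>J. \<tau> j * (\<Sum>i=1..n. lp_norm q (\<delta> j (W i \<omega>)) powr \<rho>))"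
    using sc(2) by (subst sum.swap) (simp add: lp_norm_scaleR[OF q] powr_mult sum_distrib_left mult_ac)
  also have "(1 / real n) * \<dots> = t powr \<rho> * (\<Sum>j\<in>J. \<tau> j * a j)"
  proof -
    have "r * (r' * (\<Sum>j\<in>J. \<tau> j * S j)) = r' * (\<Sum>j\<in>J. \<tau> j * (r * S j))" for r r' and S :: "'j \<Rightarrow> real"
      by (simp add: sum_distrib_left mult_ac)
    then show ?thesis unfolding a_def .
  qed
  also have "ennreal \<dots> \<le> ennreal (t powr \<rho> * v)"
    using \<tau>(4) by (intro ennreal_leI mult_left_mono) auto
  finally have "enn2real (profile n \<omega>) \<le> t powr \<rho> * v"
    using v by (intro enn2real_leI) auto
  then have "scaled_profile n \<omega> \<le> real n powr (\<rho> / 2) * (t powr \<rho> * v)"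
    unfolding scaled_profile_def by (intro mult_left_mono) auto
  also have "\<dots> = v" using sc(1) by (simp flip: mult.assoc)
  finally show ?thesis .
qed

text \<open>The maximum keeps the value positive at \<open>n = 0\<close>.\<close>

definition step :: "nat \<Rightarrow> real" where
  "step n = 1 / sqrt (real (max 1 n))"

lemma step_pos: "0 < step n" and step_le_1: "step n \<le> 1"
  by (auto simp: step_def)

lemma step_eq: "1 \<le> n \<Longrightarrow> step n = 1 / sqrt (real n)"
  by (simp add: step_def max_def)

lemma step_tendsto: "step \<longlonglongrightarrow> 0"
proof -
  have "(\<lambda>n. 1 / sqrt (real n)) \<longlonglongrightarrow> 0"
    using tendsto_real_sqrt[OF lim_1_over_n[where 'a=real]] by (simp add: real_sqrt_divide)
  then show ?thesis
    by (rule Lim_transform_eventually) (auto simp: step_eq intro!: eventually_sequentiallyI[of 1])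
qed

section \<open>Lower bound for a single multiplier\<close>

lemma high_probability_ge_objective:
  assumes e: "0 < e"
  shows "high_probability M (\<lambda>n \<omega>. dual_objective (normalized_sum n \<omega>) z - e \<le> scaled_profile n \<omega>)"
proof -
  obtain E t0 where E: "0 \<le> E" "0 < t0"
    and gap: "\<And>t w. 0 < t \<Longrightarrow> t \<le> t0 \<Longrightarrow> 0 \<le> duality_gap z t w \<and> duality_gap z t w \<le> E * (1 + norm w powr \<rho>)"
    and dual: "\<And>t w d. 0 < t \<Longrightarrow> t \<le> t0 \<Longrightarrow> local_value z w - duality_gap z t w \<le> perturbed_cost z t w d"
    and meas: "\<And>t. 0 < t \<Longrightarrow> t \<le> t0 \<Longrightarrow> duality_gap z t \<in> borel_measurable borel"
    by (rule duality_gap_properties[of z], rule that)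
  obtain K where K: "0 \<le> K" "\<And>z w. \<bar>local_value z w\<bar> \<le> K * norm z powr s * (1 + norm w powr \<rho>)"
    by (rule local_value_bound, rule that)
  \<comment> \<open>The gap is controlled only for steps up to \<open>t0\<close>. Setting it to zero
    for the finitely many larger steps keeps one majorant valid for all \<open>n\<close>.\<close>
  define g where "g n w = local_value z w - (if step n \<le> t0 then duality_gap z (step n) w else 0)" for n w
  have small: "\<forall>\<^sub>F n in sequentially. step n \<le> t0"
    using order_tendstoD(2)[OF step_tendsto E(2)] by eventually_elim simp
  have "high_probability M (\<lambda>n \<omega>. \<bar>(1 / real n) * (\<Sum>i=1..n. g n (W i \<omega>)) - expectation (\<lambda>\<omega>. local_value z (W 0 \<omega>))\<bar> < e)"
  proof (rule high_probability_average_sequence[OF _ _ _ _ _ e])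
    show "g n \<in> borel_measurable borel" for n
    proof (cases "step n \<le> t0")
      case True
      note meas[OF step_pos True, measurable]
      show ?thesis unfolding g_def[abs_def] using True by simp
    next
      case False
      then show ?thesis unfolding g_def[abs_def] by simp
    qed
    let ?G = "\<lambda>w. (K * norm z powr s + E) * (1 + norm w powr \<rho>)"
    show "?G \<in> borel_measurable borel" by measurable
    show "integrable M (\<lambda>\<omega>. ?G (W 0 \<omega>))" by (rule integrable_envelope)
    show "\<bar>g n w\<bar> \<le> ?G w" for n w
    proof -
      have "\<bar>if step n \<le> t0 then duality_gap z (step n) w else 0\<bar> \<le> E * (1 + norm w powr \<rho>)"
        using gap[OF step_pos, of n w] E by auto
      then show ?thesis using K(2)[of z w] unfolding g_def distrib_right by linarith
    qed
    show "(\<lambda>n. g n w) \<longlonglongrightarrow> local_value z w" for w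
    proof -
      have "(\<lambda>n. local_value z w - duality_gap z (step n) w) \<longlonglongrightarrow> local_value z w - 0"
        by (intro tendsto_intros duality_gap_tendsto step_tendsto step_pos)
      then have "(\<lambda>n. local_value z w - duality_gap z (step n) w) \<longlonglongrightarrow> local_value z w" by simp
      then show ?thesis
        by (rule Lim_transform_eventually)
           (use small in \<open>auto simp: g_def elim: eventually_mono\<close>)
    qed
  qed
  then show ?thesis
  proof (rule high_probability_mono)
    show "\<forall>\<^sub>F n in sequentially. \<forall>\<omega>\<in>space M.
      \<bar>(1 / real n) * (\<Sum>i=1..n. g n (W i \<omega>)) - expectation (\<lambda>\<omega>. local_value z (W 0 \<omega>))\<bar> < e \<longrightarrow>
      dual_objective (normalized_sum n \<omega>) z - e \<le> scaled_profile n \<omega>"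
      using small eventually_ge_at_top[of 1]
    proof eventually_elim
      case (elim n)
      have "\<rho> * (z \<bullet> normalized_sum n \<omega>) + (1 / real n) * (\<Sum>i=1..n. g n (W i \<omega>)) \<le> scaled_profile n \<omega>" for \<omega>
        using scaled_profile_ge[OF elim(2) step_eq[OF elim(2)], of z "duality_gap z (step n)" \<omega>]
          dual[OF step_pos elim(1)] elim(1) by (simp add: g_def)
      then show ?case
        unfolding dual_objective_def mean_value_def by (smt (verit))
    qed
  qed
qed

end

context iid_sequence
begin

lemma high_probability_average_sequence_vector:
  fixes g :: "nat \<Rightarrow> 'c \<Rightarrow> 'd::euclidean_space"
  assumes gn[measurable]: "\<And>n. g n \<in> borel_measurable borel"
    and G[measurable]: "G \<in> borel_measurable borel" and int: "integrable M (\<lambda>\<omega>. G (W 0 \<omega>))"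
    and bound: "\<And>n x. norm (g n x) \<le> G x"
    and lim: "\<And>x. (\<lambda>n. g n x) \<longlonglongrightarrow> g' x"
    and int': "integrable M (\<lambda>\<omega>. g' (W 0 \<omega>))"
    and e: "0 < e"
  shows "high_probability M (\<lambda>n \<omega>. norm ((1 / real n) *\<^sub>R (\<Sum>i=1..n. g n (W i \<omega>)) - expectation (\<lambda>\<omega>. g' (W 0 \<omega>))) < e)"
proof -
  have "0 < e / real DIM('d)" using e by simp
  then have "high_probability M (\<lambda>n \<omega>. \<forall>b\<in>(Basis :: 'd set). \<bar>(1 / real n) * (\<Sum>i=1..n. g n (W i \<omega>) \<bullet> b)
      - expectation (\<lambda>\<omega>. g' (W 0 \<omega>) \<bullet> b)\<bar> < e / real DIM('d))"
  proof (intro high_probability_finite_Ball finite_measure_axioms finite_Basis)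
    fix b :: 'd assume b: "b \<in> Basis"
    show "high_probability M (\<lambda>n \<omega>. \<bar>(1 / real n) * (\<Sum>i=1..n. g n (W i \<omega>) \<bullet> b)
        - expectation (\<lambda>\<omega>. g' (W 0 \<omega>) \<bullet> b)\<bar> < e / real DIM('d))"
    proof (rule high_probability_average_sequence[OF _ G int _ _ \<open>0 < e / real DIM('d)\<close>])
      show "\<bar>g n x \<bullet> b\<bar> \<le> G x" for n x
        using Basis_le_norm[OF b, of "g n x"] bound[of n x] by linarith
    qed (auto intro!: tendsto_intros lim)
  qed
  then show ?thesis
  proof (rule high_probability_mono, intro always_eventually allI ballI impI)
    fix n \<omega>
    let ?d = "(1 / real n) *\<^sub>R (\<Sum>i=1..n. g n (W i \<omega>)) - expectation (\<lambda>\<omega>. g' (W 0 \<omega>))"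
    assume *: "\<forall>b\<in>(Basis :: 'd set). \<bar>(1 / real n) * (\<Sum>i=1..n. g n (W i \<omega>) \<bullet> b)
      - expectation (\<lambda>\<omega>. g' (W 0 \<omega>) \<bullet> b)\<bar> < e / real DIM('d)"
    have "norm ?d \<le> (\<Sum>b\<in>Basis. \<bar>?d \<bullet> b\<bar>)" by (rule norm_le_l1)
    also have "\<dots> < (\<Sum>b\<in>(Basis :: 'd set). e / real DIM('d))"
    proof (rule sum_strict_mono)
      fix b :: 'd assume "b \<in> Basis"
      then show "\<bar>?d \<bullet> b\<bar> < e / real DIM('d)"
        using * int' by (simp add: inner_diff_left inner_sum_left)
    qed auto
    also have "\<dots> = e" by simp
    finally show "norm ?d < e" .
  qed
qed

end

section \<open>Upper bound by finitely many displacement fields\<close>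

context sampled_profile
begin

text \<open>A bounded field keeps the difference quotients below a function of order
  \<open>norm w powr (\<rho> - 1)\<close>, which the moment of order \<open>\<rho>\<close> makes
  integrable.\<close>

lemma
  assumes \<delta>[measurable]: "\<delta> \<in> borel_measurable borel" and K: "\<And>w. norm (\<delta> w) \<le> K"
  shows integrable_displacement_cost: "integrable M (\<lambda>\<omega>. lp_norm q (\<delta> (W i \<omega>)) powr \<rho>)"
    and integrable_displacement: "integrable M (\<lambda>\<omega>. D (W 0 \<omega>) *v \<delta> (W 0 \<omega>))"
    and high_probability_difference_quotient: "0 < e \<Longrightarrow> high_probability M (\<lambda>n \<omega>.
      norm ((1 / real n) *\<^sub>R (\<Sum>i=1..n. (1 / step n) *\<^sub>R (f (W i \<omega> + step n *\<^sub>R \<delta> (W i \<omega>)) - f (W i \<omega>)))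
        - expectation (\<lambda>\<omega>. D (W 0 \<omega>) *v \<delta> (W 0 \<omega>))) < e)"
proof -
  have "0 \<le> K" using K[of 0] norm_ge_zero[of "\<delta> 0"] by linarith
  note borel_measurable_lp_norm[OF q, measurable]
  define m where "m = real CARD('m)"
  show "integrable M (\<lambda>\<omega>. lp_norm q (\<delta> (W i \<omega>)) powr \<rho>)"
  proof (rule integrable_const_bound[where B="(m * K) powr \<rho>"])
    have "lp_norm q (\<delta> w) \<le> m * K" for w
      using lp_norm_le_norm[OF q, of "\<delta> w"] K[of w] unfolding m_def
      by (meson mult_left_mono of_nat_0_le_iff order_trans)
    then show "AE \<omega> in M. norm (lp_norm q (\<delta> (W i \<omega>)) powr \<rho>) \<le> (m * K) powr \<rho>"
      using rho by (auto intro!: AE_I2 powr_mono2)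
  qed measurable
  define g where "g n w = (1 / step n) *\<^sub>R (f (w + step n *\<^sub>R \<delta> w) - f w)" for n w
  have g_meas[measurable]: "g n \<in> borel_measurable borel" for n
    unfolding g_def by measurable
  have g_lim: "(\<lambda>n. g n w) \<longlonglongrightarrow> D w *v \<delta> w" for w
    unfolding g_def by (intro difference_quotient_tendsto step_tendsto step_pos)
  \<comment> \<open>Measurability of the product comes from its being a pointwise limit of the
    difference quotients.\<close>
  have lim_meas[measurable]: "(\<lambda>w. D w *v \<delta> w) \<in> borel_measurable borel"
    by (rule borel_measurable_LIMSEQ_metric[OF g_meas g_lim])
  let ?G = "\<lambda>w. C * (1 + (norm w + K) powr (\<rho> - 1)) * K"
  have g_bound: "norm (g n w) \<le> ?G w" for n w
    unfolding g_def by (rule difference_quotient_bound[OF step_pos step_le_1 K])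
  have G_int: "integrable M (\<lambda>\<omega>. ?G (W 0 \<omega>))"
  proof (rule Bochner_Integration.integrable_bound)
    show "integrable M (\<lambda>\<omega>. C * (1 + 2 powr (\<rho> - 1) * (1 + norm (W 0 \<omega>) powr \<rho> + K powr (\<rho> - 1))) * K)"
      using moment by simp
    have le: "?G w \<le> C * (1 + 2 powr (\<rho> - 1) * (1 + norm w powr \<rho> + K powr (\<rho> - 1))) * K" for w
    proof -
      have "(norm w + K) powr (\<rho> - 1) \<le> 2 powr (\<rho> - 1) * (norm w powr (\<rho> - 1) + K powr (\<rho> - 1))"
        using \<open>0 \<le> K\<close> rho by (intro powr_add_le) auto
      also have "\<dots> \<le> 2 powr (\<rho> - 1) * (1 + norm w powr \<rho> + K powr (\<rho> - 1))"
        using rho by (intro mult_left_mono add_right_mono powr_minus_1_le) auto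
      finally show ?thesis
        using C_nonneg \<open>0 \<le> K\<close> by (intro mult_right_mono mult_left_mono add_left_mono) auto
    qed
    have nn: "0 \<le> ?G w" for w using C_nonneg \<open>0 \<le> K\<close> by simp
    show "AE \<omega> in M. norm (?G (W 0 \<omega>)) \<le> norm (C * (1 + 2 powr (\<rho> - 1) * (1 + norm (W 0 \<omega>) powr \<rho> + K powr (\<rho> - 1))) * K)"
      unfolding real_norm_def abs_of_nonneg[OF nn] by (intro AE_I2 order_trans[OF le abs_ge_self])
  qed measurable
  show int: "integrable M (\<lambda>\<omega>. D (W 0 \<omega>) *v \<delta> (W 0 \<omega>))"
  proof (rule Bochner_Integration.integrable_bound[OF G_int])
    show "AE \<omega> in M. norm (D (W 0 \<omega>) *v \<delta> (W 0 \<omega>)) \<le> norm (?G (W 0 \<omega>))"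
    proof (rule AE_I2)
      fix \<omega>
      have "norm (D (W 0 \<omega>) *v \<delta> (W 0 \<omega>)) \<le> ?G (W 0 \<omega>)"
        by (rule Lim_bounded[OF tendsto_norm[OF g_lim]]) (use g_bound in auto)
      then show "norm (D (W 0 \<omega>) *v \<delta> (W 0 \<omega>)) \<le> norm (?G (W 0 \<omega>))" by simp
    qed
  qed measurable
  show "high_probability M (\<lambda>n \<omega>.
      norm ((1 / real n) *\<^sub>R (\<Sum>i=1..n. (1 / step n) *\<^sub>R (f (W i \<omega> + step n *\<^sub>R \<delta> (W i \<omega>)) - f (W i \<omega>)))
        - expectation (\<lambda>\<omega>. D (W 0 \<omega>) *v \<delta> (W 0 \<omega>))) < e)" if "0 < e"
    using high_probability_average_sequence_vector[OF g_meas _ G_int g_bound g_lim int that]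
    by (simp add: g_def)
qed

text \<open>For a fixed field both sides are continuous in the multiplier, so a field that is nearly
  optimal at \<open>z\<close> remains so on an open neighbourhood.\<close>

lemma finite_near_optimal_displacements:
  assumes e: "0 < e"
  obtains J \<delta> where "finite J" "\<And>z. z \<in> J \<Longrightarrow> \<delta> z \<in> borel_measurable borel" "\<And>z. z \<in> J \<Longrightarrow> \<exists>K. \<forall>w. norm (\<delta> z w) \<le> K"
    "\<And>z'. norm z' \<le> B \<Longrightarrow> \<exists>z\<in>(J :: (real ^ 'r) set). expectation (\<lambda>\<omega>. lp_norm q (\<delta> z (W 0 \<omega>)) powr \<rho>)
      + \<rho> * (z' \<bullet> expectation (\<lambda>\<omega>. D (W 0 \<omega>) *v \<delta> z (W 0 \<omega>))) < mean_value z' + e"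
proof -
  define P where "P z \<delta> \<longleftrightarrow> \<delta> \<in> borel_measurable borel \<and> (\<exists>K. \<forall>w. norm (\<delta> w) \<le> K) \<and>
    expectation (\<lambda>\<omega>. lp_norm q (\<delta> (W 0 \<omega>)) powr \<rho> + \<rho> * (z \<bullet> (D (W 0 \<omega>) *v \<delta> (W 0 \<omega>)))) < mean_value z + e" for z \<delta>
  have "\<exists>\<delta>. P z \<delta>" for z
  proof -
    obtain \<delta> K where "\<delta> \<in> borel_measurable borel" "\<And>w. norm (\<delta> w) \<le> K"
      "expectation (\<lambda>\<omega>. lp_norm q (\<delta> (W 0 \<omega>)) powr \<rho> + \<rho> * (z \<bullet> (D (W 0 \<omega>) *v \<delta> (W 0 \<omega>)))) < mean_value z + e"
      by (rule near_optimal_displacement[OF e, of z], rule that)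
    then have "P z \<delta>" unfolding P_def by (intro conjI exI[of _ K] allI)
    then show ?thesis by blast
  qed
  then have SOME_P: "P z (SOME \<delta>. P z \<delta>)" for z by (rule someI_ex)
  define \<delta> where "\<delta> z = (SOME \<delta>. P z \<delta>)" for z
  have P: "P z (\<delta> z)" for z unfolding \<delta>_def by (rule SOME_P)
  have \<delta>: "\<delta> z \<in> borel_measurable borel" "\<exists>K. \<forall>w. norm (\<delta> z w) \<le> K"
    "expectation (\<lambda>\<omega>. lp_norm q (\<delta> z (W 0 \<omega>)) powr \<rho> + \<rho> * (z \<bullet> (D (W 0 \<omega>) *v \<delta> z (W 0 \<omega>)))) < mean_value z + e" for z
    using P[of z] unfolding P_def by blast+
  define a where "a z = expectation (\<lambda>\<omega>. lp_norm q (\<delta> z (W 0 \<omega>)) powr \<rho>)" for z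
  define b where "b z = expectation (\<lambda>\<omega>. D (W 0 \<omega>) *v \<delta> z (W 0 \<omega>))" for z
  have ab: "a z + \<rho> * (z \<bullet> b z) < mean_value z + e" for z
  proof -
    obtain K where K: "\<And>w. norm (\<delta> z w) \<le> K" using \<delta>(2) by blast
    show ?thesis
      using \<delta>(3)[of z] integrable_displacement_cost[OF \<delta>(1) K] integrable_displacement[OF \<delta>(1) K]
      by (simp add: a_def b_def)
  qed
  define U where "U z = {z'. a z + \<rho> * (z' \<bullet> b z) < mean_value z' + e}" for z
  have "open (U z)" for z
    unfolding U_def by (intro open_Collect_less continuous_intros continuous_mean_value)
  moreover have "cball 0 B \<subseteq> (\<Union>z\<in>cball 0 B. U z)" using ab by (auto simp: U_def)
  ultimately obtain J where J: "J \<subseteq> cball 0 B" "finite J" "cball 0 B \<subseteq> (\<Union>z\<in>J. U z)"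
    using compactE_image[OF compact_cball, of "cball 0 B" U 0 B] by blast
  show ?thesis
  proof (rule that[of J \<delta>])
    fix z' :: "real ^ 'r" assume "norm z' \<le> B"
    then have "z' \<in> (\<Union>z\<in>J. U z)" using J(3) by (auto simp: subset_iff)
    then show "\<exists>z\<in>J. expectation (\<lambda>\<omega>. lp_norm q (\<delta> z (W 0 \<omega>)) powr \<rho>)
      + \<rho> * (z' \<bullet> expectation (\<lambda>\<omega>. D (W 0 \<omega>) *v \<delta> z (W 0 \<omega>))) < mean_value z' + e"
      by (auto simp: U_def a_def b_def)
  qed (use J \<delta> in auto)
qed

text \<open>Linear duality demands a bound for every multiplier, but the finite family serves only a
  ball. Coercivity at its boundary carries the bound outward along rays.\<close>

lemma high_probability_le_value:
  assumes e: "0 < e"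
  shows "high_probability M (\<lambda>n \<omega>. norm (normalized_sum n \<omega>) \<le> B \<longrightarrow>
    scaled_profile n \<omega> \<le> dual_value (normalized_sum n \<omega>) + e)"
proof -
  obtain K where K: "0 < K" "\<And>x z. norm x \<le> B \<Longrightarrow> K \<le> norm z \<Longrightarrow> dual_objective x z \<le> -1"
    by (rule dual_objective_coercive[of B], rule that)
  \<comment> \<open>\<open>e' \<le> 1 / 2\<close> lets the margin \<open>-1\<close> of coercivity
    absorb the error \<open>2 * e'\<close> on the sphere of radius \<open>K\<close>.\<close>
  define e' where "e' = min e 1 / 2"
  have e': "0 < e'" "e' \<le> 1 / 2" "2 * e' \<le> e" using e by (auto simp: e'_def)
  \<comment> \<open>Sampling errors below \<open>r\<close> in costs and in moments change the
    objective by at most \<open>r + \<rho> * K * r = e'\<close> for multipliers of norm at most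
    \<open>K\<close>.\<close>
  define r where "r = e' / (1 + \<rho> * K)"
  have rK: "0 < 1 + \<rho> * K" using K rho by (simp add: add_pos_pos)
  have r: "0 < r" "r + \<rho> * (K * r) = e'"
  proof -
    show "0 < r" using e' rK by (simp add: r_def)
    have "r * (1 + \<rho> * K) = e'" using rK by (simp add: r_def)
    then show "r + \<rho> * (K * r) = e'" by (simp add: algebra_simps)
  qed
  obtain J \<delta> where J: "finite J" "\<And>z. z \<in> J \<Longrightarrow> \<delta> z \<in> borel_measurable borel" "\<And>z. z \<in> J \<Longrightarrow> \<exists>K. \<forall>w. norm (\<delta> z w) \<le> K"
    and near: "\<And>z'. norm z' \<le> K \<Longrightarrow> \<exists>z\<in>(J :: (real ^ 'r) set). expectation (\<lambda>\<omega>. lp_norm q (\<delta> z (W 0 \<omega>)) powr \<rho>)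
      + \<rho> * (z' \<bullet> expectation (\<lambda>\<omega>. D (W 0 \<omega>) *v \<delta> z (W 0 \<omega>))) < mean_value z' + e'"
    by (rule finite_near_optimal_displacements[OF e'(1), of K], rule that)
  define a where "a z = expectation (\<lambda>\<omega>. lp_norm q (\<delta> z (W 0 \<omega>)) powr \<rho>)" for z
  define b where "b z = expectation (\<lambda>\<omega>. D (W 0 \<omega>) *v \<delta> z (W 0 \<omega>))" for z
  define an where "an n \<omega> z = (1 / real n) * (\<Sum>i=1..n. lp_norm q (\<delta> z (W i \<omega>)) powr \<rho>)" for n \<omega> z
  define bn where "bn n \<omega> z = (1 / real n) *\<^sub>R (\<Sum>i=1..n. (1 / step n) *\<^sub>R (f (W i \<omega> + step n *\<^sub>R \<delta> z (W i \<omega>)) - f (W i \<omega>)))" for n \<omega> z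
  have "high_probability M (\<lambda>n \<omega>. \<forall>z\<in>J. \<bar>an n \<omega> z - a z\<bar> < r \<and> norm (bn n \<omega> z - b z) < r)"
  proof (intro high_probability_finite_Ball high_probability_conj finite_measure_axioms J(1))
    fix z assume z: "z \<in> J"
    obtain Kz where Kz: "\<And>w. norm (\<delta> z w) \<le> Kz" using J(3)[OF z] by blast
    note [measurable] = J(2)[OF z] borel_measurable_lp_norm[OF q]
    show "high_probability M (\<lambda>n \<omega>. \<bar>an n \<omega> z - a z\<bar> < r)"
      unfolding an_def a_def
      by (rule high_probability_average[of "\<lambda>w. lp_norm q (\<delta> z w) powr \<rho>", OF _ integrable_displacement_cost[OF J(2)[OF z] Kz] r(1)]) measurable
    show "high_probability M (\<lambda>n \<omega>. norm (bn n \<omega> z - b z) < r)"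
      unfolding bn_def b_def by (rule high_probability_difference_quotient[OF J(2)[OF z] Kz r(1)])
  qed
  then show ?thesis
  proof (rule high_probability_mono)
    show "\<forall>\<^sub>F n in sequentially. \<forall>\<omega>\<in>space M. (\<forall>z\<in>J. \<bar>an n \<omega> z - a z\<bar> < r \<and> norm (bn n \<omega> z - b z) < r) \<longrightarrow>
      norm (normalized_sum n \<omega>) \<le> B \<longrightarrow> scaled_profile n \<omega> \<le> dual_value (normalized_sum n \<omega>) + e"
      using eventually_ge_at_top[of 1]
    proof (eventually_elim, intro ballI impI)
      fix n :: nat and \<omega> assume n: "1 \<le> n"
        and close: "\<forall>z\<in>J. \<bar>an n \<omega> z - a z\<bar> < r \<and> norm (bn n \<omega> z - b z) < r"
        and B: "norm (normalized_sum n \<omega>) \<le> B"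
      let ?x = "normalized_sum n \<omega>"
      have inside: "\<exists>z\<in>J. an n \<omega> z + \<rho> * (z' \<bullet> (?x + bn n \<omega> z)) \<le> dual_objective ?x z' + 2 * e'"
        if z': "norm z' \<le> K" for z'
      proof -
        obtain z where z: "z \<in> J" "a z + \<rho> * (z' \<bullet> b z) < mean_value z' + e'"
          using near[OF z'] unfolding a_def b_def by blast
        have "z' \<bullet> (bn n \<omega> z - b z) \<le> norm z' * norm (bn n \<omega> z - b z)" by (rule norm_cauchy_schwarz)
        also have "\<dots> \<le> K * r" using z' close z(1) K by (intro mult_mono) auto
        finally have "\<rho> * (z' \<bullet> (bn n \<omega> z - b z)) \<le> \<rho> * (K * r)" using rho by (intro mult_left_mono) auto
        moreover have "an n \<omega> z \<le> a z + r" using close z(1) by (auto simp: abs_less_iff)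
        ultimately have "an n \<omega> z + \<rho> * (z' \<bullet> (?x + bn n \<omega> z)) \<le> dual_objective ?x z' + 2 * e'"
          using z(2) r(2) unfolding dual_objective_def inner_add_right inner_diff_right distrib_left right_diff_distrib
          by linarith
        then show ?thesis using z(1) by blast
      qed
      have v: "0 \<le> dual_value ?x + e" using dual_value_nonneg[of ?x] e by linarith
      have "\<exists>z\<in>J. an n \<omega> z + \<rho> * (z' \<bullet> (?x + bn n \<omega> z)) \<le> dual_value ?x + e" for z'
      proof (cases "norm z' \<le> K")
        case True
        then obtain z where "z \<in> J" "an n \<omega> z + \<rho> * (z' \<bullet> (?x + bn n \<omega> z)) \<le> dual_objective ?x z' + 2 * e'"
          using inside by blast
        then show ?thesis using dual_objective_le_value[of ?x z'] e'(3) by (intro bexI[of _ z]) linarith+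
      next
        case False
        \<comment> \<open>At the point \<open>z0\<close> of the sphere on the ray through
          \<open>z'\<close> some field has a nonpositive total. Its cost is nonnegative, so its
          linear term is nonpositive and only decreases when \<open>z0\<close> is stretched to
          \<open>z'\<close>.\<close>
        define c where "c = norm z' / K"
        have c: "1 \<le> c" using False K by (simp add: c_def)
        define z0 where "z0 = (1 / c) *\<^sub>R z'"
        have z0: "norm z0 = K" "z' = c *\<^sub>R z0" using False K c by (auto simp: z0_def c_def)
        obtain z where z: "z \<in> J" "an n \<omega> z + \<rho> * (z0 \<bullet> (?x + bn n \<omega> z)) \<le> dual_objective ?x z0 + 2 * e'"
          using inside[of z0] z0(1) by auto
        note z(2)
        also have "dual_objective ?x z0 + 2 * e' \<le> 0" using K(2)[OF B, of z0] z0(1) e'(2) by simp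
        finally have le: "an n \<omega> z + \<rho> * (z0 \<bullet> (?x + bn n \<omega> z)) \<le> 0" .
        have "0 \<le> an n \<omega> z" unfolding an_def by (intro mult_nonneg_nonneg sum_nonneg) auto
        then have neg: "\<rho> * (z0 \<bullet> (?x + bn n \<omega> z)) \<le> 0" using le by linarith
        have "\<rho> * (z' \<bullet> (?x + bn n \<omega> z)) = c * (\<rho> * (z0 \<bullet> (?x + bn n \<omega> z)))" by (simp add: z0(2))
        also have "\<dots> \<le> 1 * (\<rho> * (z0 \<bullet> (?x + bn n \<omega> z)))" using c neg by (rule mult_right_mono_neg)
        finally show ?thesis using le v z(1) by (intro bexI[of _ z]) auto
      qed
      then show "scaled_profile n \<omega> \<le> dual_value ?x + e"
        unfolding an_def bn_def
        by (intro scaled_profile_le[OF n step_eq[OF n] J(1) v])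
    qed
  qed
qed

text \<open>The lower bound holds for one multiplier at a time, while the maximizer varies with the
  sample. Each multiplier stays optimal up to \<open>e / 2\<close> on an open set, so finitely many
  serve a whole ball.\<close>

lemma high_probability_ge_value:
  assumes e: "0 < e"
  shows "high_probability M (\<lambda>n \<omega>. norm (normalized_sum n \<omega>) \<le> B \<longrightarrow>
    dual_value (normalized_sum n \<omega>) - e \<le> scaled_profile n \<omega>)"
proof -
  have e2: "0 < e / 2" using e by simp
  define U where "U z = {x. dual_value x < dual_objective x z + e / 2}" for z
  have U_open: "open (U z)" for z
    unfolding U_def dual_objective_def by (intro open_Collect_less continuous_intros continuous_dual_value)
  have cover: "cball 0 B \<subseteq> (\<Union>z\<in>UNIV. U z)"
  proof
    fix x :: "real ^ 'r"
    obtain z where "dual_value x = dual_objective x z" using dual_value_attained by blast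
    then have "x \<in> U z" using e by (simp add: U_def)
    then show "x \<in> (\<Union>z\<in>UNIV. U z)" by blast
  qed
  obtain Z where Z: "finite Z" "cball 0 B \<subseteq> (\<Union>z\<in>Z. U z)"
    by (rule compactE_image[OF compact_cball U_open cover], rule that)
  have "high_probability M (\<lambda>n \<omega>. \<forall>z\<in>Z. dual_objective (normalized_sum n \<omega>) z - e / 2 \<le> scaled_profile n \<omega>)"
    by (intro high_probability_finite_Ball finite_measure_axioms Z(1) high_probability_ge_objective e2)
  then show ?thesis
  proof (rule high_probability_mono, intro always_eventually allI ballI impI)
    fix n \<omega> assume ge: "\<forall>z\<in>Z. dual_objective (normalized_sum n \<omega>) z - e / 2 \<le> scaled_profile n \<omega>"
      and B: "norm (normalized_sum n \<omega>) \<le> B"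
    then have "normalized_sum n \<omega> \<in> (\<Union>z\<in>Z. U z)" by (intro subsetD[OF Z(2)]) simp
    then obtain z where z: "z \<in> Z" "normalized_sum n \<omega> \<in> U z" by blast
    then have "dual_value (normalized_sum n \<omega>) < dual_objective (normalized_sum n \<omega>) z + e / 2"
      by (simp add: U_def)
    moreover have "dual_objective (normalized_sum n \<omega>) z - e / 2 \<le> scaled_profile n \<omega>" using ge z(1) by blast
    ultimately show "dual_value (normalized_sum n \<omega>) - e \<le> scaled_profile n \<omega>" by simp
  qed
qed

lemma high_probability_close:
  assumes e: "0 < e"
  shows "high_probability M (\<lambda>n \<omega>. \<bar>scaled_profile n \<omega> - dual_value (normalized_sum n \<omega>)\<bar> \<le> e)"
proof (rule high_probability_tight[where T="\<lambda>B n \<omega>. norm (normalized_sum n \<omega>) \<le> B"])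
  show "finite_measure M" by (rule finite_measure_axioms)
  show "{\<omega> \<in> space M. \<not> norm (normalized_sum n \<omega>) \<le> B} \<in> sets M" for B n by measurable
  show "\<exists>B. \<forall>n. prob {\<omega> \<in> space M. \<not> norm (normalized_sum n \<omega>) \<le> B} \<le> d" if "0 < d" for d
    using normalized_sum_tight[OF borel_measurable_f square mean_zero that]
    by (simp add: normalized_sum_def not_le)
  show "high_probability M (\<lambda>n \<omega>. norm (normalized_sum n \<omega>) \<le> B \<longrightarrow>
      \<bar>scaled_profile n \<omega> - dual_value (normalized_sum n \<omega>)\<bar> \<le> e)" for B
    by (rule high_probability_mono[OF high_probability_conj[OF finite_measure_axioms
          high_probability_le_value[OF e, of B] high_probability_ge_value[OF e, of B]]])
       (auto simp: abs_le_iff intro!: always_eventually)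
qed

end

text \<open>Slutsky's principle: uniform continuity transfers closeness outside a small event, and
  boundedness controls the contribution of that event.\<close>

lemma (in prob_space) expectation_difference_tendsto_0:
  fixes X Y :: "nat \<Rightarrow> 'a \<Rightarrow> real" and k :: "real \<Rightarrow> real"
  assumes X[measurable]: "\<And>n. X n \<in> borel_measurable M" and Y[measurable]: "\<And>n. Y n \<in> borel_measurable M"
    and uc: "uniformly_continuous_on UNIV k" and b: "\<And>x. \<bar>k x\<bar> \<le> B"
    and close: "\<And>e. 0 < e \<Longrightarrow> high_probability M (\<lambda>n \<omega>. \<bar>X n \<omega> - Y n \<omega>\<bar> \<le> e)"
  shows "(\<lambda>n. expectation (\<lambda>\<omega>. k (X n \<omega>)) - expectation (\<lambda>\<omega>. k (Y n \<omega>))) \<longlonglongrightarrow> 0"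
proof (rule LIMSEQ_I)
  fix r :: real assume "0 < r"
  have [measurable]: "k \<in> borel_measurable borel"
    by (rule borel_measurable_continuous_onI[OF uniformly_continuous_imp_continuous[OF uc]])
  have "0 \<le> B" using b[of 0] by linarith
  obtain d where "0 < d" "\<forall>x\<in>UNIV. \<forall>y\<in>UNIV. dist y x < d \<longrightarrow> dist (k y) (k x) < r / 2"
    using uc[unfolded uniformly_continuous_on_def, THEN spec, THEN mp, OF half_gt_zero[OF \<open>0 < r\<close>]] by (elim exE conjE)
  then have d: "0 < d" "\<And>x y. dist y x < d \<Longrightarrow> dist (k y) (k x) < r / 2"
    by simp_all
  \<comment> \<open>Keeps \<open>2 * B * e\<close> strictly below \<open>r / 2\<close>, also for
    \<open>B = 0\<close>.\<close>
  define e where "e = r / (4 * B + 4)"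
  have e: "0 < e" "2 * B * e < r / 2"
  proof -
    show "0 < e" using \<open>0 < r\<close> \<open>0 \<le> B\<close> by (simp add: e_def)
    have "(4 * B + 4) * e = r" using \<open>0 \<le> B\<close> by (simp add: e_def)
    then have "4 * (B * e) + 4 * e = r" by (simp only: distrib_right mult.assoc)
    then show "2 * B * e < r / 2" using \<open>0 < e\<close> unfolding mult.assoc by linarith
  qed
  have "0 < d / 2" using d(1) by simp
  from close[OF this, unfolded high_probability_def, rule_format, OF e(1)]
  have "\<forall>\<^sub>F n in sequentially. norm (expectation (\<lambda>\<omega>. k (X n \<omega>)) - expectation (\<lambda>\<omega>. k (Y n \<omega>)) - 0) < r"
  proof eventually_elim
    case (elim n)
    then obtain A where A[measurable]: "A \<in> sets M" and "prob A \<le> e"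
      and close: "\<forall>\<omega>\<in>space M - A. \<bar>X n \<omega> - Y n \<omega>\<bar> \<le> d / 2" by blast
    have int: "integrable M (\<lambda>\<omega>. k (X n \<omega>))" "integrable M (\<lambda>\<omega>. k (Y n \<omega>))"
      by (rule integrable_const_bound[where B=B]; simp add: b)+
    have "\<bar>expectation (\<lambda>\<omega>. k (X n \<omega>)) - expectation (\<lambda>\<omega>. k (Y n \<omega>))\<bar> = \<bar>expectation (\<lambda>\<omega>. k (X n \<omega>) - k (Y n \<omega>))\<bar>"
      using int by simp
    also have "\<dots> \<le> expectation (\<lambda>\<omega>. \<bar>k (X n \<omega>) - k (Y n \<omega>)\<bar>)" by (rule integral_abs_bound)
    also have "\<dots> \<le> expectation (\<lambda>\<omega>. r / 2 + 2 * B * indicator A \<omega>)"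
    proof (rule integral_mono)
      show "integrable M (\<lambda>\<omega>. \<bar>k (X n \<omega>) - k (Y n \<omega>)\<bar>)" using int by simp
      show "integrable M (\<lambda>\<omega>. r / 2 + 2 * B * indicator A \<omega>)"
        by (intro Bochner_Integration.integrable_add integrable_mult_right) (auto simp: emeasure_eq_measure)
      fix \<omega> assume "\<omega> \<in> space M"
      show "\<bar>k (X n \<omega>) - k (Y n \<omega>)\<bar> \<le> r / 2 + 2 * B * indicator A \<omega>"
      proof (cases "\<omega> \<in> A")
        case True
        then have "r / 2 + 2 * B * indicator A \<omega> = r / 2 + 2 * B" by simp
        then show ?thesis using b[of "X n \<omega>"] b[of "Y n \<omega>"] \<open>0 < r\<close> by linarith
      next
        case False
        then have "dist (X n \<omega>) (Y n \<omega>) < d"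
          using close[rule_format, of \<omega>] \<open>\<omega> \<in> space M\<close> d(1) by (simp add: dist_real_def)
        then show ?thesis using d(2)[of "X n \<omega>" "Y n \<omega>"] False by (simp add: dist_real_def)
      qed
    qed
    also have "\<dots> = r / 2 + 2 * B * prob A"
      by (subst Bochner_Integration.integral_add) (auto simp: emeasure_eq_measure prob_space)
    also have "\<dots> \<le> r / 2 + 2 * B * e"
      using \<open>prob A \<le> e\<close> \<open>0 \<le> B\<close> by (intro add_left_mono mult_left_mono) auto
    finally show ?case using e(2) by simp
  qed
  then show "\<exists>n0. \<forall>n\<ge>n0. norm (expectation (\<lambda>\<omega>. k (X n \<omega>)) - expectation (\<lambda>\<omega>. k (Y n \<omega>)) - 0) < r"
    by (simp add: eventually_sequentially)
qed

section \<open>Convergence in distribution\<close>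

context sampled_profile
begin

lemma scaled_profile_converges:
  assumes H: "normal_vector N H 0 (\<chi> i j. \<integral>\<omega>. f (W 0 \<omega>) $ i * f (W 0 \<omega>) $ j \<partial>M)"
  shows "converges_in_distribution M scaled_profile N (\<lambda>\<omega>. dual_value (H \<omega>))"
proof -
  have N: "prob_space N" and H_meas[measurable]: "H \<in> borel_measurable N"
    using H by (auto simp: normal_vector_def)
  note scaled_profile_measurable[measurable]
  have value_meas[measurable]: "dual_value \<in> borel_measurable borel"
    by (rule borel_measurable_continuous_onI[OF continuous_dual_value])
  have "weak_conv_m (\<lambda>n. distr M borel (scaled_profile n)) (distr N borel (\<lambda>\<omega>. dual_value (H \<omega>)))"
  proof (rule integral_cts_step_conv_imp_weak_conv)
    show "real_distribution (distr M borel (scaled_profile n))" for n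
      by (rule real_distribution_distr) measurable
    show "real_distribution (distr N borel (\<lambda>\<omega>. dual_value (H \<omega>)))"
      by (rule prob_space.real_distribution_distr[OF N]) measurable
    \<comment> \<open>Continuous steps suffice to test weak convergence on the line, and they have
      the uniform continuity that the comparison of expectations requires.\<close>
    fix x y :: real assume xy: "x < y"
    let ?k = "cts_step x y"
    have uc: "uniformly_continuous_on UNIV ?k" by (rule cts_step_uniformly_continuous[OF xy])
    have k_cont: "continuous_on UNIV ?k" by (rule uniformly_continuous_imp_continuous[OF uc])
    have [measurable]: "?k \<in> borel_measurable borel" by (rule borel_measurable_continuous_onI[OF k_cont])
    have k_bound: "\<bar>?k u\<bar> \<le> 1" for u using xy by (auto simp: cts_step_def)
    have clt: "(\<lambda>n. expectation (\<lambda>\<omega>. ?k (dual_value (normalized_sum n \<omega>)))) \<longlonglongrightarrow> (\<integral>\<omega>. ?k (dual_value (H \<omega>)) \<partial>N)"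
      unfolding normalized_sum_def
      by (rule multivariate_central_limit_theorem[OF borel_measurable_f square mean_zero H _ k_bound])
         (rule continuous_on_compose2[OF k_cont continuous_dual_value], simp)
    have "(\<lambda>n. expectation (\<lambda>\<omega>. ?k (scaled_profile n \<omega>)) - expectation (\<lambda>\<omega>. ?k (dual_value (normalized_sum n \<omega>)))) \<longlonglongrightarrow> 0"
      by (rule expectation_difference_tendsto_0[OF _ _ uc k_bound high_probability_close]) measurable
    from tendsto_add[OF this clt]
    have "(\<lambda>n. expectation (\<lambda>\<omega>. ?k (scaled_profile n \<omega>))) \<longlonglongrightarrow> (\<integral>\<omega>. ?k (dual_value (H \<omega>)) \<partial>N)"
      by simp
    then show "(\<lambda>n. integral\<^sup>L (distr M borel (scaled_profile n)) ?k) \<longlonglongrightarrow> integral\<^sup>L (distr N borel (\<lambda>\<omega>. dual_value (H \<omega>))) ?k"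
      by (simp add: integral_distr)
  qed
  then show ?thesis by (simp add: converges_in_distribution_def)
qed

end

text \<open>Condition A5 is silent where \<open>lp_norm q w < 1\<close>; continuity of the Jacobian
  on a compact ball fills this gap.\<close>

lemma smooth_moment_growth:
  fixes D :: "real ^ 'm \<Rightarrow> real ^ 'm ^ 'r"
  assumes p: "1 \<le> p" and q: "1 \<le> q" and rho: "1 < \<rho>" and kappa: "0 < \<kappa>"
    and cont: "continuous_on UNIV D"
    and bound: "\<And>w. 1 \<le> lp_norm q w \<Longrightarrow> matrix_lp_norm p (D w) \<le> \<kappa> * lp_norm q w powr (\<rho> - 1)"
  obtains C where "0 \<le> C" "\<And>w v. norm (D w *v v) \<le> C * (1 + norm w powr (\<rho> - 1)) * norm v"
proof -
  define m where "m = real CARD('m)"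
  define r where "r = real CARD('r)"
  have mr: "1 \<le> m" "1 \<le> r" by (simp_all add: m_def r_def Suc_le_eq)
  \<comment> \<open>\<open>lp_norm q w < 1\<close> implies \<open>norm w \<le> m\<close>, so the
    ball of radius \<open>m\<close> contains the whole region left open by A5.\<close>
  have "compact (D ` cball 0 m)"
    by (intro compact_continuous_image continuous_on_subset[OF cont]) auto
  then have "bounded (D ` cball 0 m)" by (rule compact_imp_bounded)
  then obtain B where "\<forall>x\<in>D ` cball 0 m. norm x \<le> B" unfolding bounded_iff by blast
  then have B: "norm (D w) \<le> B" if "norm w \<le> m" for w
    using that by simp
  have "norm (D 0) \<le> B" using B[of 0] mr by simp
  then have "0 \<le> B" by (rule order_trans[OF norm_ge_zero])
  define C where "C = r * B + r * m * (\<kappa> * m powr (\<rho> - 1))"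
  have C_parts: "0 \<le> r * B" "0 \<le> r * m * (\<kappa> * m powr (\<rho> - 1))" using mr kappa \<open>0 \<le> B\<close> by auto
  show ?thesis
  proof (rule that[of C])
    show "0 \<le> C" unfolding C_def using C_parts by linarith
    fix w v :: "real ^ 'm"
    show "norm (D w *v v) \<le> C * (1 + norm w powr (\<rho> - 1)) * norm v"
    proof (cases "1 \<le> lp_norm q w")
      case True
      have "norm (D w *v v) \<le> r * m * matrix_lp_norm p (D w) * norm v"
        unfolding r_def m_def by (rule norm_matrix_vector_le_matrix_lp_norm[OF p])
      also have "\<dots> \<le> r * m * (\<kappa> * lp_norm q w powr (\<rho> - 1)) * norm v"
        using bound[OF True] mr by (intro mult_right_mono mult_left_mono) auto
      also have "\<dots> \<le> r * m * (\<kappa> * (m * norm w) powr (\<rho> - 1)) * norm v"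
        using lp_norm_le_norm[OF q, of w] mr kappa rho unfolding m_def[symmetric]
        by (intro mult_right_mono mult_left_mono powr_mono2) auto
      also have "\<dots> = r * m * (\<kappa> * m powr (\<rho> - 1)) * norm w powr (\<rho> - 1) * norm v"
        using mr by (simp add: powr_mult)
      also have "\<dots> \<le> C * (1 + norm w powr (\<rho> - 1)) * norm v"
        using C_parts unfolding C_def by (intro mult_right_mono mult_mono) auto
      finally show ?thesis .
    next
      case False
      have "norm w \<le> m * lp_norm q w" unfolding m_def by (rule norm_le_lp_norm[OF q])
      also have "\<dots> \<le> m * 1" using False mr by (intro mult_left_mono) auto
      finally have DB: "norm (D w) \<le> B" using B by simp
      have "norm (D w *v v) \<le> (\<Sum>i\<in>UNIV. \<bar>(D w *v v) $ i\<bar>)" by (rule norm_le_l1_cart)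
      also have "\<dots> \<le> (\<Sum>i\<in>(UNIV :: 'r set). B * norm v)"
      proof (rule sum_mono)
        fix i
        have "\<bar>(D w *v v) $ i\<bar> = \<bar>D w $ i \<bullet> v\<bar>"
          by (simp add: matrix_vector_mult_def inner_vec_def)
        also have "\<dots> \<le> norm (D w $ i) * norm v" by (rule Cauchy_Schwarz_ineq2)
        also have "\<dots> \<le> B * norm v"
          using order_trans[OF Finite_Cartesian_Product.norm_nth_le DB] by (intro mult_right_mono) auto
        finally show "\<bar>(D w *v v) $ i\<bar> \<le> B * norm v" .
      qed
      also have "\<dots> = r * B * 1 * norm v" by (simp add: r_def)
      also have "\<dots> \<le> C * (1 + norm w powr (\<rho> - 1)) * norm v"
        using C_parts unfolding C_def by (intro mult_right_mono mult_mono) auto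
      finally show ?thesis .
    qed
  qed
qed

theorem proposition5:
  fixes M :: "'a measure" and N :: "'b measure"
    and W :: "nat \<Rightarrow> 'a \<Rightarrow> real ^ 'm"
    and h :: "real ^ 'm \<Rightarrow> real ^ 'l \<Rightarrow> real ^ 'r"
    and Dh :: "real ^ 'm \<Rightarrow> real ^ 'm ^ 'r"
    and \<theta> :: "real ^ 'l"
    and \<rho> \<kappa> :: real and p q :: ennreal
    and \<kappa>' :: "real ^ 'm \<Rightarrow> real"
    and H :: "'b \<Rightarrow> real ^ 'r"
  assumes "prob_space M"
    (* W 0 is the generic vector W; the samples are W 1, W 2, ... *)
    and indep: "prob_space.indep_vars M (\<lambda>_. borel) W UNIV"
    and ident: "\<And>i. distr M borel (W i) = distr M borel (W 0)"
    and samples_distinct: "AE \<omega> in M. inj_on (\<lambda>i. W i \<omega>) {1..}"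
    and rho: "1 < \<rho>"
    and A1: "1 \<le> q" "1 / p + 1 / q = 1"
    and A2: "integrable M (\<lambda>\<omega>. (norm (h (W 0 \<omega>) \<theta>))\<^sup>2)"
            "(\<integral>\<omega>. h (W 0 \<omega>) \<theta> \<partial>M) = 0"
    and A3: "\<And>w. ((\<lambda>u. h u \<theta>) has_derivative (\<lambda>v. Dh w *v v)) (at w)"
            "continuous_on UNIV Dh"
    and A4: "\<And>\<zeta>. \<zeta> \<noteq> 0 \<Longrightarrow> 0 < measure M {\<omega> \<in> space M. 0 < lp_norm p (\<zeta> v* Dh (W 0 \<omega>))}"
    and A5: "0 < \<kappa>"
            "\<And>w. 1 \<le> lp_norm q w \<Longrightarrow> matrix_lp_norm p (Dh w) \<le> \<kappa> * lp_norm q w powr (\<rho> - 1)"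
            "integrable M (\<lambda>\<omega>. lp_norm q (W 0 \<omega>) powr \<rho>)"
    and A6: "\<And>w. 0 \<le> \<kappa>' w"
            "\<And>w \<Delta>. lp_norm q \<Delta> \<le> 1 \<Longrightarrow>
               matrix_lp_norm p (Dh (w + \<Delta>) - Dh w) \<le> \<kappa>' w * lp_norm q \<Delta>"
            "\<And>c. 0 < c \<Longrightarrow> c \<le> max 2 (\<rho> / (\<rho> - 1)) \<Longrightarrow>
               integrable M (\<lambda>\<omega>. \<kappa>' (W 0 \<omega>) powr c)"
    and H: "normal_vector N H 0
              (\<chi> i j. \<integral>\<omega>. h (W 0 \<omega>) \<theta> $ i * h (W 0 \<omega>) \<theta> $ j \<partial>M)"
  defines "R \<equiv> \<lambda>n \<omega>. profile_function (\<lambda>u w. lp_norm q (u - w) powr \<rho>) h n (\<lambda>i. W i \<omega>) \<theta>"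
    and "G \<equiv> limit_objective M (\<lambda>\<omega>. Dh (W 0 \<omega>)) p \<rho>"
  shows "(\<forall>n\<ge>1. \<forall>\<omega>\<in>space M. R n \<omega> < \<infinity>) \<and>
         (\<forall>x. \<exists>\<zeta>. \<forall>\<zeta>'. G x \<zeta>' \<le> G x \<zeta>) \<and>
         converges_in_distribution
           M (\<lambda>n \<omega>. real n powr (\<rho> / 2) * enn2real (R n \<omega>))
           N (\<lambda>\<omega>. SUP \<zeta>. G (H \<omega>) \<zeta>)"
proof -
  interpret prob_space M by fact
  have p: "1 \<le> p" by (rule conjugate_exponent_ge_1[OF A1])
  obtain C where C: "0 \<le> C" "\<And>w v. norm (Dh w *v v) \<le> C * (1 + norm w powr (\<rho> - 1)) * norm v"
    by (rule smooth_moment_growth[OF p A1(1) rho A5(1) A3(2) A5(2)], assumption, rule that)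
  have W[measurable]: "W 0 \<in> borel_measurable M"
    using indep by (simp add: indep_vars_def2)
  have moment: "integrable M (\<lambda>\<omega>. norm (W 0 \<omega>) powr \<rho>)"
  proof (rule Bochner_Integration.integrable_bound)
    show "integrable M (\<lambda>\<omega>. real CARD('m) powr \<rho> * lp_norm q (W 0 \<omega>) powr \<rho>)"
      using A5(3) by simp
    have "norm w powr \<rho> \<le> real CARD('m) powr \<rho> * lp_norm q w powr \<rho>" for w :: "real ^ 'm"
      using powr_mono2[OF _ _ norm_le_lp_norm[OF A1(1), of w], of \<rho>] rho by (simp add: powr_mult)
    then show "AE \<omega> in M. norm (norm (W 0 \<omega>) powr \<rho>) \<le> norm (real CARD('m) powr \<rho> * lp_norm q (W 0 \<omega>) powr \<rho>)"
      by simp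
  qed measurable
  interpret sampled_profile M W "\<lambda>w. h w \<theta>" Dh p q \<rho> C h \<theta>
    by unfold_locales (rule indep ident rho A1 A2 A3 A4 C moment refl, assumption?)+
  \<comment> \<open>The limit objective is the dual objective with the Legendre transform written
    out, so attainment and the limit law carry over.\<close>
  have G: "G x \<zeta> = dual_objective x \<zeta>" for x \<zeta>
    by (simp add: G_def limit_objective_def dual_objective_def mean_value_def local_value_def)
      (simp add: algebra_simps)
  have "R n \<omega> < \<infinity>" if "1 \<le> n" for n \<omega>
    using profile_finite[OF that] by (simp add: R_def profile_def)
  moreover have "\<exists>\<zeta>. \<forall>\<zeta>'. G x \<zeta>' \<le> G x \<zeta>" for x
    unfolding G by (rule dual_objective_attained)
  moreover have "converges_in_distribution M (\<lambda>n \<omega>. real n powr (\<rho> / 2) * enn2real (R n \<omega>)) N (\<lambda>\<omega>. SUP \<zeta>. G (H \<omega>) \<zeta>)"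
    using scaled_profile_converges[OF H]
    unfolding scaled_profile_def[abs_def] profile_def dual_value_def[abs_def] R_def G .
  ultimately show ?thesis by blast
qed

end
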